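(* Let $S\ge 1$ be an integer and let $\boldsymbol{x}_1,\boldsymbol{x}_2,\dots$ be i.i.d. with density $f>0$ on the support $[0,\mathscr{U})$, $\mathscr{U}\in(0,\infty]$; write $L=\log f$. Let $h=h_n>0$ satisfy $h\to0$ and $nh^3\to\infty$ as $n\to\infty$, and let the evaluation point $x$ and $z=\min(x/h,1)$ be as in the context, with $x_0=\lim_{n\to\infty} x$. Assume $L$ is $S+1$ times continuously differentiable in a neighborhood of $x_0$ (relative to $[0,\mathscr{U})$). With $\beta,\beta_{S+1},\hat{\boldsymbol\beta},\tilde\beta,\Omega,b,\Lambda,V$ as defined in the context, $$\Lambda(\tilde\beta-\beta)=h^S\beta_{S+1}\,b+o_p(h^S),$$ and $$\sqrt{nh^3}\,\Lambda(\hat{\boldsymbol\beta}-\tilde\beta)\ \xrightarrow{d}\ N\Big(0,\ (\Omega^{\top}V^{-1}\Omega)^{-1}/f(x_0)\Big).$$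
   Context: Evaluation point: either $x>0$ is a fixed point of $(0,\mathscr{U})$ (then $z=1$ for all large $n$ and $x_0=x$), or $x=x_n=zh_n$ for a fixed $z\in[0,1]$ (then $x_0=0$). In both cases $z=\min(x/h,1)$ is constant for large $n$; the objects below use this value of $z$. Derivatives at $0$ are one-sided. Derivatives: $\beta_s=L^{(s)}(x)$ for $s=1,\dots,S+1$ and $\beta=(\beta_1,\dots,\beta_S)^\top$. Functions: $g=(g_1,\dots,g_S)^\top$ with $g_j(t)=(t+z)^j(t-1)\,\mathbb 1(-z\le t\le 1)$; $g_j'$ is its derivative on $(-z,1)$, and $0$ outside $[-z,1]$. Estimator: $\hat{\boldsymbol\beta}=(\hat{\boldsymbol\beta}_1,\dots,\hat{\boldsymbol\beta}_S)^\top$ is the solution (unique with probability tending to one; arbitrary otherwise) of the linear system, for $j=1,\dots,S$, $$\frac1{nh^2}\sum_{i=1}^n g_j'\Big(\frac{\boldsymbol x_i-x}{h}\Big)=-\sum_{s=1}^S\hat{\boldsymbol\beta}_s\,\frac1{nh}\sum_{i=1}^n g_j\Big(\frac{\boldsymbol x_i-x}{h}\Big)\frac{(\boldsymbol x_i-x)^{s-1}}{(s-1)!}.$$ Centering: $\tilde\beta=R_{hx}^{-1}\ell_{hx}$ (defined for $n$ large), where $\ell_{hx}\in\mathbb R^S$ and $R_{hx}\in\mathbb R^{S\times S}$ have elements $$\ell_{hxj}=\mathbb E\Big(\tfrac1h g_j'\big(\tfrac{\boldsymbol x_1-x}{h}\big)\,\Big|\,x-zh\le\boldsymbol x_1\le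 x+h\Big),\qquad R_{hxjs}=-\mathbb E\Big(g_j\big(\tfrac{\boldsymbol x_1-x}{h}\big)\tfrac{(\boldsymbol x_1-x)^{s-1}}{(s-1)!}\,\Big|\,x-zh\le\boldsymbol x_1\le x+h\Big).$$ Constants: $\Omega_{js}=-\frac1{(s-1)!}\int_{-z}^1 g_j(t)t^{s-1}\,dt$ for $j,s\ge1$; $\Omega=(\Omega_{js})_{j,s=1}^S$; $b=\Omega^{-1}(\Omega_{1,S+1},\dots,\Omega_{S,S+1})^\top$; $\Lambda=\mathrm{diag}(1,h,\dots,h^{S-1})$; $V\in\mathbb R^{S\times S}$ has $(j,s)$ element $\int_{-z}^1 g_j'(t)g_s'(t)\,dt=\frac{2js(1+z)^{j+s+1}}{(j+s+1)(j+s)(j+s-1)}$. *)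

theory Defs
  imports "HOL-Probability.Probability"
begin

definition conv_in_distribution ::
  "'a measure \<Rightarrow> (nat \<Rightarrow> 'a \<Rightarrow> 'b::topological_space) \<Rightarrow> 'b measure \<Rightarrow> bool" where
  "conv_in_distribution M Y \<mu> \<longleftrightarrow>
     (\<forall>\<phi>::'b \<Rightarrow> real. continuous_on UNIV \<phi> \<longrightarrow> bounded (range \<phi>) \<longrightarrow>
        (\<lambda>n. LINT \<omega>|M. \<phi> (Y n \<omega>)) \<longlonglongrightarrow> (LINT y|\<mu>. \<phi> y))"

definition little_op ::
  "'a measure \<Rightarrow> (nat \<Rightarrow> 'a \<Rightarrow> 'b::real_normed_vector) \<Rightarrow> (nat \<Rightarrow> real) \<Rightarrow> bool" where
  "little_op M Y a \<longleftrightarrow>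
     (\<forall>\<epsilon>>0. (\<lambda>n. measure M {\<omega>\<in>space M. norm (Y n \<omega>) > \<epsilon> * a n}) \<longlonglongrightarrow> 0)"

text \<open>The normal law on \<open>\<real>\<^sup>S\<close> with mean \<open>m\<close> and nonsingular covariance matrix \<open>\<Sigma>\<close>, by its density.\<close>

definition mvnormal :: "real^'s \<Rightarrow> real^'s^'s \<Rightarrow> (real^'s) measure" where
  "mvnormal m \<Sigma> = density lborel (\<lambda>y. ennreal
     (exp (- ((y - m) \<bullet> (matrix_inv \<Sigma> *v (y - m))) / 2) / sqrt ((2 * pi) ^ CARD('s) * det \<Sigma>)))"

text \<open>
  Derivatives are taken within \<open>A\<close>; for \<open>A = [0,U)\<close> they are the ordinary ones
  in the interior and one-sided at \<open>0\<close>.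
\<close>

definition nth_deriv_within :: "real set \<Rightarrow> nat \<Rightarrow> (real \<Rightarrow> real) \<Rightarrow> real \<Rightarrow> real" where
  "nth_deriv_within A k u = ((\<lambda>v y. vector_derivative v (at y within A)) ^^ k) u"

definition cont_diff_near :: "real set \<Rightarrow> nat \<Rightarrow> (real \<Rightarrow> real) \<Rightarrow> real \<Rightarrow> bool" where
  "cont_diff_near A m u y0 \<longleftrightarrow>
     (\<exists>e>0. (\<forall>k<m. \<forall>y\<in>A \<inter> ball y0 e. nth_deriv_within A k u differentiable (at y within A)) \<and>
            continuous_on (A \<inter> ball y0 e) (nth_deriv_within A m u))"

definition halfopen :: "ereal \<Rightarrow> real set" where
  "halfopen U = {y. 0 \<le> y \<and> ereal y < U}"

text \<open>
  Vectors and matrices of dimension \<open>S = CARD('s)\<close> are indexed by the ordered finite type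
  \<open>'s\<close>; \<open>pos\<close> is the order isomorphism from \<open>'s\<close> onto \<open>{1..S}\<close>.
\<close>

definition pos :: "'s::{finite,linorder} \<Rightarrow> nat" where
  "pos k = card {..k}"

definition gfun :: "real \<Rightarrow> nat \<Rightarrow> real \<Rightarrow> real" where
  "gfun z j t = (if - z \<le> t \<and> t \<le> 1 then (t + z) ^ j * (t - 1) else 0)"

text \<open>
  \<open>g\<^sub>j\<close> need not be differentiable at \<open>-z\<close> and \<open>1\<close>; the value \<open>0\<close> used there is
  immaterial because the observations have a density.
\<close>

definition gder :: "real \<Rightarrow> nat \<Rightarrow> real \<Rightarrow> real" where
  "gder z j t = (if - z < t \<and> t < 1 then deriv (gfun z j) t else 0)"

text \<open>
  \<open>c\<close> solves the linear system built from the observations \<open>obs 0, \<dots>, obs (n - 1)\<close>,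
  with bandwidth \<open>h\<close> at the point \<open>x\<close>.
\<close>

definition solves_system ::
  "real \<Rightarrow> nat \<Rightarrow> real \<Rightarrow> real \<Rightarrow> (nat \<Rightarrow> real) \<Rightarrow> real^'s::{finite,linorder} \<Rightarrow> bool" where
  "solves_system z n h x obs c \<longleftrightarrow>
     (\<forall>j::'s. 1 / (real n * h\<^sup>2) * (\<Sum>i<n. gder z (pos j) ((obs i - x) / h)) =
        - (\<Sum>s\<in>UNIV. c $ s * (1 / (real n * h) *
            (\<Sum>i<n. gfun z (pos j) ((obs i - x) / h) * ((obs i - x) ^ (pos s - 1) / fact (pos s - 1))))))"

definition window_measure :: "'a measure \<Rightarrow> ('a \<Rightarrow> real) \<Rightarrow> real \<Rightarrow> real \<Rightarrow> real \<Rightarrow> 'a measure" where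
  "window_measure M X z h x = uniform_measure M {\<omega>\<in>space M. x - z * h \<le> X \<omega> \<and> X \<omega> \<le> x + h}"

definition ell_vec ::
  "'a measure \<Rightarrow> ('a \<Rightarrow> real) \<Rightarrow> real \<Rightarrow> real \<Rightarrow> real \<Rightarrow> real^'s::{finite,linorder}" where
  "ell_vec M X z h x =
     (\<chi> j. LINT \<omega>|window_measure M X z h x. 1 / h * gder z (pos j) ((X \<omega> - x) / h))"

definition R_mat ::
  "'a measure \<Rightarrow> ('a \<Rightarrow> real) \<Rightarrow> real \<Rightarrow> real \<Rightarrow> real \<Rightarrow> (real^'s::{finite,linorder})^'s::{finite,linorder}" where
  "R_mat M X z h x =
     (\<chi> j s. - (LINT \<omega>|window_measure M X z h x.
        gfun z (pos j) ((X \<omega> - x) / h) * ((X \<omega> - x) ^ (pos s - 1) / fact (pos s - 1))))"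

definition beta_tilde ::
  "'a measure \<Rightarrow> ('a \<Rightarrow> real) \<Rightarrow> real \<Rightarrow> real \<Rightarrow> real \<Rightarrow> real^'s::{finite,linorder}" where
  "beta_tilde M X z h x = matrix_inv (R_mat M X z h x) *v ell_vec M X z h x"

definition omega :: "real \<Rightarrow> nat \<Rightarrow> nat \<Rightarrow> real" where
  "omega z j s = - (1 / fact (s - 1)) * (LBINT t:{-z..1}. gfun z j t * t ^ (s - 1))"

definition Omega_mat :: "real \<Rightarrow> (real^'s::{finite,linorder})^'s::{finite,linorder}" where
  "Omega_mat z = (\<chi> j s. omega z (pos j) (pos s))"

definition b_vec :: "real \<Rightarrow> real^'s::{finite,linorder}" where
  "b_vec z = matrix_inv (Omega_mat z) *v (\<chi> j. omega z (pos j) (CARD('s) + 1))"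

definition Lambda_mat :: "real \<Rightarrow> (real^'s::{finite,linorder})^'s::{finite,linorder}" where
  "Lambda_mat h = (\<chi> j s. if j = s then h ^ (pos j - 1) else 0)"

definition V_mat :: "real \<Rightarrow> (real^'s::{finite,linorder})^'s::{finite,linorder}" where
  "V_mat z = (\<chi> j s. LBINT t:{-z..1}. gder z (pos j) t * gder z (pos s) t)"

definition deriv_vec :: "real set \<Rightarrow> (real \<Rightarrow> real) \<Rightarrow> real \<Rightarrow> real^'s::{finite,linorder}" where
  "deriv_vec A u x = (\<chi> s. nth_deriv_within A (pos s) u x)"

end

theory Submission
  imports Defs "HOL-Computational_Algebra.Polynomial"
begin

text \<open>
  After the substitution \<open>y = x + h t\<close> every moment is an integral of a fixed polynomial kernel
  against \<open>f (x + h t)\<close>, which converges uniformly to \<open>f x0\<close>. Integration by parts turns the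
  left-hand sides into integrals of \<open>g\<^sub>j L' f\<close> (this is why \<open>g\<^sub>j\<close> vanishes at both ends), and
  Taylor expansion of \<open>L'\<close> to order \<open>S\<close> gives the bias, because \<open>\<Omega>\<close> is invertible.

  For the fluctuations, let \<open>B\<close> be the random matrix of the system, rescaled by \<open>\<Lambda>\<close>. Then
  \<open>sqrt (n h\<^sup>3) \<Lambda> (\<beta>hat - \<beta>tilde) = B\<inverse> W\<close>, where \<open>W\<close> is \<open>1 / sqrt (n h)\<close> times a sum of
  i.i.d. centred bounded vectors. By Chebyshev \<open>B\<close> tends to \<open>f x0 \<Omega>\<close> in probability, the
  characteristic function of \<open>W\<close> tends to that of \<open>N(0, f x0 V)\<close>, and second moments give
  tightness. Convergence of characteristic functions together with tightness implies convergence
  in distribution: on a large box a test function is approximated by trigonometric polynomials.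
\<close>

section \<open>Characteristic functions and convergence in distribution\<close>

text \<open>The scaling comes from one substitution: a kernel moment is \<open>h\<close> times an
  integral of order one, so \<open>n h\<close> acts as the sample size, and the extra factor
  \<open>1 / h\<close> on the left of the system turns the rate \<open>sqrt (n h)\<close> into
  \<open>sqrt (n h^3)\<close>. Conditioning on the window divides \<open>ell_vec\<close> and
  \<open>R_mat\<close> by the same number, so for large \<open>n\<close> the vector
  \<open>beta_tilde\<close> solves the system of unconditional means. Hence the summands of W are
  centred exactly, not only in the limit. Besides the kernel derivatives they contain a correction
  with a factor \<open>h\<close>, which is why only the derivatives of the kernels enter V. Two
  obstacles shape the rest. The estimator is arbitrary where the random system has no unique
  solution, so the representation by W holds only where the random matrix is invertible, an event
  whose probability tends to one; a perturbation bound for linear systems controls the error there.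
  And the limit law is given by a density, so its characteristic function is found by writing it as
  a linear image of a product of standard normal laws, which needs a factorization of the covariance
  and a linear change of variables.\<close>

inductive_set trig_poly :: "(real^'n \<Rightarrow> complex) set" where
  monomial: "(\<lambda>y. c * iexp (a \<bullet> y)) \<in> trig_poly"
| add: "f \<in> trig_poly \<Longrightarrow> g \<in> trig_poly \<Longrightarrow> (\<lambda>y. f y + g y) \<in> trig_poly"

text \<open>Frequencies add under multiplication. Closure under products is what Stone--Weierstrass
  asks of the ring of functions on the torus.\<close>

lemma trig_poly_mult:
  assumes "f \<in> trig_poly" "g \<in> trig_poly"
  shows "(\<lambda>y. f y * g y) \<in> trig_poly"
  using assms(1)
proof induction
  case (monomial c a)
  show ?case using assms(2)
  proof induction
    case (monomial d b)
    have "(\<lambda>y. c * iexp (a \<bullet> y) * (d * iexp (b \<bullet> y))) = (\<lambda>y. (c * d) * iexp ((a + b) \<bullet> y))"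
      by (auto simp: inner_add_left ring_distribs exp_add)
    then show ?case using trig_poly.monomial[of "c * d" "a + b"] by simp
  next
    case (add f g)
    then show ?case using trig_poly.add by (simp add: ring_distribs)
  qed
next
  case (add f h)
  then show ?case using trig_poly.add by (simp add: ring_distribs)
qed

lemma trig_poly_const: "(\<lambda>_. c) \<in> trig_poly"
  using trig_poly.monomial[of c 0] by simp

lemma integrable_trig_poly:
  assumes "prob_space M" "Y \<in> borel_measurable M" "f \<in> trig_poly"
  shows "integrable M (\<lambda>\<omega>. f (Y \<omega>))"
  using assms(3)
proof induction
  case (monomial c a)
  interpret prob_space M by fact
  have [measurable]: "Y \<in> borel_measurable M" by fact
  have "integrable M (\<lambda>\<omega>. iexp (a \<bullet> Y \<omega>))"
    by (intro integrable_iexp) auto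
  then show ?case by simp
qed auto

lemma trig_poly_integral_tendsto:
  assumes "prob_space M" "prob_space \<mu>" "sets \<mu> = sets borel" "\<And>n. Y n \<in> borel_measurable M"
    and "\<And>a. (\<lambda>n. CLINT \<omega>|M. iexp (a \<bullet> Y n \<omega>)) \<longlonglongrightarrow> (CLINT y|\<mu>. iexp (a \<bullet> y))"
    and "f \<in> trig_poly"
  shows "(\<lambda>n. CLINT \<omega>|M. f (Y n \<omega>)) \<longlonglongrightarrow> (CLINT y|\<mu>. f y)"
  using assms(6)
proof induction
  case (monomial c a)
  then show ?case using assms(5)[of a] by (simp add: tendsto_mult_left)
next
  case (add f g)
  have "(\<lambda>y. y) \<in> borel_measurable \<mu>" using assms(3) by (simp add: measurable_def)
  from integrable_trig_poly[OF assms(2) this] integrable_trig_poly[OF assms(1,4)] add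
  show ?case by (simp add: tendsto_add)
qed

text \<open>\<open>Arg\<close> inverts \<open>cis\<close> on the half-open interval from
  \<open>-pi\<close> to \<open>pi\<close>, so only the two endpoints of the closed interval can be
  glued together. For the torus this means that only boundary points of the box are
  identified.\<close>

lemma cis_eq_cisD:
  assumes "cis a = cis b" "\<bar>a\<bar> \<le> pi" "\<bar>b\<bar> \<le> pi" "a \<noteq> b"
  shows "\<bar>a\<bar> = pi"
proof (rule ccontr)
  assume a: "\<bar>a\<bar> \<noteq> pi"
  have "Arg (cis a) = a"
    using assms a by (intro cis_Arg_unique) (auto simp: abs_if split: if_splits)
  moreover have "Arg (cis b) = (if b = - pi then pi else b)"
  proof (cases "b = - pi")
    case True
    then have "cis b = -1" by (simp add: complex_eq_iff)
    with True show ?thesis using cis_Arg_unique[of "-1" pi] by simp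
  next
    case False
    then show ?thesis using assms by (intro cis_Arg_unique) (auto simp: abs_if split: if_splits)
  qed
  ultimately have "a = (if b = - pi then pi else b)"
    using assms(1) by simp
  then show False
    using assms(4) a by (simp split: if_splits)
qed

text \<open>
  Continuous functions vanishing near the boundary of a large box live on a torus, where the
  trigonometric polynomials of the right period are dense by Stone--Weierstrass.
\<close>

lemma trig_poly_approx:
  fixes \<phi> :: "real^'n \<Rightarrow> real"
  assumes cont: "continuous_on UNIV \<phi>" and bd: "\<And>y. \<bar>\<phi> y\<bar> \<le> B" and e: "0 < e" and R: "0 \<le> R"
  obtains g where "(\<lambda>y. complex_of_real (g y)) \<in> trig_poly"
    "\<And>y. norm y \<le> R \<Longrightarrow> \<bar>\<phi> y - g y\<bar> < e" "\<And>y. \<bar>g y\<bar> \<le> B + e"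
proof -
  \<comment> \<open>The cut-off \<open>k\<close> is 1 up to norm \<open>R\<close> and 0 from norm
    \<open>R + 1\<close> on. A boundary point of the box \<open>C\<close> has norm at least
    \<open>P = R + 2\<close>, so it lies where \<open>\<psi>\<close> vanishes.\<close>
  define P where "P = R + 2"
  define k where "k y = max 0 (min 1 (R + 1 - norm y))" for y :: "real^'n"
  define \<psi> where "\<psi> y = \<phi> y * k y" for y
  define q where "q y = (\<chi> i. cis (pi / P * y $ i))" for y :: "real^'n"
  define C where "C = {y :: real^'n. \<forall>i. \<bar>y $ i\<bar> \<le> P}"
  have P: "0 < P" using R by (simp add: P_def)
  have cont\<psi>: "continuous_on S \<psi>" for S
    unfolding \<psi>_def k_def by (intro continuous_intros continuous_on_subset[OF cont]) auto
  have bd\<psi>: "\<bar>\<psi> y\<bar> \<le> B" for y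
    using mult_mono[OF bd[of y], of "\<bar>k y\<bar>" 1] bd[of y] by (simp add: \<psi>_def k_def abs_mult)
  have contq: "continuous_on S q" for S
    unfolding q_def by (intro continuous_on_vec_lambda continuous_intros continuous_on_cis)
  have "C = cbox (\<chi> i. - P) (\<chi> i. P)"
    by (auto simp: C_def mem_box_cart abs_le_iff) (metis minus_le_iff)+
  then have compC: "compact C" by (simp add: compact_cbox)
  have onto: "\<exists>y'\<in>C. q y' = q y" for y
  proof (intro bexI)
    let ?y = "\<chi> i. Arg (q y $ i) * P / pi"
    show "q ?y = q y"
      using P by (auto simp: vec_eq_iff q_def cis_Arg sgn_eq)
    have "\<bar>Arg w * P / pi\<bar> \<le> P" for w
    proof -
      have "\<bar>Arg w\<bar> \<le> pi" using Arg_bounded[of w] by auto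
      then have "\<bar>Arg w\<bar> * P \<le> pi * P" using P by (intro mult_right_mono) auto
      then show ?thesis using P by (simp add: abs_mult field_simps)
    qed
    then show "?y \<in> C" by (simp add: C_def)
  qed
  \<comment> \<open>Distinct points of the box with the same image differ in a coordinate that has
    modulus \<open>P\<close> for both. Both norms are then at least \<open>P\<close>, and
    \<open>\<psi>\<close> is 0 at both points.\<close>
  have inj: "\<psi> y = \<psi> y'" if "y \<in> C" "y' \<in> C" "q y = q y'" for y y'
  proof (cases "y = y'")
    case False
    then obtain i where i: "y $ i \<noteq> y' $ i" by (auto simp: vec_eq_iff)
    have *: "\<bar>pi / P * t\<bar> \<le> pi \<longleftrightarrow> \<bar>t\<bar> \<le> P" "\<bar>pi / P * t\<bar> = pi \<longleftrightarrow> \<bar>t\<bar> = P" for t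
      using P by (auto simp: abs_mult field_simps)
    have c: "cis (pi / P * y $ i) = cis (pi / P * y' $ i)"
      using that(3) by (simp add: q_def vec_eq_iff)
    have "\<bar>y $ i\<bar> = P" "\<bar>y' $ i\<bar> = P"
      using cis_eq_cisD[OF c] cis_eq_cisD[OF c[symmetric]] that(1,2) i P unfolding C_def * mem_Collect_eq
      by auto
    then have "P \<le> norm y" "P \<le> norm y'"
      using component_le_norm_cart[of y i] component_le_norm_cart[of y' i] by auto
    then show ?thesis by (simp add: \<psi>_def k_def P_def)
  qed simp
  define \<psi>' where "\<psi>' w = \<psi> (SOME y. y \<in> C \<and> q y = w)" for w
  have \<psi>': "\<psi>' (q y) = \<psi> y" if "y \<in> C" for y
  proof -
    have "(SOME y'. y' \<in> C \<and> q y' = q y) \<in> C \<and> q (SOME y'. y' \<in> C \<and> q y' = q y) = q y"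
      by (rule someI[of "\<lambda>y'. y' \<in> C \<and> q y' = q y" y]) (simp add: that)
    then show ?thesis
      unfolding \<psi>'_def by (intro inj that) simp_all
  qed
  have compT: "compact (q ` C)"
    by (rule compact_continuous_image[OF contq compC])
  \<comment> \<open>\<open>\<psi>'\<close> uses an arbitrary choice of preimages under
    \<open>q\<close>. It is continuous because \<open>q\<close> sends compact sets to compact, hence
    closed, sets, so preimages of closed sets are closed in the torus.\<close>
  have cont\<psi>': "continuous_on (q ` C) \<psi>'"
  proof (subst continuous_on_closed_vimage[OF compact_imp_closed[OF compT]], intro allI impI)
    fix K :: "real set" assume "closed K"
    then have "closed (\<psi> -` K)" by (rule closed_vimage[OF _ cont\<psi>])
    then have "compact (C \<inter> \<psi> -` K)" using compC by (rule closed_Int_compact[of _ C, simplified Int_commute])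
    then have "compact (q ` (C \<inter> \<psi> -` K))" by (rule compact_continuous_image[OF contq])
    moreover have "q ` (C \<inter> \<psi> -` K) = \<psi>' -` K \<inter> q ` C" using \<psi>' by auto
    ultimately show "closed (\<psi>' -` K \<inter> q ` C)" by (metis compact_imp_closed)
  qed
  \<comment> \<open>The ring lives on the torus, and membership asks that the pullback along
    \<open>q\<close> be a trigonometric polynomial. Real and imaginary parts of the coordinates
    belong to it and separate points.\<close>
  define RR where "RR = {r. continuous_on (q ` C) r \<and> (\<lambda>y. complex_of_real (r (q y))) \<in> trig_poly}"
  have component: "(\<lambda>y. q y $ i) \<in> trig_poly" "(\<lambda>y. cnj (q y $ i)) \<in> trig_poly" for i
  proof -
    have "(\<lambda>y. q y $ i) = (\<lambda>y. 1 * iexp (axis i (pi / P) \<bullet> y))"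
      "(\<lambda>y. cnj (q y $ i)) = (\<lambda>y. 1 * iexp (axis i (- pi / P) \<bullet> y))"
      by (simp_all add: q_def inner_axis' cis_conv_exp exp_cnj)
    then show "(\<lambda>y. q y $ i) \<in> trig_poly" "(\<lambda>y. cnj (q y $ i)) \<in> trig_poly"
      by (metis trig_poly.monomial)+
  qed
  have Re_RR: "(\<lambda>w. Re (w $ i)) \<in> RR" for i
  proof -
    have "(\<lambda>y. complex_of_real (Re (q y $ i))) = (\<lambda>y. 1/2 * (q y $ i) + 1/2 * cnj (q y $ i))"
      by (auto simp: complex_eq_iff)
    moreover have "\<dots> \<in> trig_poly"
      by (intro trig_poly.add trig_poly_mult trig_poly_const component)
    ultimately show ?thesis
      unfolding RR_def by (auto intro!: continuous_intros)
  qed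
  have Im_RR: "(\<lambda>w. Im (w $ i)) \<in> RR" for i
  proof -
    have "(\<lambda>y. complex_of_real (Im (q y $ i))) = (\<lambda>y. (- \<i> / 2) * (q y $ i) + (\<i> / 2) * cnj (q y $ i))"
      by (auto simp: complex_eq_iff)
    moreover have "\<dots> \<in> trig_poly"
      by (intro trig_poly.add trig_poly_mult trig_poly_const component)
    ultimately show ?thesis
      unfolding RR_def by (auto intro!: continuous_intros)
  qed
  interpret function_ring_on RR "q ` C"
  proof
    show "compact (q ` C)" by fact
    fix f g assume "f \<in> RR" "g \<in> RR"
    then show "(\<lambda>x. f x + g x) \<in> RR" "(\<lambda>x. f x * g x) \<in> RR"
      by (auto simp: RR_def intro!: continuous_intros trig_poly.add trig_poly_mult)
  next
    fix f assume "f \<in> RR" then show "continuous_on (q ` C) f" by (simp add: RR_def)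
  next
    fix c show "(\<lambda>_. c) \<in> RR" by (simp add: RR_def trig_poly_const)
  next
    fix w w' :: "complex^'n" assume "w \<noteq> w'"
    then obtain i where "Re (w $ i) \<noteq> Re (w' $ i) \<or> Im (w $ i) \<noteq> Im (w' $ i)"
      by (auto simp: vec_eq_iff complex_eq_iff)
    then show "\<exists>f\<in>RR. f w \<noteq> f w'"
      by (elim disjE) (rule bexI[OF _ Re_RR[of i]] bexI[OF _ Im_RR[of i]], simp)+
  qed
  obtain r where r: "r \<in> RR" "\<And>w. w \<in> q ` C \<Longrightarrow> \<bar>\<psi>' w - r w\<bar> < e"
    using Stone_Weierstrass_basic[OF cont\<psi>' e] by auto
  show ?thesis
  proof
    show "(\<lambda>y. complex_of_real (r (q y))) \<in> trig_poly" using r by (simp add: RR_def)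
    have app: "\<bar>\<psi> y - r (q y)\<bar> < e" if "y \<in> C" for y
      using r(2)[of "q y"] that \<psi>' by auto
    show "\<bar>\<phi> y - r (q y)\<bar> < e" if "norm y \<le> R" for y
    proof -
      have "\<bar>y $ i\<bar> \<le> P" for i
        using component_le_norm_cart[of y i] that by (simp add: P_def)
      then have "y \<in> C" by (simp add: C_def)
      then show ?thesis using app[of y] that by (simp add: \<psi>_def k_def)
    qed
    \<comment> \<open>The approximant is periodic, so its bound on the box holds everywhere. This
      controls it on the tail event, where it need not be close to \<open>\<phi>\<close>.\<close>
    show "\<bar>r (q y)\<bar> \<le> B + e" for y
    proof -
      obtain y' where "y' \<in> C" "q y' = q y" using onto by blast
      then show ?thesis using app[of y'] bd\<psi>[of y'] by auto
    qed
  qed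
qed

lemma prob_space_norm_tail:
  fixes \<mu> :: "'b::real_normed_vector measure"
  assumes "prob_space \<mu>" "sets \<mu> = sets borel" "0 < e"
  obtains R where "0 \<le> R" "measure \<mu> {y. R < norm y} < (e::real)"
proof -
  interpret prob_space \<mu> by fact
  have [measurable_cong]: "sets \<mu> = sets borel" by fact
  have sp: "space \<mu> = UNIV" using sets_eq_imp_space_eq[OF assms(2)] by simp
  have "{y::'b. real k < norm y} \<in> sets borel" for k :: nat
    by (intro borel_open open_Collect_less continuous_intros)
  then have "(\<lambda>k. measure \<mu> {y. real k < norm y}) \<longlonglongrightarrow> measure \<mu> (\<Inter>k. {y. real k < norm y})"
    by (intro finite_Lim_measure_decseq decseq_SucI) (simp_all only: assms(2) image_subset_iff, auto)
  moreover have "(\<Inter>k. {y::'b. real k < norm y}) = {}"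
  proof (intro equals0I)
    fix y :: 'b assume "y \<in> (\<Inter>k. {y. real k < norm y})"
    then have "real k < norm y" for k by blast
    then show False using reals_Archimedean2[of "norm y"] less_asym by blast
  qed
  ultimately have "(\<lambda>k. measure \<mu> {y. real k < norm y}) \<longlonglongrightarrow> 0" by simp
  from order_tendstoD(2)[OF this assms(3)] obtain k where "measure \<mu> {y. real k < norm y} < e"
    by (auto simp: eventually_sequentially)
  then show ?thesis by (intro that[of "real k"]) auto
qed

theorem levy_continuity_cart:
  fixes Y :: "nat \<Rightarrow> 'a \<Rightarrow> real^'n"
  assumes "prob_space M" "prob_space \<mu>" and sets: "sets \<mu> = sets borel" and Y[measurable]: "\<And>n. Y n \<in> borel_measurable M"
    and cf: "\<And>a. (\<lambda>n. CLINT \<omega>|M. iexp (a \<bullet> Y n \<omega>)) \<longlonglongrightarrow> (CLINT y|\<mu>. iexp (a \<bullet> y))"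
    and tight: "\<And>e. 0 < e \<Longrightarrow> \<exists>R. \<forall>\<^sub>F n in sequentially. measure M {\<omega>\<in>space M. R < norm (Y n \<omega>)} < e"
  shows "conv_in_distribution M Y \<mu>"
  unfolding conv_in_distribution_def
proof (intro allI impI)
  fix \<phi> :: "real^'n \<Rightarrow> real" assume cont: "continuous_on UNIV \<phi>" and "bounded (range \<phi>)"
  then obtain B where B: "0 < B" "\<And>y. \<bar>\<phi> y\<bar> \<le> B"
    unfolding bounded_pos by auto
  have [measurable]: "\<phi> \<in> borel_measurable borel" by (rule borel_measurable_continuous_onI[OF cont])
  interpret M: prob_space M by fact
  interpret \<mu>: prob_space \<mu> by fact
  have Y\<mu>: "(\<lambda>y. y) \<in> borel_measurable \<mu>" using sets by (simp add: measurable_def)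
  \<comment> \<open>Stated for an arbitrary probability space because it is used twice: for
    \<open>Y n\<close> under \<open>M\<close>, and for the identity under \<open>\<mu>\<close>.
    Outside the tail event the error is below \<open>e\<close>; on it, both functions are merely
    bounded.\<close>
  have compare: "\<bar>(LINT \<omega>|N. \<phi> (Z \<omega>)) - (LINT \<omega>|N. g (Z \<omega>))\<bar> \<le> e + (2 * B + e) * e"
    if N: "prob_space N" and Z[measurable]: "Z \<in> borel_measurable N"
      and tail: "measure N {\<omega>\<in>space N. R < norm (Z \<omega>)} < e"
      and g: "(\<lambda>y. complex_of_real (g y)) \<in> trig_poly" "\<And>y. norm y \<le> R \<Longrightarrow> \<bar>\<phi> y - g y\<bar> < e" "\<And>y. \<bar>g y\<bar> \<le> B + e"
      and e: "0 < e"
    for N :: "'c measure" and Z :: "'c \<Rightarrow> real^'n" and R e g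
  proof -
    interpret N: prob_space N by fact
    have i1: "integrable N (\<lambda>\<omega>. \<phi> (Z \<omega>))"
      by (rule N.integrable_const_bound[of _ B]) (use B in auto)
    have i2: "integrable N (\<lambda>\<omega>. g (Z \<omega>))"
      using integrable_Re[OF integrable_trig_poly[OF N Z g(1)]] by simp
    have [measurable]: "{\<omega>\<in>space N. R < norm (Z \<omega>)} \<in> sets N" by measurable
    have "\<bar>(LINT \<omega>|N. \<phi> (Z \<omega>)) - (LINT \<omega>|N. g (Z \<omega>))\<bar> \<le> (LINT \<omega>|N. \<bar>\<phi> (Z \<omega>) - g (Z \<omega>)\<bar>)"
      using i1 i2 by (simp flip: Bochner_Integration.integral_diff)
    also have "\<dots> \<le> (LINT \<omega>|N. e + (2 * B + e) * indicator {\<omega>\<in>space N. R < norm (Z \<omega>)} \<omega>)"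
    proof (rule integral_mono)
      fix \<omega> assume "\<omega> \<in> space N"
      then show "\<bar>\<phi> (Z \<omega>) - g (Z \<omega>)\<bar> \<le> e + (2 * B + e) * indicator {\<omega>\<in>space N. R < norm (Z \<omega>)} \<omega>"
        using B(2)[of "Z \<omega>"] g(2)[of "Z \<omega>"] g(3)[of "Z \<omega>"] e by (auto simp: indicator_def)
    next
      show "integrable N (\<lambda>\<omega>. e + (2 * B + e) * indicator {\<omega>\<in>space N. R < norm (Z \<omega>)} \<omega>)"
        by (intro Bochner_Integration.integrable_add integrable_mult_right integrable_real_indicator)
          (auto simp: N.emeasure_eq_measure)
    qed (use i1 i2 in auto)
    also have "\<dots> = e + (2 * B + e) * measure N {\<omega>\<in>space N. R < norm (Z \<omega>)}"
      by (subst Bochner_Integration.integral_add)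
        (auto simp: N.prob_space N.emeasure_eq_measure intro!: integrable_mult_right integrable_real_indicator)
    also have "\<dots> \<le> e + (2 * B + e) * e" using tail e B(1) by (intro add_left_mono mult_left_mono) auto
    finally show ?thesis .
  qed
  show "(\<lambda>n. LINT \<omega>|M. \<phi> (Y n \<omega>)) \<longlonglongrightarrow> (LINT y|\<mu>. \<phi> y)"
  proof (rule tendstoI)
    fix \<epsilon> :: real assume \<epsilon>: "0 < \<epsilon>"
    \<comment> \<open>The total error is two comparison errors plus \<open>e\<close>. Since
      \<open>e \<le> 1\<close> gives \<open>e * e \<le> e\<close>, it is at most
      \<open>e * (4 * B + 5)\<close>, which this choice keeps below
      \<open>\<epsilon>\<close>.\<close>
    define e where "e = min 1 (\<epsilon> / 2 / (2 * (2 * B + 2) + 1))"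
    have e: "0 < e" "e \<le> 1" using \<epsilon> B by (auto simp: e_def)
    have "e \<le> \<epsilon> / 2 / (2 * (2 * B + 2) + 1)" by (simp add: e_def)
    then have "e * (2 * (2 * B + 2) + 1) \<le> \<epsilon> / 2"
      using B(1) by (subst (asm) pos_le_divide_eq) auto
    then have e\<epsilon>: "2 * (e + (2 * B + e) * e) + e < \<epsilon>"
    proof -
      have eq: "2 * (e + (2 * B + e) * e) + e = 3 * e + 4 * (B * e) + 2 * (e * e)"
        "e * (2 * (2 * B + 2) + 1) = 5 * e + 4 * (B * e)"
        by (simp_all add: algebra_simps)
      have "e * e \<le> e" "0 < B * e"
        using e B(1) by (auto simp: mult_left_le)
      then show ?thesis
        using \<open>e * (2 * (2 * B + 2) + 1) \<le> \<epsilon> / 2\<close> e \<epsilon> unfolding eq by linarith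
    qed
    obtain R1 where R1: "\<forall>\<^sub>F n in sequentially. measure M {\<omega>\<in>space M. R1 < norm (Y n \<omega>)} < e"
      using tight[OF e(1)] by blast
    obtain R2 where R2: "0 \<le> R2" "measure \<mu> {y. R2 < norm y} < e"
      by (rule prob_space_norm_tail[OF assms(2) sets e(1)])
    define R where "R = max R1 R2"
    have R: "0 \<le> R" using R2 by (simp add: R_def)
    have tail1: "\<forall>\<^sub>F n in sequentially. measure M {\<omega>\<in>space M. R < norm (Y n \<omega>)} < e"
      using R1
    proof eventually_elim
      case (elim n)
      have "measure M {\<omega>\<in>space M. R < norm (Y n \<omega>)} \<le> measure M {\<omega>\<in>space M. R1 < norm (Y n \<omega>)}"
        by (rule M.finite_measure_mono) (auto simp: R_def)
      then show ?case using elim by simp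
    qed
    have sp: "space \<mu> = UNIV" using sets_eq_imp_space_eq[OF sets] by simp
    have "{y. R2 < norm y} \<in> sets \<mu>"
      unfolding sets by (intro borel_open open_Collect_less continuous_intros)
    then have "measure \<mu> {y\<in>space \<mu>. R < norm y} \<le> measure \<mu> {y. R2 < norm y}"
      by (intro \<mu>.finite_measure_mono) (auto simp: R_def)
    then have tail2: "measure \<mu> {y\<in>space \<mu>. R < norm y} < e" using R2 by simp
    obtain g where g: "(\<lambda>y. complex_of_real (g y)) \<in> trig_poly"
      "\<And>y. norm y \<le> R \<Longrightarrow> \<bar>\<phi> y - g y\<bar> < e" "\<And>y. \<bar>g y\<bar> \<le> B + e"
      using trig_poly_approx[OF cont B(2) e(1) R] by metis
    have "(\<lambda>n. complex_of_real (LINT \<omega>|M. g (Y n \<omega>))) \<longlonglongrightarrow> complex_of_real (LINT y|\<mu>. g y)"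
      using trig_poly_integral_tendsto[OF assms(1-4) cf g(1)] by simp
    then have "(\<lambda>n. LINT \<omega>|M. g (Y n \<omega>)) \<longlonglongrightarrow> (LINT y|\<mu>. g y)"
      by (simp add: tendsto_of_real_iff)
    from tendstoD[OF this e(1)] tail1
    show "\<forall>\<^sub>F n in sequentially. dist (LINT \<omega>|M. \<phi> (Y n \<omega>)) (LINT y|\<mu>. \<phi> y) < \<epsilon>"
    proof eventually_elim
      case (elim n)
      have "\<bar>(LINT \<omega>|M. \<phi> (Y n \<omega>)) - (LINT \<omega>|M. g (Y n \<omega>))\<bar> \<le> e + (2 * B + e) * e"
        using compare[OF assms(1) Y elim(2) g e(1)] by simp
      moreover have "\<bar>(LINT y|\<mu>. \<phi> y) - (LINT y|\<mu>. g y)\<bar> \<le> e + (2 * B + e) * e"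
        using compare[OF assms(2) Y\<mu> tail2 g e(1)] by simp
      ultimately show ?case using elim(1) e\<epsilon> by (simp add: dist_real_def abs_if split: if_splits)
    qed
  qed
qed

section \<open>Linear images of Lebesgue measure and the normal law\<close>

lemma prod_Basis_cart:
  fixes g :: "real^'n \<Rightarrow> 'b::comm_monoid_mult"
  shows "(\<Prod>b\<in>Basis. g b) = (\<Prod>i\<in>UNIV. g (axis i 1))"
proof -
  have "(Basis :: (real^'n) set) = range (\<lambda>i. axis i 1)"
    by (auto simp: Basis_vec_def)
  moreover have "inj (\<lambda>i::'n. axis i (1::real))"
    by (auto intro!: injI simp: axis_eq_axis)
  ultimately show ?thesis
    using prod.reindex[of "\<lambda>i. axis i 1" UNIV g] by simp
qed

lemma borel_measurable_vec_lambda [measurable (raw)]: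
  fixes f :: "'a \<Rightarrow> 'n::finite \<Rightarrow> 'b::euclidean_space"
  assumes "\<And>i. (\<lambda>x. f x i) \<in> borel_measurable M"
  shows "(\<lambda>x. \<chi> i. f x i) \<in> borel_measurable M"
proof (subst borel_measurable_euclidean_space, intro ballI)
  fix b :: "'b^'n" assume "b \<in> Basis"
  then obtain i u where "b = axis i u" by (auto simp: Basis_vec_def)
  then show "(\<lambda>x. (\<chi> i. f x i) \<bullet> b) \<in> borel_measurable M"
    using assms by (simp add: inner_axis)
qed

lemma borel_measurable_vec_component [measurable (raw)]:
  fixes f :: "'a \<Rightarrow> real^'n"
  assumes "f \<in> borel_measurable M"
  shows "(\<lambda>x. f x $ i) \<in> borel_measurable M"
  using assms by (rule borel_measurable_continuous_on[rotated]) (intro continuous_intros)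

lemma lborel_eqI_cart:
  fixes M :: "(real^'n) measure"
  assumes "\<And>l u. (\<And>i. l $ i \<le> u $ i) \<Longrightarrow>
      emeasure M {x. \<forall>i. x $ i \<in> {l $ i<..<u $ i}} = (\<Prod>i\<in>UNIV. ennreal (u $ i - l $ i))"
    and "sets M = sets borel"
  shows "lborel = M"
proof (rule lborel_eqI[OF _ assms(2)])
  fix l u :: "real^'n" assume "\<And>b. b \<in> Basis \<Longrightarrow> l \<bullet> b \<le> u \<bullet> b"
  then have le: "l $ i \<le> u $ i" for i
    by (metis axis_in_Basis_iff cart_eq_inner_axis Basis_real_def insertI1)
  have "box l u = {x. \<forall>i. x $ i \<in> {l $ i<..<u $ i}}"
    by (auto simp: interval_cbox_cart mem_box_cart)
  then show "emeasure M (box l u) = ennreal (\<Prod>b\<in>Basis. (u - l) \<bullet> b)"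
    using assms(1)[of l u, OF le] le by (simp add: prod_Basis_cart inner_axis prod_ennreal)
qed

text \<open>Both measures give a box the product of its side lengths, and boxes determine Lebesgue
  measure. This opens the way to Fubini, one coordinate at a time.\<close>

lemma lborel_cart:
  "(lborel :: (real^'n) measure) = distr (Pi\<^sub>M UNIV (\<lambda>_. lborel)) borel (\<lambda>f. \<chi> i. f i)"
proof (rule lborel_eqI_cart)
  interpret product_sigma_finite "\<lambda>_::'n. lborel :: real measure" ..
  fix l u :: "real^'n" assume le: "\<And>i. l $ i \<le> u $ i"
  have "(\<lambda>f. \<chi> i. f i) -` {x. \<forall>i. x $ i \<in> {l $ i<..<u $ i}} = (PiE UNIV (\<lambda>i. {l $ i<..<u $ i}))"
    by (auto simp: PiE_def)
  moreover have "{x. \<forall>i. x $ i \<in> {l $ i<..<u $ i}} \<in> sets (borel :: (real^'n) measure)"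
    by measurable
  ultimately show "emeasure (distr (Pi\<^sub>M UNIV (\<lambda>_. lborel)) borel (\<lambda>f. \<chi> i. f i))
      {x. \<forall>i. x $ i \<in> {l $ i<..<u $ i}} = (\<Prod>i\<in>UNIV. ennreal (u $ i - l $ i))"
    using le by (simp add: emeasure_distr space_PiM emeasure_PiM)
qed simp

lemma nn_integral_lborel_permute:
  fixes F :: "real^'n \<Rightarrow> ennreal"
  assumes p: "bij (p :: 'n \<Rightarrow> 'n)" and [measurable]: "F \<in> borel_measurable borel"
  shows "(\<integral>\<^sup>+x. F (\<chi> i. x $ p i) \<partial>lborel) = (\<integral>\<^sup>+x. F x \<partial>lborel)"
proof -
  have "lborel = distr lborel borel (\<lambda>x::real^'n. \<chi> i. x $ p i)"
  proof (rule lborel_eqI_cart)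
    interpret product_sigma_finite "\<lambda>_::'n. lborel :: real measure" ..
    fix l u :: "real^'n" assume le: "\<And>i. l $ i \<le> u $ i"
    have "(\<lambda>x. \<chi> i. x $ p i) -` {x. \<forall>i. x $ i \<in> {l $ i<..<u $ i}} =
        {x. \<forall>i. x $ i \<in> {l $ inv p i<..<u $ inv p i}}"
      using p by (auto simp: bij_inv_eq_iff bij_is_surj surj_f_inv_f) (metis bij_inv_eq_iff p)+
    moreover have "(\<lambda>f. \<chi> i. f i) -` {x. \<forall>i. x $ i \<in> {l $ inv p i<..<u $ inv p i}}
        = (PiE UNIV (\<lambda>i. {l $ inv p i<..<u $ inv p i}))"
      by (auto simp: PiE_def)
    moreover have "{x. \<forall>i. x $ i \<in> {l $ i<..<u $ i}} \<in> sets (borel :: (real^'n) measure)"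
      "{x. \<forall>i. x $ i \<in> {l $ inv p i<..<u $ inv p i}} \<in> sets (borel :: (real^'n) measure)"
      by measurable
    moreover have "(\<Prod>i\<in>UNIV. ennreal (u $ inv p i - l $ inv p i)) = (\<Prod>i\<in>UNIV. ennreal (u $ i - l $ i))"
      using p by (intro prod.reindex_bij_betw[of "inv p" UNIV UNIV "\<lambda>i. ennreal (u $ i - l $ i)"])
        (rule bij_imp_bij_inv)
    ultimately show "emeasure (distr lborel borel (\<lambda>x::real^'n. \<chi> i. x $ p i))
        {x. \<forall>i. x $ i \<in> {l $ i<..<u $ i}} = (\<Prod>i\<in>UNIV. ennreal (u $ i - l $ i))"
      using le by (subst emeasure_distr) (simp_all, simp add: lborel_cart emeasure_distr space_PiM emeasure_PiM)
  qed simp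
  then have "(\<integral>\<^sup>+x. F x \<partial>lborel) = (\<integral>\<^sup>+x. F x \<partial>distr lborel borel (\<lambda>x::real^'n. \<chi> i. x $ p i))"
    by simp
  then show ?thesis by (simp add: nn_integral_distr)
qed

text \<open>With all coordinates except \<open>m\<close> held fixed, the shear is a translation of
  the coordinate \<open>m\<close> by a constant, because \<open>m \<noteq> n\<close>. Fubini and
  translation invariance on the line do the rest.\<close>

lemma nn_integral_lborel_shear:
  fixes F :: "real^'n \<Rightarrow> ennreal"
  assumes "m \<noteq> n" and [measurable]: "F \<in> borel_measurable borel"
  shows "(\<integral>\<^sup>+x. F (\<chi> i. if i = m then x $ m + c * x $ n else x $ i) \<partial>lborel) = (\<integral>\<^sup>+x. F x \<partial>lborel)"
proof -
  interpret product_sigma_finite "\<lambda>_::'n. lborel :: real measure" ..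
  define I where "I = UNIV - {m}"
  have I: "finite I" "m \<notin> I" "insert m I = UNIV" by (auto simp: I_def)
  have *: "(\<integral>\<^sup>+x. G x \<partial>lborel) = (\<integral>\<^sup>+f. (\<integral>\<^sup>+y. G (\<chi> i. (f(m := y)) i) \<partial>lborel) \<partial>Pi\<^sub>M I (\<lambda>_. lborel))"
    if [measurable]: "G \<in> borel_measurable borel" for G :: "real^'n \<Rightarrow> ennreal"
  proof -
    have "(\<integral>\<^sup>+x. G x \<partial>lborel) = (\<integral>\<^sup>+f. G (\<chi> i. f i) \<partial>Pi\<^sub>M (insert m I) (\<lambda>_. lborel))"
      by (subst lborel_cart) (simp add: nn_integral_distr I)
    also have "\<dots> = (\<integral>\<^sup>+f. (\<integral>\<^sup>+y. G (\<chi> i. (f(m := y)) i) \<partial>lborel) \<partial>Pi\<^sub>M I (\<lambda>_. lborel))"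
    proof (rule product_nn_integral_insert[OF I(1,2)])
      show "(\<lambda>f. G (\<chi> i. f i)) \<in> borel_measurable (Pi\<^sub>M (insert m I) (\<lambda>_. lborel))"
        unfolding I(3) by measurable
    qed
    finally show ?thesis .
  qed
  have "(\<integral>\<^sup>+x. F (\<chi> i. if i = m then x $ m + c * x $ n else x $ i) \<partial>lborel) =
     (\<integral>\<^sup>+f. (\<integral>\<^sup>+y. F (\<chi> i. (f(m := c * f n + 1 * y)) i) \<partial>lborel) \<partial>Pi\<^sub>M I (\<lambda>_. lborel))"
    using assms(1) by (subst *) (auto intro!: nn_integral_cong arg_cong[of _ _ F] simp: vec_eq_iff)
  also have "\<dots> = (\<integral>\<^sup>+f. (\<integral>\<^sup>+y. F (\<chi> i. (f(m := y)) i) \<partial>lborel) \<partial>Pi\<^sub>M I (\<lambda>_. lborel))"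
  proof (rule nn_integral_cong)
    fix f :: "'n \<Rightarrow> real"
    have "(\<lambda>y. F (\<chi> i. (f(m := y)) i)) \<in> borel_measurable borel"
      by (auto intro!: measurable_compose[OF _ assms(2)] borel_measurable_vec_lambda simp: fun_upd_def)
    from nn_integral_real_affine[OF this, of 1 "c * f n"]
    show "(\<integral>\<^sup>+y. F (\<chi> i. (f(m := c * f n + 1 * y)) i) \<partial>lborel) = (\<integral>\<^sup>+y. F (\<chi> i. (f(m := y)) i) \<partial>lborel)"
      by simp
  qed
  also have "\<dots> = (\<integral>\<^sup>+x. F x \<partial>lborel)" by (rule *[symmetric]) measurable
  finally show ?thesis .
qed

lemma matrix_vector_mult_measurable [measurable]:
  "(\<lambda>x. (A :: real^'n^'m) *v x) \<in> borel_measurable borel"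
  by (intro borel_measurable_continuous_onI continuous_intros)

lemma nn_integral_lborel_diagonal:
  fixes F :: "real^'n \<Rightarrow> ennreal"
  assumes "\<And>i. d i \<noteq> 0" and [measurable]: "F \<in> borel_measurable borel"
  shows "(\<integral>\<^sup>+x. F x \<partial>lborel) = ennreal \<bar>\<Prod>i\<in>UNIV. d i\<bar> * (\<integral>\<^sup>+x. F (\<chi> i. d i * x $ i) \<partial>lborel)"
proof -
  \<comment> \<open>Scaling factors are expected per basis vector, not per index; \<open>c\<close>
    is the linear form that takes the value \<open>d i\<close> at the \<open>i\<close>-th
    axis.\<close>
  define c where "c = (\<lambda>b::real^'n. \<Sum>i\<in>UNIV. d i * b $ i)"
  have c_axis: "c (axis i 1) = d i" for i
    by (simp add: c_def axis_def if_distrib sum.delta cong: if_cong)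
  have "lborel = density (distr lborel borel (\<lambda>x::real^'n. 0 + (\<Sum>j\<in>Basis. (c j * (x \<bullet> j)) *\<^sub>R j)))
      (\<lambda>_. ennreal (\<Prod>j\<in>Basis. \<bar>c j\<bar>))"
    by (rule lborel_affine_euclidean) (use assms(1) in \<open>auto simp: Basis_vec_def c_axis\<close>)
  moreover have "0 + (\<Sum>j\<in>Basis. (c j * (x \<bullet> j)) *\<^sub>R j) = (\<chi> i. d i * x $ i)" for x :: "real^'n"
  proof (rule euclidean_eqI)
    fix b :: "real^'n" assume b: "b \<in> Basis"
    then obtain i where "b = axis i 1" by (auto simp: Basis_vec_def)
    then have "(0 + (\<Sum>j\<in>Basis. (c j * (x \<bullet> j)) *\<^sub>R j)) \<bullet> b = c b * (x \<bullet> b)"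
      using b by simp
    with \<open>b = axis i 1\<close> show "(0 + (\<Sum>j\<in>Basis. (c j * (x \<bullet> j)) *\<^sub>R j)) \<bullet> b = (\<chi> i. d i * x $ i) \<bullet> b"
      by (simp add: c_axis inner_axis)
  qed
  ultimately have *: "lborel = density (distr lborel borel (\<lambda>x::real^'n. \<chi> i. d i * x $ i)) (\<lambda>_. ennreal \<bar>\<Prod>i\<in>UNIV. d i\<bar>)"
    by (simp add: prod_Basis_cart c_axis abs_prod)
  show ?thesis
    by (subst *) (simp add: nn_integral_density nn_integral_distr nn_integral_cmult)
qed

text \<open>The linear change of variables in the library is limited to well-ordered index types.\<close>

lemma nn_integral_lborel_matrix:
  fixes A :: "real^'n^'n"
  assumes "det A \<noteq> 0" and "F \<in> borel_measurable borel"
  shows "(\<integral>\<^sup>+x. F x \<partial>lborel) = ennreal \<bar>det A\<bar> * (\<integral>\<^sup>+x. F (A *v x) \<partial>lborel)"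
proof -
  \<comment> \<open>The quantifier over \<open>F\<close> sits inside the induction: in the product
    case the hypothesis for \<open>B\<close> is applied to \<open>F\<close> composed with
    \<open>A\<close>. The determinant condition also sits inside, so that matrices with a zero row
    are vacuous cases.\<close>
  have "det A \<noteq> 0 \<longrightarrow> (\<forall>F\<in>borel_measurable borel.
      (\<integral>\<^sup>+x. F x \<partial>lborel) = ennreal \<bar>det A\<bar> * (\<integral>\<^sup>+x. F (A *v x) \<partial>lborel))"
  proof (rule induct_matrix_elementary, goal_cases)
    case (1 A B)
    show ?case
    proof (intro impI ballI)
      fix F :: "real^'n \<Rightarrow> ennreal" assume d: "det (A ** B) \<noteq> 0" and F[measurable]: "F \<in> borel_measurable borel"
      have nz: "det A \<noteq> 0" "det B \<noteq> 0" using d by (auto simp: det_mul)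
      have "(\<integral>\<^sup>+x. F x \<partial>lborel) = ennreal \<bar>det A\<bar> * (\<integral>\<^sup>+x. F (A *v x) \<partial>lborel)"
        using 1(1) nz F by blast
      also have "(\<integral>\<^sup>+x. F (A *v x) \<partial>lborel) = ennreal \<bar>det B\<bar> * (\<integral>\<^sup>+x. F (A *v (B *v x)) \<partial>lborel)"
        using bspec[OF mp[OF 1(2) nz(2)], of "\<lambda>x. F (A *v x)"] by simp
      finally show "(\<integral>\<^sup>+x. F x \<partial>lborel) = ennreal \<bar>det (A ** B)\<bar> * (\<integral>\<^sup>+x. F (A ** B *v x) \<partial>lborel)"
        by (simp add: det_mul abs_mult ennreal_mult mult.assoc matrix_vector_mul_assoc)
    qed
  next
    case (2 A i)
    then show ?case using det_zero_row by blast
  next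
    case (3 A)
    show ?case
    proof (intro impI ballI)
      fix F :: "real^'n \<Rightarrow> ennreal" assume d: "det A \<noteq> 0" and F[measurable]: "F \<in> borel_measurable borel"
      have "A *v x = (\<chi> i. A $ i $ i * x $ i)" for x
      proof -
        have "(\<Sum>j\<in>UNIV. A $ i $ j * x $ j) = A $ i $ i * x $ i" for i
          using 3 by (subst sum.remove[of _ i]) (auto intro!: sum.neutral)
        then show ?thesis by (simp add: vec_eq_iff matrix_vector_mult_def)
      qed
      with d 3 show "(\<integral>\<^sup>+x. F x \<partial>lborel) = ennreal \<bar>det A\<bar> * (\<integral>\<^sup>+x. F (A *v x) \<partial>lborel)"
        using nn_integral_lborel_diagonal[of "\<lambda>i. A $ i $ i" F] by (simp add: det_diagonal)
    qed
  next
    case (4 m n)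
    let ?P = "\<chi> i j. (mat 1 :: real^'n^'n) $ i $ Transposition.transpose m n j"
    show ?case
    proof (intro impI ballI)
      fix F :: "real^'n \<Rightarrow> ennreal" assume F[measurable]: "F \<in> borel_measurable borel"
      have p: "Transposition.transpose m n permutes UNIV" by (rule permutes_swap_id) auto
      have "\<bar>det ?P\<bar> = 1"
        using 4 det_permute_columns[OF p, of "mat 1 :: real^'n^'n"] by (simp add: sign_swap_id)
      moreover have "?P *v x = (\<chi> i. x $ Transposition.transpose m n i)" for x
      proof -
        have "(mat 1 :: real^'n^'n) $ i $ Transposition.transpose m n j =
            (if j = Transposition.transpose m n i then 1 else 0)" for i j
          by (auto simp: mat_def)
        then show ?thesis
          by (simp add: vec_eq_iff matrix_vector_mult_def if_distrib[of "\<lambda>a. a * _"] sum.delta cong: if_cong)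
      qed
      ultimately show "(\<integral>\<^sup>+x. F x \<partial>lborel) = ennreal \<bar>det ?P\<bar> * (\<integral>\<^sup>+x. F (?P *v x) \<partial>lborel)"
        using nn_integral_lborel_permute[of "Transposition.transpose m n" F] by simp
    qed
  next
    case (5 m n c)
    let ?P = "(\<chi> i j. if i = m \<and> j = n then c else of_bool (i = j)) :: real^'n^'n"
    show ?case
    proof (intro impI ballI)
      fix F :: "real^'n \<Rightarrow> ennreal" assume F[measurable]: "F \<in> borel_measurable borel"
      have "?P = (\<chi> k. if k = m then row m (mat 1) + c *s row n (mat 1) else row k (mat 1))"
        using 5 by (auto simp: vec_eq_iff row_def mat_def)
      then have "det ?P = 1"
        using det_row_operation[OF 5, of "mat 1 :: real^'n^'n" c] by simp
      moreover have "?P *v x = (\<chi> i. if i = m then x $ m + c * x $ n else x $ i)" for x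
      proof -
        have "?P $ i $ j * x $ j = (if j = i then x $ i else 0) + (if j = n then (if i = m then c * x $ n else 0) else 0)" for i j
          using 5 by auto
        then show ?thesis
          by (simp add: vec_eq_iff matrix_vector_mult_def sum.distrib sum.delta del: vec_lambda_beta cong: if_cong)
             (simp add: vec_lambda_beta)
      qed
      ultimately show "(\<integral>\<^sup>+x. F x \<partial>lborel) = ennreal \<bar>det ?P\<bar> * (\<integral>\<^sup>+x. F (?P *v x) \<partial>lborel)"
        using nn_integral_lborel_shear[OF 5 F, of c] by simp
    qed
  qed
  with assms show ?thesis by blast
qed

text \<open>Gram--Schmidt for the inner product with matrix \<open>Q\<close>, run over finite sets
  of indices; an orthonormal family indexed by all of \<open>'n\<close> gives the columns of
  \<open>A\<close>.\<close>

lemma posdef_congruent_identity: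
  fixes Q :: "real^'n^'n"
  assumes sym: "transpose Q = Q" and pos: "\<And>x. x \<noteq> 0 \<Longrightarrow> 0 < x \<bullet> (Q *v x)"
  obtains A :: "real^'n^'n" where "transpose A ** Q ** A = mat 1"
proof -
  have comm: "x \<bullet> (Q *v y) = y \<bullet> (Q *v x)" for x y
    by (metis sym dot_lmul_matrix inner_commute transpose_matrix_vector)
  have "\<exists>v. \<forall>i\<in>I. \<forall>j\<in>I. v i \<bullet> (Q *v v j) = (if i = j then 1 else 0)" if "finite I" for I :: "'n set"
    using that
  proof (induction I)
    case empty
    then show ?case by simp
  next
    case (insert k I)
    then obtain v where v: "\<And>i j. i \<in> I \<Longrightarrow> j \<in> I \<Longrightarrow> v i \<bullet> (Q *v v j) = (if i = j then 1 else 0)"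
      by blast
    \<comment> \<open>\<open>I\<close> misses the index \<open>k\<close>, so the vectors
      \<open>Q v\<^sub>i\<close> span a proper subspace. A nonzero vector orthogonal to it is
      orthogonal to every \<open>v\<^sub>i\<close> in the sense of \<open>Q\<close>.\<close>
    let ?S = "(\<lambda>i. Q *v v i) ` I"
    have "dim ?S \<le> card I"
      using dim_le_card'[of ?S] card_image_le[of I "\<lambda>i. Q *v v i"] by simp
    also have "card I < CARD('n)"
      using insert(2) by (intro psubset_card_mono) auto
    finally have "dim ?S < DIM(real^'n)" by simp
    then obtain x where x: "x \<noteq> 0" "\<And>y. y \<in> span ?S \<Longrightarrow> orthogonal x y"
      using orthogonal_to_subspace_exists[of ?S] by blast
    define w where "w = (1 / sqrt (x \<bullet> (Q *v x))) *\<^sub>R x"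
    have w: "w \<bullet> (Q *v v j) = 0" if "j \<in> I" for j
      using x(2)[of "Q *v v j"] that by (auto simp: w_def orthogonal_def intro: span_base)
    have ww: "w \<bullet> (Q *v w) = 1"
      using pos[OF x(1)] by (simp add: w_def matrix_vector_mult_scaleR field_simps)
    show ?case
      using insert(2) v w ww comm by (intro exI[of _ "v(k := w)"]) auto
  qed
  from this[of UNIV] obtain v :: "'n \<Rightarrow> real^'n" where "\<forall>i j. v i \<bullet> (Q *v v j) = (if i = j then 1 else 0)"
    by auto
  then have v: "v i \<bullet> (Q *v v j) = (if i = j then 1 else 0)" for i j by blast
  define A :: "real^'n^'n" where "A = (\<chi> i j. v j $ i)"
  have "transpose A ** Q ** A = mat 1"
  proof -
    have "(transpose A ** (Q ** A)) $ i $ j = v i \<bullet> (Q *v v j)" for i j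
      by (simp add: A_def matrix_matrix_mult_def transpose_def inner_vec_def matrix_vector_mult_def)
    then show ?thesis
      by (simp add: vec_eq_iff v mat_def matrix_mul_assoc[symmetric])
  qed
  then show ?thesis by (rule that)
qed

lemma matrix_inv_mult:
  assumes "invertible (A :: real^'n^'n)"
  shows "A ** matrix_inv A = mat 1" "matrix_inv A ** A = mat 1"
  using someI_ex[OF assms[unfolded invertible_def]] unfolding matrix_inv_def by auto

lemma posdef_invertible:
  fixes Q :: "real^'n^'n"
  assumes "\<And>x. x \<noteq> 0 \<Longrightarrow> 0 < x \<bullet> (Q *v x)"
  shows "invertible Q"
  using assms by (auto simp: invertible_left_inverse matrix_left_invertible_ker) (metis inner_zero_right less_irrefl)

lemma posdef_matrix_inv:
  fixes Q :: "real^'n^'n"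
  assumes sym: "transpose Q = Q" and pos: "\<And>x. x \<noteq> 0 \<Longrightarrow> 0 < x \<bullet> (Q *v x)"
  shows "transpose (matrix_inv Q) = matrix_inv Q" "x \<noteq> 0 \<Longrightarrow> 0 < x \<bullet> (matrix_inv Q *v x)"
proof -
  note inv = matrix_inv_mult[OF posdef_invertible[OF pos]]
  have "transpose (matrix_inv Q) ** Q = mat 1"
    using inv(1) by (metis matrix_transpose_mul sym transpose_mat)
  then show "transpose (matrix_inv Q) = matrix_inv Q"
    by (metis inv(1) matrix_mul_assoc matrix_mul_lid matrix_mul_rid)
  assume x: "x \<noteq> 0"
  have Qx: "Q *v (matrix_inv Q *v x) = x"
    by (simp add: matrix_vector_mul_assoc inv)
  with x have "matrix_inv Q *v x \<noteq> 0" by auto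
  from pos[OF this] show "0 < x \<bullet> (matrix_inv Q *v x)"
    by (simp add: Qx inner_commute)
qed

text \<open>The congruence is applied to the inverse of \<open>\<Sigma>\<close>, because the density
  contains the inverse: substituting \<open>A *v u\<close> then turns the exponent into that of a
  standard normal law.\<close>

lemma posdef_factorization:
  fixes \<Sigma> :: "real^'n^'n"
  assumes "transpose \<Sigma> = \<Sigma>" and "\<And>x. x \<noteq> 0 \<Longrightarrow> 0 < x \<bullet> (\<Sigma> *v x)"
  obtains A :: "real^'n^'n" where "det A \<noteq> 0" "\<Sigma> = A ** transpose A" "transpose A ** matrix_inv \<Sigma> ** A = mat 1"
proof -
  obtain A :: "real^'n^'n" where A: "transpose A ** matrix_inv \<Sigma> ** A = mat 1"
    using posdef_congruent_identity[of "matrix_inv \<Sigma>"] posdef_matrix_inv[OF assms] by blast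
  then have A': "A ** (transpose A ** matrix_inv \<Sigma>) = mat 1"
    using matrix_left_right_inverse1 by blast
  have "det A \<noteq> 0"
    using A by (metis det_I det_mul mult_zero_right zero_neq_one)
  moreover have "\<Sigma> = A ** transpose A"
    using A' matrix_inv_mult[OF posdef_invertible[OF assms(2)]]
    by (metis matrix_mul_assoc matrix_mul_lid matrix_mul_rid)
  ultimately show ?thesis using A by (rule that)
qed

lemma integral_lborel_cart_prod:
  fixes g :: "'n::finite \<Rightarrow> real \<Rightarrow> complex"
  assumes "\<And>i. integrable lborel (g i)"
  shows "(LINT x|(lborel :: (real^'n) measure). (\<Prod>i\<in>UNIV. g i (x $ i))) = (\<Prod>i\<in>UNIV. (LINT t|lborel. g i t))"
proof -
  interpret product_sigma_finite "\<lambda>_::'n. lborel :: real measure" ..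
  have [measurable]: "g i \<in> borel_measurable borel" for i
    using borel_measurable_integrable[OF assms[of i]] by simp
  show ?thesis
    by (subst lborel_cart, subst integral_distr)
      (auto simp: product_integral_prod[OF finite assms])
qed

definition std_mvnormal :: "(real^'n) measure" where
  "std_mvnormal = density lborel (\<lambda>u. ennreal (\<Prod>i\<in>UNIV. std_normal_density (u $ i)))"

text \<open>Under \<open>y = A *v u\<close> the quadratic form becomes \<open>u \<bullet> u\<close>,
  and the Jacobian cancels because the square root of \<open>det \<Sigma>\<close> is the modulus of
  \<open>det A\<close>.\<close>

lemma mvnormal_eq_distr:
  fixes \<Sigma> :: "real^'n^'n"
  assumes \<Sigma>: "\<Sigma> = A ** transpose A" and A: "det A \<noteq> 0" "transpose A ** matrix_inv \<Sigma> ** A = mat 1"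
  shows "mvnormal 0 \<Sigma> = distr std_mvnormal borel (\<lambda>u. A *v u)"
proof (rule measure_eqI)
  show "sets (mvnormal 0 \<Sigma>) = sets (distr std_mvnormal borel (\<lambda>u. A *v u))"
    by (simp add: mvnormal_def)
  fix B assume "B \<in> sets (mvnormal 0 \<Sigma>)"
  then have [measurable]: "B \<in> sets borel" by (simp add: mvnormal_def)
  have [measurable]: "(\<lambda>u. A *v u) -` B \<in> sets borel"
    using measurable_sets[OF matrix_vector_mult_measurable \<open>B \<in> sets borel\<close>] by simp
  let ?d = "\<lambda>y. exp (- (y \<bullet> (matrix_inv \<Sigma> *v y)) / 2) / sqrt ((2 * pi) ^ CARD('n) * det \<Sigma>)"
  have [measurable]: "?d \<in> borel_measurable borel"
    by (intro borel_measurable_continuous_onI continuous_intros) (use A in \<open>auto simp: \<Sigma> det_mul det_transpose\<close>)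
  have q: "(A *v u) \<bullet> (matrix_inv \<Sigma> *v (A *v u)) = u \<bullet> u" for u
  proof -
    have "(A *v u) \<bullet> (matrix_inv \<Sigma> *v (A *v u)) = u \<bullet> ((transpose A ** matrix_inv \<Sigma> ** A) *v u)"
      by (metis dot_lmul_matrix inner_commute matrix_vector_mul_assoc transpose_matrix_vector transpose_transpose)
    then show ?thesis by (simp add: A)
  qed
  have d: "\<bar>det A\<bar> * ?d (A *v u) = (\<Prod>i\<in>UNIV. std_normal_density (u $ i))" for u
  proof -
    have "(\<Prod>i\<in>UNIV. std_normal_density (u $ i)) = exp (- (u \<bullet> u) / 2) / sqrt (2 * pi) ^ CARD('n)"
    proof -
      have "(\<Prod>i\<in>UNIV. std_normal_density (u $ i)) =
          (\<Prod>i\<in>(UNIV::'n set). 1 / sqrt (2 * pi)) * exp (\<Sum>i\<in>UNIV. - (u $ i)\<^sup>2 / 2)"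
        by (simp add: std_normal_density_def prod_dividef exp_sum power_one_over)
      also have "(\<Sum>i\<in>UNIV. - (u $ i)\<^sup>2 / 2) = - (u \<bullet> u) / 2"
        by (simp add: inner_vec_def power2_eq_square sum_negf sum_divide_distrib)
      finally show ?thesis by (simp add: power_one_over)
    qed
    moreover have "sqrt ((2 * pi) ^ CARD('n) * det \<Sigma>) = sqrt (2 * pi) ^ CARD('n) * \<bar>det A\<bar>"
      by (simp add: \<Sigma> det_mul det_transpose real_sqrt_mult real_sqrt_power power_mult_distrib)
    ultimately show ?thesis using A by (simp add: q)
  qed
  have "emeasure (mvnormal 0 \<Sigma>) B = (\<integral>\<^sup>+y. ennreal (?d y) * indicator B y \<partial>lborel)"
    unfolding mvnormal_def by (subst emeasure_density) auto
  also have "\<dots> = ennreal \<bar>det A\<bar> * (\<integral>\<^sup>+u. ennreal (?d (A *v u)) * indicator B (A *v u) \<partial>lborel)"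
    by (rule nn_integral_lborel_matrix[OF A(1)]) measurable
  also have "\<dots> = (\<integral>\<^sup>+u. ennreal (\<bar>det A\<bar> * ?d (A *v u)) * indicator B (A *v u) \<partial>lborel)"
    by (subst nn_integral_cmult[symmetric]) (measurable, simp only: ennreal_mult'[OF abs_ge_zero] mult.assoc)
  also have "\<dots> = (\<integral>\<^sup>+u. ennreal (\<Prod>i\<in>UNIV. std_normal_density (u $ i)) * indicator ((\<lambda>u. A *v u) -` B) u \<partial>lborel)"
    unfolding d by (simp add: indicator_def)
  also have "\<dots> = emeasure (distr std_mvnormal borel (\<lambda>u. A *v u)) B"
    by (subst emeasure_distr) (auto simp: std_mvnormal_def emeasure_density indicator_def)
  finally show "emeasure (mvnormal 0 \<Sigma>) B = emeasure (distr std_mvnormal borel (\<lambda>u. A *v u)) B" .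
qed

text \<open>Density and exponential both factor over the coordinates, which leaves a product of
  one-dimensional normal characteristic functions.\<close>

lemma std_mvnormal_char:
  "(CLINT u|std_mvnormal. iexp (b \<bullet> u)) = complex_of_real (exp (- (b \<bullet> b) / 2))"
proof -
  have [simp]: "integrable lborel (\<lambda>t. complex_of_real (std_normal_density t) * iexp (c * t))" for c
  proof -
    have "integrable std_normal_distribution (\<lambda>t. iexp (c * t))"
      by (rule prob_space.integrable_iexp[OF real_distribution.axioms(1)[OF real_dist_normal_dist]]) auto
    then show ?thesis
      by (simp add: integrable_density scaleR_conv_of_real)
  qed
  have "(CLINT u|std_mvnormal. iexp (b \<bullet> u)) =
      (CLINT u|lborel. (\<Prod>i\<in>UNIV. complex_of_real (std_normal_density (u $ i)) * iexp (b $ i * u $ i)))"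
    unfolding std_mvnormal_def
    by (subst integral_density)
      (auto simp: prod_nonneg scaleR_conv_of_real prod.distrib exp_sum inner_vec_def sum_distrib_left
        intro!: Bochner_Integration.integral_cong)
  also have "\<dots> = (\<Prod>i\<in>UNIV. (CLINT t|lborel. complex_of_real (std_normal_density t) * iexp (b $ i * t)))"
    by (rule integral_lborel_cart_prod) (simp del: of_real_mult)
  also have "\<dots> = (\<Prod>i\<in>UNIV. char std_normal_distribution (b $ i))"
    unfolding char_def by (subst integral_density) (auto simp: scaleR_conv_of_real)
  also have "\<dots> = complex_of_real (exp (- (b \<bullet> b) / 2))"
    by (simp add: char_std_normal_distribution of_real_prod[symmetric] exp_sum[symmetric] inner_vec_def
        power2_eq_square sum_negf sum_divide_distrib del: of_real_prod of_real_exp)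
  finally show ?thesis .
qed

text \<open>Pulling back along \<open>A\<close> replaces \<open>a\<close> by
  \<open>transpose A *v a\<close>, whose squared norm is
  \<open>a \<bullet> (\<Sigma> *v a)\<close>.\<close>

lemma
  fixes \<Sigma> :: "real^'n^'n"
  assumes "transpose \<Sigma> = \<Sigma>" and "\<And>x. x \<noteq> 0 \<Longrightarrow> 0 < x \<bullet> (\<Sigma> *v x)"
  shows mvnormal_char: "(CLINT y|mvnormal 0 \<Sigma>. iexp (a \<bullet> y)) = complex_of_real (exp (- (a \<bullet> (\<Sigma> *v a)) / 2))"
    and prob_space_mvnormal: "prob_space (mvnormal 0 \<Sigma>)"
proof -
  obtain A :: "real^'n^'n" where A: "det A \<noteq> 0" "\<Sigma> = A ** transpose A" "transpose A ** matrix_inv \<Sigma> ** A = mat 1"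
    by (rule posdef_factorization[OF assms])
  note eq = mvnormal_eq_distr[OF A(2,1,3)]
  have [measurable]: "(\<lambda>u. A *v u) \<in> std_mvnormal \<rightarrow>\<^sub>M borel"
    by (simp add: std_mvnormal_def)
  have "(CLINT y|mvnormal 0 \<Sigma>. iexp (a \<bullet> y)) = (CLINT u|std_mvnormal. iexp ((transpose A *v a) \<bullet> u))"
    unfolding eq by (subst integral_distr) (auto simp: dot_lmul_matrix)
  also have "\<dots> = complex_of_real (exp (- (a \<bullet> (\<Sigma> *v a)) / 2))"
    unfolding std_mvnormal_char
    by (simp add: A(2) dot_lmul_matrix matrix_vector_mul_assoc[symmetric])
  finally show "(CLINT y|mvnormal 0 \<Sigma>. iexp (a \<bullet> y)) = complex_of_real (exp (- (a \<bullet> (\<Sigma> *v a)) / 2))" .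
  have "emeasure (std_mvnormal :: (real^'n) measure) UNIV = 1"
  proof -
    interpret product_sigma_finite "\<lambda>_::'n. lborel :: real measure" ..
    have "(\<integral>\<^sup>+t. ennreal (std_normal_density t) \<partial>lborel) = 1"
      using prob_space.emeasure_space_1[OF real_distribution.axioms(1)[OF real_dist_normal_dist]]
      by (simp add: emeasure_density)
    then show ?thesis
      using product_nn_integral_prod[of UNIV "\<lambda>_ t. ennreal (std_normal_density t)"]
      by (simp add: std_mvnormal_def emeasure_density lborel_cart nn_integral_distr flip: prod_ennreal)
  qed
  then have "prob_space (std_mvnormal :: (real^'n) measure)"
    by (intro prob_spaceI) (simp add: std_mvnormal_def)
  then show "prob_space (mvnormal 0 \<Sigma>)"
    unfolding eq by (rule prob_space.prob_space_distr) measurable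
qed

section \<open>Sums over triangular arrays\<close>

lemma exp_neg_approx:
  fixes x :: real
  assumes "0 \<le> x"
  shows "\<bar>exp (- x) - (1 - x)\<bar> \<le> x\<^sup>2"
proof -
  have "1 - x \<le> exp (- x)" using exp_ge_add_one_self[of "- x"] by simp
  moreover have "exp (- x) \<le> 1 / (1 + x)"
    using exp_ge_add_one_self[of x] assms by (simp add: exp_minus field_simps)
  moreover have "1 / (1 + x) \<le> 1 - x + x\<^sup>2"
    using assms by (simp add: field_simps power2_eq_square)
  ultimately show ?thesis by simp
qed

text \<open>The uniform bound \<open>c n\<close>, which tends to 0, plays the role of Lindeberg's
  condition. By independence the characteristic function is an \<open>n\<close>-th power; its base
  differs from \<open>exp (- m / 2)\<close>, with \<open>m\<close> the second moment of one summand,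
  by at most \<open>m\<close> times a null sequence, and \<open>n * m\<close> converges.\<close>

lemma (in prob_space) triangular_clt_char:
  fixes X :: "nat \<Rightarrow> 'a \<Rightarrow> real" and G :: "nat \<Rightarrow> real \<Rightarrow> real"
  assumes indep: "indep_vars (\<lambda>_. borel) X UNIV"
    and D: "\<And>i. distr M borel (X i) = D"
    and G: "\<And>n. G n \<in> borel_measurable borel"
    and bd: "\<forall>\<^sub>F n in sequentially. \<forall>y. \<bar>G n y\<bar> \<le> c n" and c: "c \<longlonglongrightarrow> 0"
    and mean: "\<forall>\<^sub>F n in sequentially. (LINT y|D. G n y) = 0"
    and var: "(\<lambda>n. real n * (LINT y|D. (G n y)\<^sup>2)) \<longlonglongrightarrow> v"
  shows "(\<lambda>n. CLINT \<omega>|M. iexp (\<Sum>i<n. G n (X i \<omega>))) \<longlonglongrightarrow> complex_of_real (exp (- v / 2))"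
proof -
  note G[measurable]
  have X[measurable]: "X i \<in> borel_measurable M" for i
    using indep unfolding indep_vars_def by simp
  define m where "m n = (LINT y|D. (G n y)\<^sup>2)" for n
  define \<phi> where "\<phi> n = (CLINT y|D. iexp (G n y))" for n
  have prod: "(CLINT \<omega>|M. iexp (\<Sum>i<n. G n (X i \<omega>))) = \<phi> n ^ n" for n
  proof -
    have ind: "indep_vars (\<lambda>_. borel) (\<lambda>i \<omega>. G n (X i \<omega>)) {..<n}"
      by (rule indep_vars_compose2[where X = X]) (auto intro: indep_vars_subset[OF indep])
    have *: "(CLINT \<omega>|M. iexp (G n (X i \<omega>))) = \<phi> n" for i
      unfolding \<phi>_def D[symmetric, of i] by (subst integral_distr) auto
    from char_distr_sum[OF ind, of 1]
    have "(CLINT \<omega>|M. iexp (\<Sum>i<n. G n (X i \<omega>))) = (\<Prod>i<n. (CLINT \<omega>|M. iexp (G n (X i \<omega>))))"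
      by (simp add: char_def integral_distr)
    then show ?thesis by (simp add: *)
  qed
  have m0: "0 \<le> m n" for n by (simp add: m_def)
  have est: "\<forall>\<^sub>F n in sequentially. cmod (\<phi> n ^ n - complex_of_real (exp (- (real n * m n) / 2)))
      \<le> (real n * m n) * (c n / 6 + (c n)\<^sup>2 / 4)"
    using bd mean
  proof eventually_elim
    case (elim n)
    then have c0: "0 \<le> c n" using abs_ge_zero order_trans by blast
    have bdX: "\<bar>G n (X 0 \<omega>)\<bar> \<le> c n" for \<omega> using elim by blast
    have bdX2: "(G n (X 0 \<omega>))\<^sup>2 \<le> (c n)\<^sup>2" for \<omega>
      using bdX[of \<omega>] c0 by (metis abs_le_square_iff abs_of_nonneg)
    have int: "integrable M (\<lambda>\<omega>. G n (X 0 \<omega>))"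
      by (rule integrable_const_bound[of _ "c n"]) (use bdX in auto)
    have int2: "integrable M (\<lambda>\<omega>. (G n (X 0 \<omega>))\<^sup>2)"
      by (rule integrable_const_bound[of _ "(c n)\<^sup>2"]) (use bdX2 in auto)
    have mM: "m n = expectation (\<lambda>\<omega>. (G n (X 0 \<omega>))\<^sup>2)"
      unfolding m_def D[symmetric, of 0] by (subst integral_distr) auto
    have "(LINT y|D. G n y) = expectation (\<lambda>\<omega>. G n (X 0 \<omega>))"
      unfolding D[symmetric, of 0] by (subst integral_distr) auto
    with elim have mean0: "expectation (\<lambda>\<omega>. G n (X 0 \<omega>)) = 0" by simp
    have "m n \<le> expectation (\<lambda>\<omega>. (c n)\<^sup>2)"
      unfolding mM using int2 bdX2 by (intro integral_mono) auto
    then have mc: "m n \<le> (c n)\<^sup>2" by (simp add: prob_space)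
    have \<phi>_char: "\<phi> n = char (distr M borel (\<lambda>\<omega>. G n (X 0 \<omega>))) 1"
      unfolding \<phi>_def D[symmetric, of 0] char_def by (subst (1 2) integral_distr) auto
    \<comment> \<open>Third-order expansion of a characteristic function with mean zero; the cubic
      term is at most \<open>c n\<close> times the square, so its expectation is at most
      \<open>c n * m n\<close>.\<close>
    have "cmod (\<phi> n - (1 - 1\<^sup>2 * m n / 2)) \<le> (1\<^sup>2 / 6) * expectation (\<lambda>\<omega>. min (6 * (G n (X 0 \<omega>))\<^sup>2) (\<bar>1\<bar> * \<bar>G n (X 0 \<omega>)\<bar> ^ 3))"
      unfolding \<phi>_char
      by (rule char_approx3'[OF _ int int2 mean0 _ refl]) (auto simp: mM mean0)
    also have "\<dots> \<le> (1\<^sup>2 / 6) * expectation (\<lambda>\<omega>. c n * (G n (X 0 \<omega>))\<^sup>2)"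
    proof (intro mult_left_mono integral_mono)
      show "integrable M (\<lambda>\<omega>. min (6 * (G n (X 0 \<omega>))\<^sup>2) (\<bar>1\<bar> * \<bar>G n (X 0 \<omega>)\<bar> ^ 3))"
        by (rule integrable_const_bound[of _ "6 * (c n)\<^sup>2"]) (use bdX2 in \<open>auto simp: min_le_iff_disj\<close>)
      show "min (6 * (G n (X 0 \<omega>))\<^sup>2) (\<bar>1\<bar> * \<bar>G n (X 0 \<omega>)\<bar> ^ 3) \<le> c n * (G n (X 0 \<omega>))\<^sup>2" for \<omega>
      proof -
        have "\<bar>G n (X 0 \<omega>)\<bar> ^ 3 = \<bar>G n (X 0 \<omega>)\<bar> * (G n (X 0 \<omega>))\<^sup>2"
          by (simp add: eval_nat_numeral)
        then show ?thesis
          using mult_right_mono[OF bdX[of \<omega>], of "(G n (X 0 \<omega>))\<^sup>2"] by (simp add: min_le_iff_disj)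
      qed
    qed (use int2 in auto)
    also have "\<dots> = c n * m n / 6" using mM by simp
    finally have 1: "cmod (\<phi> n - (1 - m n / 2)) \<le> c n * m n / 6" by simp
    have "\<bar>exp (- (m n / 2)) - (1 - m n / 2)\<bar> \<le> (m n / 2)\<^sup>2"
      using m0[of n] by (intro exp_neg_approx) simp
    also have "\<dots> \<le> m n * ((c n)\<^sup>2 / 4)"
      using mult_left_mono[OF mc m0[of n]] by (simp add: power2_eq_square)
    finally have "cmod (complex_of_real (exp (- (m n / 2)) - (1 - m n / 2))) \<le> m n * ((c n)\<^sup>2 / 4)"
      unfolding norm_of_real .
    with 1 have 2: "cmod (\<phi> n - complex_of_real (exp (- (m n / 2)))) \<le> m n * (c n / 6 + (c n)\<^sup>2 / 4)"
      using norm_triangle_ineq4[of "\<phi> n - (1 - m n / 2)" "complex_of_real (exp (- (m n / 2)) - (1 - m n / 2))"]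
      by (simp add: algebra_simps)
    \<comment> \<open>Both bases have modulus at most 1, so their \<open>n\<close>-th powers differ
      by at most \<open>n\<close> times the difference of the bases.\<close>
    have "cmod (\<phi> n) \<le> 1"
      unfolding \<phi>_char by (rule real_distribution.cmod_char_le_1) (simp add: real_distribution_distr)
    then have "cmod (\<phi> n ^ n - complex_of_real (exp (- (m n / 2))) ^ n)
        \<le> real n * cmod (\<phi> n - complex_of_real (exp (- (m n / 2))))"
      using m0[of n] by (intro norm_power_diff) (auto simp: norm_of_real simp del: of_real_exp)
    also have "\<dots> \<le> real n * (m n * (c n / 6 + (c n)\<^sup>2 / 4))" by (intro mult_left_mono 2) simp
    also have "complex_of_real (exp (- (m n / 2))) ^ n = complex_of_real (exp (- (real n * m n) / 2))"
      by (simp add: exp_of_nat_mult[symmetric] flip: of_real_power)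
    finally show ?case by (simp add: mult.assoc)
  qed
  have lim: "(\<lambda>n. complex_of_real (exp (- (real n * m n) / 2))) \<longlonglongrightarrow> complex_of_real (exp (- v / 2))"
    using var unfolding m_def by (intro tendsto_intros) auto
  have "(\<lambda>n. (real n * m n) * (c n / 6 + (c n)\<^sup>2 / 4)) \<longlonglongrightarrow> v * (0 / 6 + 0\<^sup>2 / 4)"
    using var c unfolding m_def by (intro tendsto_intros) auto
  then have "(\<lambda>n. \<phi> n ^ n - complex_of_real (exp (- (real n * m n) / 2))) \<longlonglongrightarrow> 0"
    using est by (intro Lim_null_comparison[OF est]) simp
  from tendsto_add[OF this lim] show ?thesis unfolding prod by simp
qed

lemma (in prob_space) sum_second_moment:
  fixes X :: "nat \<Rightarrow> 'a \<Rightarrow> real"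
  assumes indep: "indep_vars (\<lambda>_. borel) X UNIV"
    and D: "\<And>i. distr M borel (X i) = D"
    and G[measurable]: "G \<in> borel_measurable borel"
    and bd: "\<And>y. \<bar>G y\<bar> \<le> c"
    and mean: "(LINT y|D. G y) = 0"
  shows "expectation (\<lambda>\<omega>. (\<Sum>i<n. G (X i \<omega>))\<^sup>2) = real n * (LINT y|D. (G y)\<^sup>2)"
proof -
  have X[measurable]: "X i \<in> borel_measurable M" for i
    using indep unfolding indep_vars_def by simp
  have int: "integrable M (\<lambda>\<omega>. G (X i \<omega>))" for i
    by (rule integrable_const_bound[of _ c]) (use bd in auto)
  have int2: "integrable M (\<lambda>\<omega>. G (X i \<omega>) * G (X j \<omega>))" for i j
    by (rule integrable_const_bound[of _ "c * c"])
      (use bd abs_ge_zero[THEN order_trans, OF bd] in \<open>auto simp: abs_mult intro!: mult_mono\<close>)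
  have E: "expectation (\<lambda>\<omega>. G (X i \<omega>)) = 0" for i
    using mean unfolding D[symmetric, of i] by (subst (asm) integral_distr) auto
  have E2: "expectation (\<lambda>\<omega>. G (X i \<omega>) * G (X j \<omega>)) = (if i = j then (LINT y|D. (G y)\<^sup>2) else 0)" for i j
  proof (cases "i = j")
    case True
    then show ?thesis
      unfolding D[symmetric, of i] by (subst integral_distr) (auto simp: power2_eq_square)
  next
    case False
    have "indep_vars (\<lambda>_. borel) (\<lambda>i \<omega>. G (X i \<omega>)) {i, j}"
      by (rule indep_vars_compose2[where X = X]) (auto intro: indep_vars_subset[OF indep])
    from indep_vars_lebesgue_integral[OF _ this] int False
    show ?thesis by (simp add: E)
  qed
  have "expectation (\<lambda>\<omega>. (\<Sum>i<n. G (X i \<omega>))\<^sup>2) = expectation (\<lambda>\<omega>. \<Sum>i<n. \<Sum>j<n. G (X i \<omega>) * G (X j \<omega>))"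
    by (simp add: power2_eq_square sum_product)
  also have "\<dots> = (\<Sum>i<n. \<Sum>j<n. expectation (\<lambda>\<omega>. G (X i \<omega>) * G (X j \<omega>)))"
    using int2 by (subst Bochner_Integration.integral_sum; auto intro!: sum.cong Bochner_Integration.integral_sum)
  also have "\<dots> = real n * (LINT y|D. (G y)\<^sup>2)"
    by (simp add: E2)
  finally show ?thesis .
qed

lemma (in prob_space) sum_chebyshev:
  fixes X :: "nat \<Rightarrow> 'a \<Rightarrow> real"
  assumes "indep_vars (\<lambda>_. borel) X UNIV" "\<And>i. distr M borel (X i) = D"
    and G[measurable]: "G \<in> borel_measurable borel"
    and bd: "\<And>y. \<bar>G y\<bar> \<le> c" and "(LINT y|D. G y) = 0" and a: "0 < a"
  shows "prob {\<omega>\<in>space M. a < \<bar>\<Sum>i<n. G (X i \<omega>)\<bar>} \<le> real n * (LINT y|D. (G y)\<^sup>2) / a\<^sup>2"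
proof -
  have X[measurable]: "X i \<in> borel_measurable M" for i
    using assms(1) unfolding indep_vars_def by simp
  let ?S = "\<lambda>\<omega>. \<Sum>i<n. G (X i \<omega>)"
  have "\<bar>?S \<omega>\<bar> \<le> real n * c" for \<omega>
    using sum_norm_bound[of "{..<n}" "\<lambda>i. G (X i \<omega>)" c] bd by simp
  then have "(?S \<omega>)\<^sup>2 \<le> (real n * c)\<^sup>2" for \<omega>
    by (metis abs_ge_zero abs_le_square_iff abs_of_nonneg order_trans)
  then have int: "integrable M (\<lambda>\<omega>. (?S \<omega>)\<^sup>2)"
    by (intro integrable_const_bound[of _ "(real n * c)\<^sup>2"]) auto
  have "prob {\<omega>\<in>space M. a < \<bar>?S \<omega>\<bar>} \<le> prob {\<omega>\<in>space M. a\<^sup>2 \<le> (?S \<omega>)\<^sup>2}"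
    using a by (intro finite_measure_mono) (auto simp: abs_le_square_iff[symmetric] abs_of_pos)
  also have "\<dots> \<le> expectation (\<lambda>\<omega>. (?S \<omega>)\<^sup>2) / a\<^sup>2"
    using a int by (intro integral_Markov_inequality_measure[where A = "{}"]) auto
  finally show ?thesis
    using sum_second_moment[OF assms(1-5)] by simp
qed

section \<open>Perturbed linear systems\<close>

text \<open>\<open>norm\<close> of a matrix is the Euclidean norm of all its entries, so this is the
  Cauchy--Schwarz inequality row by row.\<close>

lemma norm_matrix_vector_mult_le: "norm ((A :: real^'n^'m) *v x) \<le> norm A * norm x"
proof -
  have "norm (A *v x) \<le> norm (\<chi> i. norm (A $ i) * norm x)"
    by (rule norm_le_componentwise_cart)
      (simp add: matrix_mult_dot abs_mult Cauchy_Schwarz_ineq2)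
  also have "(\<chi> i. norm (A $ i) * norm x) = norm x *\<^sub>R (\<chi> i. norm (A $ i))"
    by (simp add: vec_eq_iff)
  also have "norm (norm x *\<^sub>R (\<chi> i. norm (A $ i))) = norm (\<chi> i. norm (A $ i)) * norm x"
    by simp
  also have "norm (\<chi> i. norm (A $ i)) = norm A"
    by (subst (1 2) norm_vec_def) (simp add: L2_set_def)
  finally show ?thesis .
qed

text \<open>Within radius \<open>1 / (2 * k)\<close> the perturbation absorbs half of
  \<open>norm u\<close>, so \<open>norm u\<close> is at most \<open>2 * k\<close> times
  \<open>norm (B' *v u)\<close>, and the kernel of \<open>B'\<close> is trivial. The error is the
  inverse of \<open>B\<close> applied to \<open>(B - B') *v u\<close>. It is expressed through
  \<open>B' *v u\<close>, the right-hand side of the perturbed system, which is the quantity known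
  to be bounded or tight.\<close>

lemma matrix_perturbation:
  fixes B :: "real^'n^'n"
  assumes "invertible B"
  obtains K \<delta> where "0 < K" "0 < \<delta>"
    "\<And>B'. norm (B' - B) < \<delta> \<Longrightarrow> invertible B'"
    "\<And>B' u. norm (B' - B) < \<delta> \<Longrightarrow>
      norm (u - matrix_inv B *v (B' *v u)) \<le> K * norm (B' - B) * norm (B' *v u)"
proof -
  note inv = matrix_inv_mult[OF assms]
  define k where "k = norm (matrix_inv B) + 1"
  have k: "0 < k" unfolding k_def using norm_ge_zero[of "matrix_inv B"] by linarith
  have invk: "norm (matrix_inv B *v w) \<le> k * norm w" for w
    using norm_matrix_vector_mult_le[of "matrix_inv B" w] norm_ge_zero[of w]
    unfolding k_def distrib_right by linarith
  have low: "norm u \<le> 2 * k * norm (B' *v u)" if "norm (B' - B) < 1 / (2 * k)" for B' u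
  proof -
    have "norm u = norm (matrix_inv B *v (B *v u))" by (simp add: matrix_vector_mul_assoc inv)
    also have "\<dots> \<le> k * norm (B *v u)" by (rule invk)
    also have "B *v u = B' *v u - (B' - B) *v u" by (simp add: matrix_vector_mult_diff_rdistrib)
    also have "norm \<dots> \<le> norm (B' *v u) + norm ((B' - B) *v u)" by (rule norm_triangle_ineq4)
    also have "norm ((B' - B) *v u) \<le> 1 / (2 * k) * norm u"
      using norm_matrix_vector_mult_le[of "B' - B" u] mult_right_mono[OF less_imp_le[OF that], of "norm u"] by simp
    finally have "norm u \<le> k * (norm (B' *v u) + 1 / (2 * k) * norm u)" using k by simp
    then show ?thesis using k by (simp add: field_simps)
  qed
  show ?thesis
  proof
    show "0 < 2 * k * k" "0 < 1 / (2 * k)" using k by auto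
    fix B' :: "real^'n^'n" assume B': "norm (B' - B) < 1 / (2 * k)"
    have "u = 0" if "B' *v u = 0" for u
      using low[OF B', of u] that by simp
    then show "invertible B'"
      by (simp add: invertible_left_inverse matrix_left_invertible_ker)
    fix u
    have "u - matrix_inv B *v (B' *v u) = matrix_inv B *v ((B - B') *v u)"
      by (simp add: matrix_vector_mult_diff_rdistrib matrix_vector_mult_diff_distrib matrix_vector_mul_assoc inv)
    also have "norm \<dots> \<le> k * norm ((B - B') *v u)" by (rule invk)
    also have "\<dots> \<le> k * (norm (B' - B) * norm u)"
      using k norm_matrix_vector_mult_le[of "B - B'" u] by (simp add: norm_minus_commute)
    also have "\<dots> \<le> k * (norm (B' - B) * (2 * k * norm (B' *v u)))"
      using k low[OF B', of u] by (intro mult_left_mono) auto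
    finally show "norm (u - matrix_inv B *v (B' *v u)) \<le> 2 * k * k * norm (B' - B) * norm (B' *v u)"
      by (simp add: algebra_simps)
  qed
qed

lemma tendsto_matrix_vector_solve:
  fixes B :: "real^'n^'n"
  assumes "invertible B" "Bn \<longlonglongrightarrow> B" "(\<lambda>n. Bn n *v u n) \<longlonglongrightarrow> w"
  shows "u \<longlonglongrightarrow> matrix_inv B *v w"
proof -
  obtain K \<delta> where K: "0 < K" "0 < \<delta>" "\<And>B' u. norm (B' - B) < \<delta> \<Longrightarrow>
      norm (u - matrix_inv B *v (B' *v u)) \<le> K * norm (B' - B) * norm (B' *v u)"
    by (rule matrix_perturbation[OF assms(1)]) blast
  have ev: "\<forall>\<^sub>F n in sequentially. norm (Bn n - B) < \<delta>"
    using tendstoD[OF assms(2) K(2)] by (simp add: dist_norm)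
  have "(\<lambda>n. K * norm (Bn n - B) * norm (Bn n *v u n)) \<longlonglongrightarrow> K * norm (B - B) * norm w"
    by (intro tendsto_intros assms)
  then have lim0: "(\<lambda>n. K * norm (Bn n - B) * norm (Bn n *v u n)) \<longlonglongrightarrow> 0" by simp
  have "\<forall>\<^sub>F n in sequentially. norm (u n - matrix_inv B *v (Bn n *v u n)) \<le> K * norm (Bn n - B) * norm (Bn n *v u n)"
    using ev by eventually_elim (rule K(3))
  from Lim_null_comparison[OF this lim0]
  have "(\<lambda>n. u n - matrix_inv B *v (Bn n *v u n)) \<longlonglongrightarrow> 0" .
  moreover have "(\<lambda>n. matrix_inv B *v (Bn n *v u n)) \<longlonglongrightarrow> matrix_inv B *v w"
    by (intro bounded_linear.tendsto[OF matrix_vector_mul_bounded_linear] assms)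
  ultimately have "(\<lambda>n. (u n - matrix_inv B *v (Bn n *v u n)) + matrix_inv B *v (Bn n *v u n)) \<longlonglongrightarrow> 0 + matrix_inv B *v w"
    by (rule tendsto_add)
  then show ?thesis by simp
qed

lemma eventually_invertible:
  fixes B :: "real^'n^'n"
  assumes "invertible B" "(Bn \<longlongrightarrow> B) F"
  shows "\<forall>\<^sub>F n in F. invertible (Bn n)"
proof -
  obtain \<delta> where d: "0 < \<delta>" "\<And>B'. norm (B' - B) < \<delta> \<Longrightarrow> invertible B'"
    by (rule matrix_perturbation[OF assms(1)]) blast
  show ?thesis
    using tendstoD[OF assms(2) d(1)] by eventually_elim (rule d(2), simp add: dist_norm)
qed

section \<open>The matrices of the estimator\<close>

lemma bij_betw_pos: "bij_betw (pos :: 's::{finite,linorder} \<Rightarrow> nat) UNIV {1..CARD('s)}"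
proof -
  have lt: "pos k < pos l" if "k < l" for k l :: 's
    unfolding pos_def using that by (intro psubset_card_mono) auto
  then have inj: "inj (pos :: 's \<Rightarrow> nat)"
    by (intro injI) (metis less_irrefl linorder_less_linear)
  have "pos k \<in> {1..CARD('s)}" for k :: 's
    unfolding pos_def by (auto intro!: card_mono simp: Suc_le_eq card_gt_0_iff)
  then have "range (pos :: 's \<Rightarrow> nat) \<subseteq> {1..CARD('s)}" by auto
  moreover have "card (range (pos :: 's \<Rightarrow> nat)) = CARD('s)"
    using inj by (simp add: card_image)
  ultimately have "range (pos :: 's \<Rightarrow> nat) = {1..CARD('s)}"
    by (intro card_subset_eq) auto
  with inj show ?thesis by (simp add: bij_betw_def)
qed

lemma pos_ge_1: "1 \<le> pos k" and pos_le: "pos (k :: 's::{finite,linorder}) \<le> CARD('s)"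
  using bij_betwE[OF bij_betw_pos] by force+

lemma pos_gt_0 [simp]: "0 < pos k"
  using pos_ge_1[of k] by linarith

lemma pos_eq_iff: "pos k = pos l \<longleftrightarrow> k = l"
  using bij_betw_imp_inj_on[OF bij_betw_pos] by (auto simp: inj_def)

lemma sum_pos: "(\<Sum>s\<in>(UNIV::'s::{finite,linorder} set). F (pos s)) = (\<Sum>k<CARD('s). F (Suc k))"
proof -
  have "(\<Sum>s\<in>(UNIV::'s set). F (pos s)) = sum F {1..CARD('s)}"
    by (rule sum.reindex_bij_betw[OF bij_betw_pos])
  also have "\<dots> = (\<Sum>k<CARD('s). F (Suc k))"
    by (simp add: sum.atLeast1_atMost_eq)
  finally show ?thesis .
qed

lemma poly_zero_on_interval:
  fixes p :: "real poly"
  assumes "a < b" "\<And>t. a < t \<Longrightarrow> t < b \<Longrightarrow> poly p t = 0"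
  shows "p = 0"
proof (rule ccontr)
  assume "p \<noteq> 0"
  then have "finite {t. poly p t = 0}" by (rule poly_roots_finite)
  moreover have "{a<..<b} \<subseteq> {t. poly p t = 0}" using assms(2) by auto
  ultimately have "finite {a<..<b}" by (rule finite_subset[rotated])
  then show False using assms(1) by (simp add: infinite_Ioo)
qed

text \<open>Linear independence of the powers of \<open>t + z\<close>. Since \<open>pos\<close> is
  injective with values at least 1, the exponents \<open>pos s - 1\<close> are distinct and the
  \<open>v $ s\<close> are the coefficients of a polynomial with infinitely many roots.\<close>

lemma poly_pos_expansion:
  fixes v :: "real^'s::{finite,linorder}"
  assumes "a < b" "\<And>t. a < t \<Longrightarrow> t < b \<Longrightarrow> (\<Sum>s\<in>UNIV. v $ s * (t + z) ^ (pos s - 1)) = 0"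
  shows "v = 0"
proof -
  define p where "p = (\<Sum>s\<in>UNIV. monom (v $ s) (pos s - 1))"
  have "poly p t = 0" if "a + z < t" "t < b + z" for t
    using assms(2)[of "t - z"] that by (simp add: p_def poly_sum poly_monom)
  then have "p = 0" using assms(1) by (intro poly_zero_on_interval[of "a + z" "b + z"]) auto
  have "coeff p (pos s - 1) = v $ s" for s
  proof -
    have "pos t - 1 = pos s - 1 \<longleftrightarrow> t = s" for t
      using pos_ge_1[of s] pos_ge_1[of t] pos_eq_iff[of t s] by auto
    then show ?thesis by (simp add: p_def coeff_sum coeff_monom)
  qed
  with \<open>p = 0\<close> show ?thesis by (simp add: vec_eq_iff)
qed

text \<open>Endpoints are null sets. This allows the cut-off kernels, whose derivative is set to 0
  at the ends, to be exchanged for polynomials.\<close>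

lemma LBINT_Icc_cong_Ioo:
  fixes a b :: real
  assumes "\<And>t. a < t \<Longrightarrow> t < b \<Longrightarrow> F t = G t"
  shows "(LBINT t:{a..b}. F t :: real) = (LBINT t:{a..b}. G t)"
  unfolding set_lebesgue_integral_def
proof (rule integral_discrete_difference[of "{a, b}"])
  fix t assume "t \<notin> {a, b}"
  then show "indicator {a..b} t *\<^sub>R F t = indicator {a..b} t *\<^sub>R G t"
    using assms[of t] by (cases "a < t \<and> t < b") (auto simp: indicator_def)
qed auto

lemma LBINT_nonneg_eq_0D:
  fixes F :: "real \<Rightarrow> real"
  assumes "a < b" "continuous_on {a..b} F" "\<And>t. a \<le> t \<Longrightarrow> t \<le> b \<Longrightarrow> 0 \<le> F t"
    and "(LBINT t:{a..b}. F t) = 0" "a \<le> t" "t \<le> b"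
  shows "F t = 0"
proof -
  note i = set_borel_integral_eq_integral[OF borel_integrable_atLeastAtMost'[OF assms(2)]]
  have "(F has_integral 0) (cbox a b)"
    using i assms(4) integrable_integral[OF i(1)] by simp
  from has_integral_0_cbox_imp_0[OF _ _ this, of t] assms show ?thesis by auto
qed

text \<open>The kernel without its cut-off: continuous and differentiable on the whole line, so that
  limits and integration by parts on the closed window involve no case distinction at the
  ends.\<close>

definition gfun_poly :: "real \<Rightarrow> nat \<Rightarrow> real \<Rightarrow> real" where
  "gfun_poly z j t = (t + z) ^ j * (t - 1)"

definition gder_poly :: "real \<Rightarrow> nat \<Rightarrow> real \<Rightarrow> real" where
  "gder_poly z j t = real j * (t + z) ^ (j - 1) * (t - 1) + (t + z) ^ j"

lemma continuous_on_gfun_poly [continuous_intros]: "continuous_on A (gfun_poly z j)"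
  unfolding gfun_poly_def by (intro continuous_intros)

lemma continuous_on_gder_poly [continuous_intros]: "continuous_on A (gder_poly z j)"
  unfolding gder_poly_def by (intro continuous_intros)

lemma has_real_derivative_gfun_poly: "(gfun_poly z j has_real_derivative gder_poly z j t) (at t within A)"
  unfolding gfun_poly_def gder_poly_def by (auto intro!: derivative_eq_intros simp: algebra_simps)

lemma gfun_eq_gfun_poly: "- z \<le> t \<Longrightarrow> t \<le> 1 \<Longrightarrow> gfun z j t = gfun_poly z j t"
  by (simp add: gfun_def gfun_poly_def)

lemma gder_eq_gder_poly: "- z < t \<Longrightarrow> t < 1 \<Longrightarrow> gder z j t = gder_poly z j t"
proof -
  assume t: "- z < t" "t < 1"
  have "(gfun z j has_real_derivative gder_poly z j t) (at t)"
  proof (rule has_field_derivative_transform_within_open[OF has_real_derivative_gfun_poly])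
    show "open {- z<..<1}" "t \<in> {- z<..<1}" using t by auto
  qed (auto simp: gfun_eq_gfun_poly)
  then show ?thesis using t by (simp add: gder_def DERIV_imp_deriv)
qed

lemma omega_eq_gfun_poly: "omega z j s = - (1 / fact (s - 1)) * (LBINT t:{-z..1}. gfun_poly z j t * t ^ (s - 1))"
  unfolding omega_def by (subst LBINT_Icc_cong_Ioo[where G = "\<lambda>t. gfun_poly z j t * t ^ (s - 1)"])
    (auto simp: gfun_eq_gfun_poly)

lemma V_mat_eq_gder_poly: "V_mat z $ j $ s = (LBINT t:{-z..1}. gder_poly z (pos j) t * gder_poly z (pos s) t)"
  unfolding V_mat_def vec_lambda_beta by (rule LBINT_Icc_cong_Ioo) (auto simp: gder_eq_gder_poly)

lemma LBINT_sum_continuous: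
  fixes F :: "'i \<Rightarrow> real \<Rightarrow> real"
  assumes "finite I" "\<And>i. i \<in> I \<Longrightarrow> continuous_on {a..b} (F i)"
  shows "(LBINT t:{a..b}. \<Sum>i\<in>I. F i t) = (\<Sum>i\<in>I. LBINT t:{a..b}. F i t)"
  using borel_integrable_atLeastAtMost'[OF assms(2)] assms(1)
  unfolding set_lebesgue_integral_def set_integrable_def scaleR_sum_right
  by (intro Bochner_Integration.integral_sum) auto

text \<open>
  If \<open>\<Omega> c = 0\<close>, put \<open>P t = \<Sum> c\<^sub>s t\<^bsup>s-1\<^esup> / (s-1)!\<close>. Expanding one factor \<open>P\<close> in powers of
  \<open>t + z\<close> shows that \<open>(t + z) (1 - t) (P t)\<^sup>2\<close> has integral \<open>0\<close>.
\<close>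

lemma Omega_mat_ker:
  fixes c :: "real^'s::{finite,linorder}"
  assumes z: "0 \<le> z" and c: "Omega_mat z *v c = 0"
  shows "c = 0"
proof -
  define v where "v = (\<chi> s. c $ s / fact (pos s - 1))"
  define P where "P t = (\<Sum>s\<in>UNIV. v $ s * t ^ (pos s - 1))" for t
  have contP: "continuous_on A P" for A unfolding P_def by (intro continuous_intros)
  have zero: "(LBINT t:{-z..1}. gfun_poly z (pos j) t * P t) = 0" for j :: 's
  proof -
    have "(LBINT t:{-z..1}. gfun_poly z (pos j) t * P t) =
        (LBINT t:{-z..1}. \<Sum>s\<in>UNIV. v $ s * (gfun_poly z (pos j) t * t ^ (pos s - 1)))"
      by (simp add: P_def sum_distrib_left mult_ac)
    also have "\<dots> = (\<Sum>s\<in>UNIV. LBINT t:{-z..1}. v $ s * (gfun_poly z (pos j) t * t ^ (pos s - 1)))"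
      by (intro LBINT_sum_continuous continuous_intros) auto
    also have "\<dots> = - (Omega_mat z *v c) $ j"
      by (simp add: Omega_mat_def matrix_vector_mult_def omega_eq_gfun_poly v_def sum_negf[symmetric] mult_ac)
    finally show ?thesis using c by simp
  qed
  define p where "p = (\<Sum>s\<in>UNIV. monom (v $ s) (pos s - 1))"
  \<comment> \<open>The expansion of \<open>P\<close> about \<open>-z\<close>, that is,
    \<open>P t = q (t + z)\<close>. The shift preserves the degree, which is below S, so the S
    powers with exponents \<open>pos s - 1\<close> suffice. Together with one factor
    \<open>t + z\<close> each becomes the power in \<open>gfun_poly z (pos s)\<close>.\<close>
  define q where "q = pcompose p [:- z, 1:]"
  have Pp: "P t = poly p t" for t by (simp add: P_def p_def poly_sum poly_monom)
  have "degree p < CARD('s)"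
    unfolding p_def
    by (rule le_less_trans[OF degree_sum_le[of _ _ "CARD('s) - 1"]])
      (auto intro!: order_trans[OF degree_monom_le] diff_le_mono pos_le)
  then have deg: "degree q < CARD('s)" by (simp add: q_def degree_pcompose)
  have "P t = poly q (t + z)" for t by (simp add: q_def poly_pcompose Pp)
  also have "poly q (t + z) = (\<Sum>k<CARD('s). coeff q k * (t + z) ^ k)" for t
    unfolding poly_altdef using deg
    by (intro sum.mono_neutral_left) (auto simp: coeff_eq_0 not_le)
  also have "(\<Sum>k<CARD('s). coeff q k * (t + z) ^ k) = (\<Sum>s\<in>(UNIV::'s set). coeff q (pos s - 1) * (t + z) ^ (pos s - 1))" for t
    by (subst sum_pos[of "\<lambda>k. coeff q (k - 1) * (t + z) ^ (k - 1)"]) simp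
  finally have Pz: "P t = (\<Sum>s\<in>(UNIV::'s set). coeff q (pos s - 1) * (t + z) ^ (pos s - 1))" for t .
  have "(LBINT t:{-z..1}. (t + z) * (1 - t) * (P t)\<^sup>2) =
      (LBINT t:{-z..1}. \<Sum>s\<in>(UNIV::'s set). - coeff q (pos s - 1) * (gfun_poly z (pos s) t * P t))"
  proof (rule arg_cong[where f = "set_lebesgue_integral lborel {-z..1}"], rule ext)
    fix t
    have "(t + z) * (1 - t) * (P t)\<^sup>2 = (t + z) * (1 - t) * P t * P t" by (simp add: power2_eq_square)
    also have "\<dots> = (\<Sum>s\<in>(UNIV::'s set). (t + z) * (1 - t) * P t * (coeff q (pos s - 1) * (t + z) ^ (pos s - 1)))"
      by (subst (2) Pz) (simp add: sum_distrib_left)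
    also have "\<dots> = (\<Sum>s\<in>(UNIV::'s set). - coeff q (pos s - 1) * (gfun_poly z (pos s) t * P t))"
    proof (rule sum.cong[OF refl])
      fix s :: 's
      have "(t + z) ^ pos s = (t + z) * (t + z) ^ (pos s - 1)"
        using pos_ge_1[of s] by (metis One_nat_def Suc_pred' less_eq_Suc_le power_Suc)
      then show "(t + z) * (1 - t) * P t * (coeff q (pos s - 1) * (t + z) ^ (pos s - 1)) =
          - coeff q (pos s - 1) * (gfun_poly z (pos s) t * P t)"
        by (simp add: gfun_poly_def algebra_simps)
    qed
    finally show "(t + z) * (1 - t) * (P t)\<^sup>2 = (\<Sum>s\<in>(UNIV::'s set). - coeff q (pos s - 1) * (gfun_poly z (pos s) t * P t))" .
  qed
  also have "\<dots> = (\<Sum>s\<in>(UNIV::'s set). LBINT t:{-z..1}. - coeff q (pos s - 1) * (gfun_poly z (pos s) t * P t))"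
    by (intro LBINT_sum_continuous continuous_intros contP) auto
  also have "\<dots> = 0" by (simp only: set_integral_mult_right zero mult_zero_right sum.neutral_const)
  finally have int0: "(LBINT t:{-z..1}. (t + z) * (1 - t) * (P t)\<^sup>2) = 0" .
  have "P t = 0" if "- z < t" "t < 1" for t
  proof -
    have "(t + z) * (1 - t) * (P t)\<^sup>2 = 0"
      by (rule LBINT_nonneg_eq_0D[OF _ _ _ int0])
        (use z that in \<open>auto intro!: continuous_intros contP mult_nonneg_nonneg\<close>)
    then show ?thesis using that by auto
  qed
  then have "v = 0"
    using z by (intro poly_pos_expansion[of "-z" 1 v 0]) (auto simp: P_def)
  then show ?thesis by (simp add: v_def vec_eq_iff)
qed

lemma invertible_Omega_mat: "0 \<le> z \<Longrightarrow> invertible (Omega_mat z)"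
  using Omega_mat_ker by (auto simp: invertible_left_inverse matrix_left_invertible_ker)

text \<open>\<open>V_mat\<close> is the Gram matrix of the kernel derivatives. Besides giving
  definiteness, this identifies the limit variance of linear combinations of the scores.\<close>

lemma V_mat_quadratic:
  "c \<bullet> (V_mat z *v c) = (LBINT t:{-z..1}. (\<Sum>j\<in>UNIV. c $ j * gder_poly z (pos j) t)\<^sup>2)"
proof -
  have "(LBINT t:{-z..1}. (\<Sum>j\<in>UNIV. c $ j * gder_poly z (pos j) t)\<^sup>2) =
      (LBINT t:{-z..1}. \<Sum>j\<in>UNIV. \<Sum>s\<in>UNIV. c $ j * c $ s * (gder_poly z (pos j) t * gder_poly z (pos s) t))"
    by (simp add: power2_eq_square sum_product mult_ac)
  also have "\<dots> = (\<Sum>j\<in>UNIV. \<Sum>s\<in>UNIV. LBINT t:{-z..1}. c $ j * c $ s * (gder_poly z (pos j) t * gder_poly z (pos s) t))"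
    by (subst LBINT_sum_continuous; (intro sum.cong refl LBINT_sum_continuous continuous_intros)?) auto
  also have "\<dots> = c \<bullet> (V_mat z *v c)"
    by (simp add: inner_vec_def matrix_vector_mult_def V_mat_eq_gder_poly sum_distrib_left mult_ac)
  finally show ?thesis by simp
qed

lemma transpose_V_mat: "transpose (V_mat z) = V_mat z"
  by (simp add: vec_eq_iff transpose_def V_mat_eq_gder_poly mult.commute)

text \<open>If the form vanishes, the combination \<open>Q\<close> of kernels has derivative 0 on
  the window. It is then constant, and 0 because every kernel vanishes at \<open>-z\<close>.
  Dividing by \<open>(t + z) * (t - 1)\<close> leaves a vanishing combination of powers of
  \<open>t + z\<close>.\<close>

lemma V_mat_posdef:
  fixes c :: "real^'s::{finite,linorder}"
  assumes z: "0 \<le> z" and c: "c \<noteq> 0"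
  shows "0 < c \<bullet> (V_mat z *v c)"
proof -
  define Q' where "Q' t = (\<Sum>j\<in>UNIV. c $ j * gder_poly z (pos j) t)" for t
  define Q where "Q t = (\<Sum>j\<in>UNIV. c $ j * gfun_poly z (pos j) t)" for t
  have contQ': "continuous_on A Q'" for A unfolding Q'_def by (intro continuous_intros)
  have "c \<bullet> (V_mat z *v c) \<noteq> 0"
  proof
    assume "c \<bullet> (V_mat z *v c) = 0"
    then have int0: "(LBINT t:{-z..1}. (Q' t)\<^sup>2) = 0" by (simp add: V_mat_quadratic Q'_def)
    have Q'0: "Q' t = 0" if "- z \<le> t" "t \<le> 1" for t
    proof -
      have "(Q' t)\<^sup>2 = 0"
        by (rule LBINT_nonneg_eq_0D[OF _ _ _ int0]) (use z that in \<open>auto intro!: continuous_intros contQ'\<close>)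
      then show ?thesis by simp
    qed
    have der: "(Q has_real_derivative Q' t) (at t within A)" for t A
      unfolding Q_def Q'_def by (intro DERIV_sum DERIV_cmult has_real_derivative_gfun_poly)
    have "Q t = 0" if "- z \<le> t" "t \<le> 1" for t
    proof -
      have "(Q has_real_derivative 0) (at y within {-z..1})" if "y \<in> {-z..1}" for y
        using der[of y "{-z..1}"] Q'0[of y] that by simp
      then obtain C where "\<And>y. y \<in> {-z..1} \<Longrightarrow> Q y = C"
        using has_field_derivative_zero_constant[of "{-z..1}" Q] convex_real_interval by blast
      then have "Q t = Q (- z)" using that by simp
      also have "Q (- z) = 0"
        unfolding Q_def by (intro sum.neutral ballI) (simp add: gfun_poly_def)
      finally show ?thesis .
    qed
    have "c = 0"
    proof (rule poly_pos_expansion[of "- z" 1 c z])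
      show "- z < 1" using z by simp
      fix t assume t: "- z < t" "t < 1"
      have "Q t = (\<Sum>s\<in>UNIV. c $ s * (t + z) ^ (pos s - 1)) * ((t + z) * (t - 1))"
      proof -
        have "gfun_poly z (pos s) t = (t + z) ^ (pos s - 1) * ((t + z) * (t - 1))" for s :: 's
        proof -
          have "(t + z) ^ pos s = (t + z) * (t + z) ^ (pos s - 1)"
            using pos_ge_1[of s] by (metis One_nat_def Suc_pred' less_eq_Suc_le power_Suc)
          then show ?thesis by (simp add: gfun_poly_def)
        qed
        then show ?thesis by (simp add: Q_def sum_distrib_left mult_ac)
      qed
      with \<open>\<And>t. - z \<le> t \<Longrightarrow> t \<le> 1 \<Longrightarrow> Q t = 0\<close>[of t] t
      show "(\<Sum>s\<in>UNIV. c $ s * (t + z) ^ (pos s - 1)) = 0" by simp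
    qed
    with c show False by simp
  qed
  moreover have "0 \<le> c \<bullet> (V_mat z *v c)"
    unfolding V_mat_quadratic set_lebesgue_integral_def by (intro Bochner_Integration.integral_nonneg) simp
  ultimately show ?thesis by simp
qed

lemma LBINT_uniform_tendsto:
  fixes F :: "nat \<Rightarrow> real \<Rightarrow> real"
  assumes "a \<le> b" and u: "uniform_limit {a..b} F G sequentially"
    and F: "\<forall>\<^sub>F n in sequentially. continuous_on {a..b} (F n)" and G: "continuous_on {a..b} G"
  shows "(\<lambda>n. LBINT t:{a..b}. F n t) \<longlonglongrightarrow> (LBINT t:{a..b}. G t)"
proof (rule tendstoI)
  fix e :: real assume e: "0 < e"
  define d where "d = e / 2 / (b - a + 1)"
  have d: "0 < d" using e assms(1) by (simp add: d_def)
  have dab: "d * (b - a) < e"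
  proof -
    have "d * (b - a) \<le> d * (b - a + 1)" using d by (intro mult_left_mono) auto
    also have "0 < b - a + 1" using assms(1) by simp
    then have "d * (b - a + 1) = e / 2" by (metis d_def less_irrefl nonzero_eq_divide_eq)
    finally show ?thesis using e by simp
  qed
  show "\<forall>\<^sub>F n in sequentially. dist (LBINT t:{a..b}. F n t) (LBINT t:{a..b}. G t) < e"
    using uniform_limitD[OF u d] F
  proof eventually_elim
    case (elim n)
    note iF = borel_integrable_atLeastAtMost'[OF elim(2)] and iG = borel_integrable_atLeastAtMost'[OF G]
    have "\<bar>(LBINT t:{a..b}. F n t) - (LBINT t:{a..b}. G t)\<bar> = \<bar>LBINT t:{a..b}. F n t - G t\<bar>"
      using set_integral_diff(2)[OF iF iG] by simp
    also have "\<dots> \<le> (LBINT t:{a..b}. \<bar>F n t - G t\<bar>)"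
      using set_integral_norm_bound[OF set_integral_diff(1)[OF iF iG]] by simp
    also have "\<dots> \<le> (LBINT t:{a..b}. d)"
      using elim(1) set_integrable_abs[OF set_integral_diff(1)[OF iF iG]]
      by (intro set_integral_mono borel_integrable_atLeastAtMost' continuous_intros)
        (use elim(2) G in \<open>auto simp: dist_real_def intro: less_imp_le\<close>)
    also have "\<dots> = d * (b - a)"
      using assms(1) by (simp add: set_lebesgue_integral_def)
    finally show ?case using dab by (simp add: dist_real_def)
  qed
qed

lemma matrix_inv_unique:
  fixes A B :: "real^'n^'n"
  assumes "A ** B = mat 1"
  shows "matrix_inv A = B"
proof -
  have "B ** A = mat 1" using assms matrix_left_right_inverse1 by blast
  then have "invertible A" using assms unfolding invertible_def by blast
  from matrix_inv_mult[OF this] assms show ?thesis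
    by (metis matrix_mul_assoc matrix_mul_lid matrix_mul_rid)
qed

lemma matrix_mult_scaleR:
  fixes A :: "real^'n^'m" and B :: "real^'k^'n"
  shows "(c *\<^sub>R A) ** B = c *\<^sub>R (A ** B)" "A ** (c *\<^sub>R B) = c *\<^sub>R (A ** B)"
  by (simp_all add: matrix_matrix_mult_def vec_eq_iff sum_distrib_left mult_ac)

lemma matrix_inv_scaleR:
  fixes A :: "real^'n^'n"
  assumes "invertible A" "c \<noteq> 0"
  shows "matrix_inv (c *\<^sub>R A) = (1 / c) *\<^sub>R matrix_inv A"
  using assms matrix_inv_mult[OF assms(1)]
  by (intro matrix_inv_unique) (simp add: matrix_mult_scaleR)

lemma invertible_scaleR:
  fixes A :: "real^'n^'n"
  assumes "invertible A" "c \<noteq> 0"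
  shows "invertible (c *\<^sub>R A)"
proof -
  have "((1 / c) *\<^sub>R matrix_inv A) ** (c *\<^sub>R A) = mat 1"
    using assms matrix_inv_mult[OF assms(1)] by (simp add: matrix_mult_scaleR)
  then show ?thesis by (auto simp: invertible_left_inverse)
qed

lemma Lambda_mat_mult: "Lambda_mat h *v c = (\<chi> j. h ^ (pos j - 1) * c $ j)"
  by (simp add: vec_eq_iff matrix_vector_mult_def Lambda_mat_def if_distrib[of "\<lambda>a. a * _"] sum.delta cong: if_cong)

lemma gfun_outside: "\<not> (- z \<le> t \<and> t \<le> 1) \<Longrightarrow> gfun z j t = 0"
  unfolding gfun_def by (simp only: if_False)

lemma gder_outside: "\<not> (- z < t \<and> t < 1) \<Longrightarrow> gder z j t = 0"
  by (auto simp: gder_def)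

lemma gfun_measurable [measurable]: "gfun z j \<in> borel_measurable borel"
  unfolding gfun_def by measurable

lemma gder_measurable [measurable]: "gder z j \<in> borel_measurable borel"
proof -
  have "gder z j = (\<lambda>t. if - z < t \<and> t < 1 then gder_poly z j t else 0)"
    by (auto simp: gder_eq_gder_poly gder_outside)
  moreover have "(\<lambda>t. if - z < t \<and> t < 1 then gder_poly z j t else 0) \<in> borel_measurable borel"
    unfolding gder_poly_def by measurable
  ultimately show ?thesis by simp
qed

text \<open>The powers of \<open>obs i - x\<close> are rewritten as powers of the scaled
  observation; the factors of \<open>h\<close> so released form exactly \<open>Lambda_mat h\<close>.
  In the unknown \<open>Lambda_mat h *v c\<close> the matrix has a nondegenerate limit.\<close>

lemma solves_system_iff:
  fixes c :: "real^'s::{finite,linorder}"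
  assumes h: "0 < h"
  shows "solves_system z n h x obs c \<longleftrightarrow>
    ((\<chi> j s. - (1 / (real n * h)) * (\<Sum>i<n. gfun z (pos j) ((obs i - x) / h) *
        ((obs i - x) / h) ^ (pos s - 1) / fact (pos s - 1))) :: ((real, 's) vec, 's) vec) *v (Lambda_mat h *v c) =
    (\<chi> j. 1 / (real n * h\<^sup>2) * (\<Sum>i<n. gder z (pos j) ((obs i - x) / h)))"
    (is "_ \<longleftrightarrow> ?B *v _ = ?a")
proof -
  have eq: "(?B *v (Lambda_mat h *v c)) $ j = - (\<Sum>s\<in>UNIV. c $ s * (1 / (real n * h) *
      (\<Sum>i<n. gfun z (pos j) ((obs i - x) / h) * ((obs i - x) ^ (pos s - 1) / fact (pos s - 1)))))" for j
  proof -
    let ?T = "\<lambda>s. \<Sum>i<n. gfun z (pos j) ((obs i - x) / h) * ((obs i - x) / h) ^ (pos s - 1) / fact (pos s - 1)"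
    have *: "(\<Sum>i<n. gfun z (pos j) ((obs i - x) / h) * ((obs i - x) ^ (pos s - 1) / fact (pos s - 1))) =
        h ^ (pos s - 1) * ?T s" for s :: 's
      using h by (simp add: sum_distrib_left power_divide)
    have "(?B *v (Lambda_mat h *v c)) $ j = (\<Sum>s\<in>UNIV. - (1 / (real n * h)) * ?T s * (h ^ (pos s - 1) * c $ s))"
      unfolding Lambda_mat_mult by (simp only: matrix_vector_mult_def vec_lambda_beta)
    also have "\<dots> = - (\<Sum>s\<in>UNIV. c $ s * (1 / (real n * h) * (h ^ (pos s - 1) * ?T s)))"
      unfolding sum_negf[symmetric] by (intro sum.cong refl) (simp only: mult_minus_left mult_ac)
    finally show ?thesis unfolding * .
  qed
  show ?thesis
    unfolding solves_system_def vec_eq_iff eq vec_lambda_beta by (rule iff_allI, rule eq_commute)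
qed

lemma (in prob_space) integral_uniform_measure:
  fixes F :: "'a \<Rightarrow> real"
  assumes [measurable]: "W \<in> sets M" "F \<in> borel_measurable M" and W: "0 < prob W"
  shows "(LINT \<omega>|uniform_measure M W. F \<omega>) = expectation (\<lambda>\<omega>. indicator W \<omega> * F \<omega>) / prob W"
proof -
  have "uniform_measure M W = density M (\<lambda>\<omega>. ennreal (indicator W \<omega> / prob W))"
    unfolding uniform_measure_def using W
    by (intro density_cong) (auto simp: emeasure_eq_measure divide_ennreal indicator_def simp flip: ennreal_1)
  then show ?thesis
    by (simp add: integral_density)
qed

section \<open>Transfer of limits in law and in probability through linear systems\<close>

lemma norm_iexp_diff: "cmod (iexp s - iexp t) \<le> \<bar>s - t\<bar>"
proof -
  have "iexp s - iexp t = iexp t * (iexp (s - t) - 1)"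
    by (simp add: exp_diff algebra_simps)
  then have "cmod (iexp s - iexp t) = cmod (iexp (s - t) - 1)"
    by (simp add: norm_mult)
  also have "\<dots> \<le> \<bar>s - t\<bar>"
    using iexp_approx1[of "s - t" 0] by simp
  finally show ?thesis .
qed

text \<open>The characteristic function of \<open>Z n\<close> at \<open>a\<close> is compared with
  that of \<open>W n\<close> at \<open>transpose C *v a\<close>: Lipschitz continuity of the
  exponential where \<open>Z n\<close> is close to \<open>C *v W n\<close>, and the trivial bound 2
  elsewhere. Tightness passes from \<open>W n\<close> to \<open>Z n\<close> by the same
  closeness.\<close>

lemma (in prob_space) slutsky_levy:
  fixes W Z :: "nat \<Rightarrow> 'a \<Rightarrow> real^'n" and C :: "real^'n^'n"
  assumes W[measurable]: "\<And>n. W n \<in> borel_measurable M" and Z[measurable]: "\<And>n. Z n \<in> borel_measurable M"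
    and cf: "\<And>a. (\<lambda>n. CLINT \<omega>|M. iexp (a \<bullet> W n \<omega>)) \<longlonglongrightarrow> \<psi> a"
    and tight: "\<And>e. 0 < e \<Longrightarrow> \<exists>R. \<forall>\<^sub>F n in sequentially. prob {\<omega>\<in>space M. R < norm (W n \<omega>)} < e"
    and close: "\<And>e. 0 < e \<Longrightarrow> (\<lambda>n. prob {\<omega>\<in>space M. e < norm (Z n \<omega> - C *v W n \<omega>)}) \<longlonglongrightarrow> 0"
    and \<mu>: "prob_space \<mu>" "sets \<mu> = sets borel" "\<And>a. (CLINT y|\<mu>. iexp (a \<bullet> y)) = \<psi> (transpose C *v a)"
  shows "conv_in_distribution M Z \<mu>"
proof (rule levy_continuity_cart[OF prob_space_axioms \<mu>(1,2) Z])
  note [measurable] = measurable_compose[OF W matrix_vector_mult_measurable]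
  fix a :: "real^'n"
  let ?b = "transpose C *v a"
  let ?Bad = "\<lambda>e n. {\<omega>\<in>space M. e < norm (Z n \<omega> - C *v W n \<omega>)}"
  have bound: "cmod ((CLINT \<omega>|M. iexp (a \<bullet> Z n \<omega>)) - (CLINT \<omega>|M. iexp (?b \<bullet> W n \<omega>)))
      \<le> norm a * e + 2 * prob (?Bad e n)" if e: "0 < e" for e n
  proof -
    have i: "integrable M (\<lambda>\<omega>. iexp (a \<bullet> Z n \<omega>))" "integrable M (\<lambda>\<omega>. iexp (?b \<bullet> W n \<omega>))"
      by (intro integrable_iexp; simp)+
    have [measurable]: "?Bad e n \<in> sets M" by measurable
    have "cmod ((CLINT \<omega>|M. iexp (a \<bullet> Z n \<omega>)) - (CLINT \<omega>|M. iexp (?b \<bullet> W n \<omega>)))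
        = cmod (CLINT \<omega>|M. iexp (a \<bullet> Z n \<omega>) - iexp (?b \<bullet> W n \<omega>))"
      using i by simp
    also have "\<dots> \<le> (LINT \<omega>|M. cmod (iexp (a \<bullet> Z n \<omega>) - iexp (?b \<bullet> W n \<omega>)))"
      by (rule integral_norm_bound)
    also have "\<dots> \<le> (LINT \<omega>|M. norm a * e + 2 * indicator (?Bad e n) \<omega>)"
    proof (rule integral_mono)
      show "integrable M (\<lambda>\<omega>. cmod (iexp (a \<bullet> Z n \<omega>) - iexp (?b \<bullet> W n \<omega>)))"
        using i by (intro integrable_norm Bochner_Integration.integrable_diff)
      show "integrable M (\<lambda>\<omega>. norm a * e + 2 * indicator (?Bad e n) \<omega>)"
        by (intro Bochner_Integration.integrable_add integrable_mult_right integrable_real_indicator)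
          (auto simp: emeasure_eq_measure)
      fix \<omega> assume \<omega>: "\<omega> \<in> space M"
      show "cmod (iexp (a \<bullet> Z n \<omega>) - iexp (?b \<bullet> W n \<omega>)) \<le> norm a * e + 2 * indicator (?Bad e n) \<omega>"
      proof (cases "\<omega> \<in> ?Bad e n")
        case True
        have "cmod (iexp (a \<bullet> Z n \<omega>) - iexp (?b \<bullet> W n \<omega>)) \<le> 2"
          using norm_triangle_ineq4[of "iexp (a \<bullet> Z n \<omega>)" "iexp (?b \<bullet> W n \<omega>)"] by simp
        moreover have "0 \<le> norm a * e" using e by simp
        ultimately show ?thesis using True by simp
      next
        case False
        have "a \<bullet> Z n \<omega> - ?b \<bullet> W n \<omega> = a \<bullet> (Z n \<omega> - C *v W n \<omega>)"
          by (simp add: inner_diff_right dot_lmul_matrix)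
        then have "cmod (iexp (a \<bullet> Z n \<omega>) - iexp (?b \<bullet> W n \<omega>)) \<le> \<bar>a \<bullet> (Z n \<omega> - C *v W n \<omega>)\<bar>"
          using norm_iexp_diff[of "a \<bullet> Z n \<omega>" "?b \<bullet> W n \<omega>"] by simp
        also have "\<dots> \<le> norm a * norm (Z n \<omega> - C *v W n \<omega>)" by (rule Cauchy_Schwarz_ineq2)
        also have "\<dots> \<le> norm a * e" using False \<omega> by (intro mult_left_mono) auto
        finally show ?thesis using False by simp
      qed
    qed
    also have "\<dots> = norm a * e + 2 * prob (?Bad e n)"
      by (subst Bochner_Integration.integral_add)
        (auto simp: prob_space emeasure_eq_measure intro!: integrable_mult_right integrable_real_indicator)
    finally show ?thesis .
  qed
  have "(\<lambda>n. (CLINT \<omega>|M. iexp (a \<bullet> Z n \<omega>)) - (CLINT \<omega>|M. iexp (?b \<bullet> W n \<omega>))) \<longlonglongrightarrow> 0"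
  proof (rule tendstoI)
    fix r :: real assume r: "0 < r"
    define e where "e = r / 2 / (norm a + 1)"
    have na: "0 < norm a + 1" using norm_ge_zero[of a] by linarith
    have e: "0 < e" using r na by (simp add: e_def)
    have "norm a * e \<le> (norm a + 1) * e" using e by (intro mult_right_mono) auto
    also have "\<dots> = r / 2"
      using na by (metis e_def less_irrefl mult.commute nonzero_eq_divide_eq)
    finally have ae: "norm a * e \<le> r / 2" .
    have "\<forall>\<^sub>F n in sequentially. prob (?Bad e n) < r / 4"
      using order_tendstoD(2)[OF close[OF e], of "r / 4"] r by simp
    then show "\<forall>\<^sub>F n in sequentially. dist ((CLINT \<omega>|M. iexp (a \<bullet> Z n \<omega>)) - (CLINT \<omega>|M. iexp (?b \<bullet> W n \<omega>))) 0 < r"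
    proof eventually_elim
      case (elim n)
      with bound[OF e, of n] ae show ?case by (simp add: dist_norm)
    qed
  qed
  from tendsto_add[OF this cf[of ?b]]
  show "(\<lambda>n. CLINT \<omega>|M. iexp (a \<bullet> Z n \<omega>)) \<longlonglongrightarrow> (CLINT y|\<mu>. iexp (a \<bullet> y))"
    by (simp add: \<mu>(3))
next
  note [measurable] = measurable_compose[OF W matrix_vector_mult_measurable]
  fix e :: real assume e: "0 < e"
  then obtain R where R: "\<forall>\<^sub>F n in sequentially. prob {\<omega>\<in>space M. R < norm (W n \<omega>)} < e / 2"
    using tight[of "e / 2"] by auto
  have "\<forall>\<^sub>F n in sequentially. prob {\<omega>\<in>space M. 1 < norm (Z n \<omega> - C *v W n \<omega>)} < e / 2"
    using order_tendstoD(2)[OF close[of 1], of "e / 2"] e by simp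
  with R have "\<forall>\<^sub>F n in sequentially. prob {\<omega>\<in>space M. norm C * \<bar>R\<bar> + 1 < norm (Z n \<omega>)} < e"
  proof eventually_elim
    case (elim n)
    have "{\<omega>\<in>space M. norm C * \<bar>R\<bar> + 1 < norm (Z n \<omega>)} \<subseteq>
        {\<omega>\<in>space M. R < norm (W n \<omega>)} \<union> {\<omega>\<in>space M. 1 < norm (Z n \<omega> - C *v W n \<omega>)}"
    proof (rule subsetI, rule ccontr)
      fix \<omega> assume \<omega>: "\<omega> \<in> {\<omega>\<in>space M. norm C * \<bar>R\<bar> + 1 < norm (Z n \<omega>)}"
        and "\<omega> \<notin> {\<omega>\<in>space M. R < norm (W n \<omega>)} \<union> {\<omega>\<in>space M. 1 < norm (Z n \<omega> - C *v W n \<omega>)}"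
      then have le: "norm (W n \<omega>) \<le> \<bar>R\<bar>" "norm (Z n \<omega> - C *v W n \<omega>) \<le> 1" by auto
      have "norm (Z n \<omega>) \<le> norm (C *v W n \<omega>) + norm (Z n \<omega> - C *v W n \<omega>)"
        by (rule norm_triangle_sub)
      also have "\<dots> \<le> norm C * norm (W n \<omega>) + 1"
        using le(2) by (intro add_mono norm_matrix_vector_mult_le)
      also have "\<dots> \<le> norm C * \<bar>R\<bar> + 1" using le(1) by (intro add_right_mono mult_left_mono) auto
      finally show False using \<omega> by simp
    qed
    then have "prob {\<omega>\<in>space M. norm C * \<bar>R\<bar> + 1 < norm (Z n \<omega>)} \<le>
        prob ({\<omega>\<in>space M. R < norm (W n \<omega>)} \<union> {\<omega>\<in>space M. 1 < norm (Z n \<omega> - C *v W n \<omega>)})"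
      by (rule finite_measure_mono) measurable
    also have "\<dots> \<le> prob {\<omega>\<in>space M. R < norm (W n \<omega>)} + prob {\<omega>\<in>space M. 1 < norm (Z n \<omega> - C *v W n \<omega>)}"
      by (rule measure_Un_le) measurable
    finally show ?case using elim by linarith
  qed
  then show "\<exists>R. \<forall>\<^sub>F n in sequentially. prob {\<omega>\<in>space M. R < norm (Z n \<omega>)} < e" by blast
qed

text \<open>The equation for \<open>Z n\<close> is assumed only where \<open>Bn n\<close> is
  invertible, which is all that the definition of the estimator provides. Near \<open>B\<close>
  invertibility is automatic, and there \<open>matrix_perturbation\<close> bounds the error by the
  matrix deviation times the tight right-hand side.\<close>

lemma (in prob_space) solve_close_in_probability:
  fixes W Z :: "nat \<Rightarrow> 'a \<Rightarrow> real^'n" and Bn :: "nat \<Rightarrow> 'a \<Rightarrow> real^'n^'n"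
  assumes W[measurable]: "\<And>n. W n \<in> borel_measurable M"
    and Bn[measurable]: "\<And>n. Bn n \<in> borel_measurable M"
    and B: "invertible B"
    and conv: "\<And>e. 0 < e \<Longrightarrow> (\<lambda>n. prob {\<omega>\<in>space M. e \<le> norm (Bn n \<omega> - B)}) \<longlonglongrightarrow> 0"
    and tight: "\<And>e. 0 < e \<Longrightarrow> \<exists>R. \<forall>\<^sub>F n in sequentially. prob {\<omega>\<in>space M. R < norm (W n \<omega>)} < e"
    and sol: "\<forall>\<^sub>F n in sequentially. \<forall>\<omega>\<in>space M. invertible (Bn n \<omega>) \<longrightarrow> Bn n \<omega> *v Z n \<omega> = W n \<omega>"
    and e: "0 < e"
  shows "(\<lambda>n. prob {\<omega>\<in>space M. e < norm (Z n \<omega> - matrix_inv B *v W n \<omega>)}) \<longlonglongrightarrow> 0"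
proof -
  obtain K \<delta> where K: "0 < K" "0 < \<delta>"
    "\<And>B'. norm (B' - B) < \<delta> \<Longrightarrow> invertible B'"
    "\<And>B' u. norm (B' - B) < \<delta> \<Longrightarrow> norm (u - matrix_inv B *v (B' *v u)) \<le> K * norm (B' - B) * norm (B' *v u)"
    by (rule matrix_perturbation[OF B]) blast
  show ?thesis
  proof (rule tendstoI)
    fix r :: real assume r: "0 < r"
    then obtain R0 where R0: "\<forall>\<^sub>F n in sequentially. prob {\<omega>\<in>space M. R0 < norm (W n \<omega>)} < r / 2"
      using tight[of "r / 2"] by auto
    define R where "R = \<bar>R0\<bar> + 1"
    \<comment> \<open>Chosen so that \<open>K * d * R \<le> e\<close>: matrix deviation below
      \<open>d\<close> and right-hand side at most \<open>R\<close> force an error of at most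
      \<open>e\<close>.\<close>
    define d where "d = min \<delta> (e / (K * R))"
    have R: "0 < R" "R0 \<le> R" by (auto simp: R_def)
    have d: "0 < d" "d \<le> \<delta>" "d \<le> e / (K * R)" using K e R by (auto simp: d_def)
    have "K * d * R \<le> e"
      using d(3) K(1) R(1) by (simp add: pos_le_divide_eq mult_ac)
    have "\<forall>\<^sub>F n in sequentially. prob {\<omega>\<in>space M. d \<le> norm (Bn n \<omega> - B)} < r / 2"
      using order_tendstoD(2)[OF conv[OF d(1)], of "r / 2"] r by simp
    with R0 sol show "\<forall>\<^sub>F n in sequentially. dist (prob {\<omega>\<in>space M. e < norm (Z n \<omega> - matrix_inv B *v W n \<omega>)}) 0 < r"
    proof eventually_elim
      case (elim n)
      have "{\<omega>\<in>space M. e < norm (Z n \<omega> - matrix_inv B *v W n \<omega>)} \<subseteq>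
          {\<omega>\<in>space M. R0 < norm (W n \<omega>)} \<union> {\<omega>\<in>space M. d \<le> norm (Bn n \<omega> - B)}"
      proof (rule subsetI, rule ccontr)
        fix \<omega> assume \<omega>: "\<omega> \<in> {\<omega>\<in>space M. e < norm (Z n \<omega> - matrix_inv B *v W n \<omega>)}"
          and "\<omega> \<notin> {\<omega>\<in>space M. R0 < norm (W n \<omega>)} \<union> {\<omega>\<in>space M. d \<le> norm (Bn n \<omega> - B)}"
        then have le: "norm (W n \<omega>) \<le> R" "norm (Bn n \<omega> - B) < d" "\<omega> \<in> space M" using R by auto
        have lt: "norm (Bn n \<omega> - B) < \<delta>" using le d by linarith
        have s: "Bn n \<omega> *v Z n \<omega> = W n \<omega>" using elim(2) le(3) K(3)[OF lt] by blast
        have "norm (Z n \<omega> - matrix_inv B *v W n \<omega>) \<le> K * norm (Bn n \<omega> - B) * norm (W n \<omega>)"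
          using K(4)[OF lt, of "Z n \<omega>"] by (simp add: s)
        also have "\<dots> \<le> K * d * R"
          using le K d by (intro mult_mono mult_left_mono) auto
        also have "\<dots> \<le> e" by fact
        finally show False using \<omega> by simp
      qed
      then have "prob {\<omega>\<in>space M. e < norm (Z n \<omega> - matrix_inv B *v W n \<omega>)} \<le>
          prob ({\<omega>\<in>space M. R0 < norm (W n \<omega>)} \<union> {\<omega>\<in>space M. d \<le> norm (Bn n \<omega> - B)})"
        by (rule finite_measure_mono) measurable
      also have "\<dots> \<le> prob {\<omega>\<in>space M. R0 < norm (W n \<omega>)} + prob {\<omega>\<in>space M. d \<le> norm (Bn n \<omega> - B)}"
        by (rule measure_Un_le) measurable
      finally show ?case using elim by (simp add: dist_real_def)
    qed
  qed
qed

lemma (in prob_space) tight_cart: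
  fixes W :: "nat \<Rightarrow> 'a \<Rightarrow> real^'n"
  assumes W[measurable]: "\<And>n. W n \<in> borel_measurable M"
    and "\<And>j e. 0 < e \<Longrightarrow> \<exists>R. \<forall>\<^sub>F n in sequentially. prob {\<omega>\<in>space M. R < \<bar>W n \<omega> $ j\<bar>} < e"
    and e: "0 < e"
  shows "\<exists>R. \<forall>\<^sub>F n in sequentially. prob {\<omega>\<in>space M. R < norm (W n \<omega>)} < e"
proof -
  have "\<exists>R. \<forall>j. \<forall>\<^sub>F n in sequentially. prob {\<omega>\<in>space M. R j < \<bar>W n \<omega> $ j\<bar>} < e / CARD('n)"
    using assms(2)[of "e / CARD('n)"] e by (intro choice) simp
  then obtain R where R: "\<And>j. \<forall>\<^sub>F n in sequentially. prob {\<omega>\<in>space M. R j < \<bar>W n \<omega> $ j\<bar>} < e / CARD('n)"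
    by blast
  have "\<forall>\<^sub>F n in sequentially. \<forall>j\<in>UNIV. prob {\<omega>\<in>space M. R j < \<bar>W n \<omega> $ j\<bar>} < e / CARD('n)"
    using R by (intro eventually_ball_finite) auto
  then have "\<forall>\<^sub>F n in sequentially. prob {\<omega>\<in>space M. (\<Sum>j\<in>UNIV. R j) < norm (W n \<omega>)} < e"
  proof eventually_elim
    case (elim n)
    have "{\<omega>\<in>space M. (\<Sum>j\<in>UNIV. R j) < norm (W n \<omega>)} \<subseteq> (\<Union>j\<in>UNIV. {\<omega>\<in>space M. R j < \<bar>W n \<omega> $ j\<bar>})"
    proof (rule subsetI, rule ccontr)
      fix \<omega> assume \<omega>: "\<omega> \<in> {\<omega>\<in>space M. (\<Sum>j\<in>UNIV. R j) < norm (W n \<omega>)}"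
        and "\<omega> \<notin> (\<Union>j\<in>UNIV. {\<omega>\<in>space M. R j < \<bar>W n \<omega> $ j\<bar>})"
      then have "\<bar>W n \<omega> $ j\<bar> \<le> R j" for j by (auto simp: not_less)
      then have "(\<Sum>j\<in>UNIV. \<bar>W n \<omega> $ j\<bar>) \<le> (\<Sum>j\<in>UNIV. R j)" by (intro sum_mono)
      with norm_le_l1_cart[of "W n \<omega>"] \<omega> show False by simp
    qed
    then have "prob {\<omega>\<in>space M. (\<Sum>j\<in>UNIV. R j) < norm (W n \<omega>)} \<le> prob (\<Union>j\<in>UNIV. {\<omega>\<in>space M. R j < \<bar>W n \<omega> $ j\<bar>})"
      by (rule finite_measure_mono) measurable
    also have "\<dots> \<le> (\<Sum>j\<in>UNIV. prob {\<omega>\<in>space M. R j < \<bar>W n \<omega> $ j\<bar>})"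
      by (rule finite_measure_subadditive_finite) auto
    also have "\<dots> < (\<Sum>j\<in>(UNIV::'n set). e / CARD('n))"
      using elim by (intro sum_strict_mono) auto
    finally show ?case by simp
  qed
  then show ?thesis by blast
qed

lemma (in prob_space) matrix_conv_in_probability:
  fixes Bn :: "nat \<Rightarrow> 'a \<Rightarrow> real^'n^'m"
  assumes Bn[measurable]: "\<And>n. Bn n \<in> borel_measurable M"
    and conv: "\<And>j s e. 0 < e \<Longrightarrow> (\<lambda>n. prob {\<omega>\<in>space M. e < \<bar>Bn n \<omega> $ j $ s - B $ j $ s\<bar>}) \<longlonglongrightarrow> 0"
    and e: "0 < e"
  shows "(\<lambda>n. prob {\<omega>\<in>space M. e \<le> norm (Bn n \<omega> - B)}) \<longlonglongrightarrow> 0"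
proof -
  \<comment> \<open>If every entry deviates by at most \<open>d\<close>, the entries sum to at most
    \<open>e / 2\<close>; the factor 2 makes this strictly smaller than \<open>e\<close>.\<close>
  define d where "d = e / (2 * (real CARD('m) * real CARD('n)))"
  have d: "0 < d" using e by (simp add: d_def)
  have norm_le: "norm A \<le> (\<Sum>j\<in>UNIV. \<Sum>s\<in>UNIV. \<bar>A $ j $ s\<bar>)" for A :: "real^'n^'m"
  proof -
    have "norm A \<le> (\<Sum>j\<in>UNIV. norm (A $ j))" by (simp add: norm_vec_def L2_set_le_sum)
    also have "\<dots> \<le> (\<Sum>j\<in>UNIV. \<Sum>s\<in>UNIV. \<bar>A $ j $ s\<bar>)" by (intro sum_mono norm_le_l1_cart)
    finally show ?thesis .
  qed
  have [measurable]: "{\<omega>\<in>space M. d < \<bar>Bn n \<omega> $ j $ s - B $ j $ s\<bar>} \<in> sets M" for n j s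
  proof -
    have "(\<lambda>\<omega>. Bn n \<omega> $ j $ s) \<in> borel_measurable M"
      by (rule measurable_compose[OF Bn]) (intro borel_measurable_continuous_onI continuous_intros)
    then show ?thesis by measurable
  qed
  have "(\<lambda>n. \<Sum>j\<in>UNIV. \<Sum>s\<in>UNIV. prob {\<omega>\<in>space M. d < \<bar>Bn n \<omega> $ j $ s - B $ j $ s\<bar>}) \<longlonglongrightarrow> (\<Sum>j\<in>(UNIV::'m set). \<Sum>s\<in>(UNIV::'n set). 0)"
    by (intro tendsto_sum conv d)
  then have lim: "(\<lambda>n. \<Sum>j\<in>UNIV. \<Sum>s\<in>UNIV. prob {\<omega>\<in>space M. d < \<bar>Bn n \<omega> $ j $ s - B $ j $ s\<bar>}) \<longlonglongrightarrow> 0"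
    by simp
  have "prob {\<omega>\<in>space M. e \<le> norm (Bn n \<omega> - B)} \<le> (\<Sum>j\<in>UNIV. \<Sum>s\<in>UNIV. prob {\<omega>\<in>space M. d < \<bar>Bn n \<omega> $ j $ s - B $ j $ s\<bar>})" for n
  proof -
    have "{\<omega>\<in>space M. e \<le> norm (Bn n \<omega> - B)} \<subseteq> (\<Union>j\<in>UNIV. \<Union>s\<in>UNIV. {\<omega>\<in>space M. d < \<bar>Bn n \<omega> $ j $ s - B $ j $ s\<bar>})"
    proof (rule subsetI, rule ccontr)
      fix \<omega> assume \<omega>: "\<omega> \<in> {\<omega>\<in>space M. e \<le> norm (Bn n \<omega> - B)}"
        and "\<omega> \<notin> (\<Union>j\<in>UNIV. \<Union>s\<in>UNIV. {\<omega>\<in>space M. d < \<bar>Bn n \<omega> $ j $ s - B $ j $ s\<bar>})"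
      then have "\<bar>(Bn n \<omega> - B) $ j $ s\<bar> \<le> d" for j s by (auto simp: not_less)
      then have "(\<Sum>j\<in>UNIV. \<Sum>s\<in>UNIV. \<bar>(Bn n \<omega> - B) $ j $ s\<bar>) \<le> (\<Sum>j\<in>(UNIV::'m set). \<Sum>s\<in>(UNIV::'n set). d)"
        by (intro sum_mono)
      also have "\<dots> = e / 2" by (simp add: d_def)
      finally show False using norm_le[of "Bn n \<omega> - B"] \<omega> e by simp
    qed
    then have "prob {\<omega>\<in>space M. e \<le> norm (Bn n \<omega> - B)} \<le> prob (\<Union>j\<in>UNIV. \<Union>s\<in>UNIV. {\<omega>\<in>space M. d < \<bar>Bn n \<omega> $ j $ s - B $ j $ s\<bar>})"
      by (rule finite_measure_mono) measurable
    also have "\<dots> \<le> (\<Sum>j\<in>UNIV. prob (\<Union>s\<in>UNIV. {\<omega>\<in>space M. d < \<bar>Bn n \<omega> $ j $ s - B $ j $ s\<bar>}))"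
      by (rule finite_measure_subadditive_finite) auto
    also have "\<dots> \<le> (\<Sum>j\<in>UNIV. \<Sum>s\<in>UNIV. prob {\<omega>\<in>space M. d < \<bar>Bn n \<omega> $ j $ s - B $ j $ s\<bar>})"
      by (intro sum_mono finite_measure_subadditive_finite) auto
    finally show ?thesis .
  qed
  then show ?thesis
    by (intro tendsto_sandwich[OF _ _ tendsto_const lim]) auto
qed

lemma uniform_limit_sum:
  fixes F :: "'i \<Rightarrow> 'b \<Rightarrow> 'c \<Rightarrow> real"
  assumes "finite I" "\<And>i. i \<in> I \<Longrightarrow> uniform_limit S (F i) (G i) net"
  shows "uniform_limit S (\<lambda>n t. \<Sum>i\<in>I. F i n t) (\<lambda>t. \<Sum>i\<in>I. G i t) net"
  using assms by (induction I) (auto intro!: uniform_limit_intros)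

lemma uniform_limit_of_tendsto:
  "(c \<longlongrightarrow> l) net \<Longrightarrow> uniform_limit S (\<lambda>n _. c n :: real) (\<lambda>_. l) net"
  by (rule uniform_limitI) (auto dest: tendstoD elim: eventually_mono)

text \<open>The inverse of \<open>transpose \<Omega> ** matrix_inv V ** \<Omega>\<close> is V
  multiplied by the inverse of \<open>\<Omega>\<close> on the left and its transpose on the right.
  With \<open>C\<close> the inverse of \<open>f *\<^sub>R \<Omega>\<close>, the covariance is
  therefore that of \<open>C\<close> applied to a vector with covariance
  \<open>f *\<^sub>R V\<close>: two factors \<open>1 / f\<close> against one factor
  \<open>f\<close>.\<close>

lemma sandwich_covariance:
  fixes \<Omega> V :: "real^'n^'n"
  assumes \<Omega>: "invertible \<Omega>" and sym: "transpose V = V" and pos: "\<And>c. c \<noteq> 0 \<Longrightarrow> 0 < c \<bullet> (V *v c)" and f: "0 < f"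
  defines "\<Sigma> \<equiv> (1 / f) *\<^sub>R matrix_inv (transpose \<Omega> ** matrix_inv V ** \<Omega>)"
    and "C \<equiv> matrix_inv (f *\<^sub>R \<Omega>)"
  shows "transpose \<Sigma> = \<Sigma>" "c \<noteq> 0 \<Longrightarrow> 0 < c \<bullet> (\<Sigma> *v c)"
    "c \<bullet> (\<Sigma> *v c) = (transpose C *v c) \<bullet> ((f *\<^sub>R V) *v (transpose C *v c))"
proof -
  let ?P = "matrix_inv \<Omega>"
  have "invertible V" using pos by (rule posdef_invertible)
  note V = matrix_inv_mult[OF this] and P = matrix_inv_mult[OF \<Omega>]
  have "transpose \<Omega> ** matrix_inv V ** \<Omega> ** (?P ** V ** transpose ?P) =
      transpose \<Omega> ** (matrix_inv V ** ((\<Omega> ** ?P) ** V)) ** transpose ?P"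
    by (simp only: matrix_mul_assoc)
  also have "\<dots> = transpose (?P ** \<Omega>)"
    by (simp only: V(2) P(1) matrix_mul_lid matrix_mul_rid matrix_transpose_mul)
  also have "\<dots> = mat 1" by (simp add: P transpose_mat)
  finally have inv: "matrix_inv (transpose \<Omega> ** matrix_inv V ** \<Omega>) = ?P ** V ** transpose ?P"
    by (rule matrix_inv_unique)
  have \<Sigma>: "\<Sigma> = (1 / f) *\<^sub>R (?P ** V ** transpose ?P)"
    by (simp add: \<Sigma>_def inv)
  have tsc: "transpose (k *\<^sub>R A) = k *\<^sub>R transpose A" for k and A :: "real^'n^'n"
    by (simp add: transpose_def vec_eq_iff)
  show "transpose \<Sigma> = \<Sigma>"
    by (simp add: \<Sigma> tsc matrix_transpose_mul sym matrix_mul_assoc)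
  have quad: "c \<bullet> (\<Sigma> *v c) = 1 / f * ((transpose ?P *v c) \<bullet> (V *v (transpose ?P *v c)))" for c
    by (simp add: \<Sigma> scaleR_matrix_vector_assoc[symmetric] matrix_vector_mul_assoc[symmetric] dot_lmul_matrix)
  have C: "C = (1 / f) *\<^sub>R ?P"
    using f \<Omega> by (simp add: C_def matrix_inv_scaleR)
  show "c \<bullet> (\<Sigma> *v c) = (transpose C *v c) \<bullet> ((f *\<^sub>R V) *v (transpose C *v c))"
    using f unfolding quad C tsc
    by (simp add: scaleR_matrix_vector_assoc[symmetric] matrix_vector_mult_scaleR)
  show "0 < c \<bullet> (\<Sigma> *v c)" if "c \<noteq> 0"
  proof -
    have "transpose ?P *v c \<noteq> 0"
    proof
      assume "transpose ?P *v c = 0"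
      then have "transpose \<Omega> *v (transpose ?P *v c) = 0" by (simp only: matrix_vector_mult_0_right)
      then have "transpose (?P ** \<Omega>) *v c = 0" by (simp only: matrix_transpose_mul matrix_vector_mul_assoc)
      then show False using that by (simp add: P transpose_mat)
    qed
    from pos[OF this] show ?thesis using f by (simp add: quad)
  qed
qed

section \<open>Bias and asymptotic normality\<close>

text \<open>The hypotheses of the theorem, collected so that bias and fluctuations share the same
  objects depending on \<open>n\<close>.\<close>

locale score_estimation =
  fixes M :: "'a measure" and X :: "nat \<Rightarrow> 'a \<Rightarrow> real"
    and f L :: "real \<Rightarrow> real" and U :: ereal
    and h x :: "nat \<Rightarrow> real" and x0 z :: real
    and beta_hat :: "nat \<Rightarrow> 'a \<Rightarrow> real^'s::{finite,linorder}"
  assumes M: "prob_space M"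
    and U: "0 < U"
    and f_pos: "\<And>y. y \<in> halfopen U \<Longrightarrow> 0 < f y"
    and f_zero: "\<And>y. y \<notin> halfopen U \<Longrightarrow> f y = 0"
    and indep: "prob_space.indep_vars M (\<lambda>_. borel) X UNIV"
    and density: "\<And>i. distributed M lborel (X i) (\<lambda>y. ennreal (f y))"
    and L: "L = (\<lambda>y. ln (f y))"
    and h_pos: "\<And>n. 0 < h n"
    and h_lim: "h \<longlonglongrightarrow> 0"
    and nh3: "filterlim (\<lambda>n. real n * h n ^ 3) at_top sequentially"
    and point:
      "(0 < x0 \<and> ereal x0 < U \<and> (\<forall>n. x n = x0) \<and> z = 1) \<or>
       (x0 = 0 \<and> 0 \<le> z \<and> z \<le> 1 \<and> (\<forall>n. x n = z * h n))"
    and smooth: "cont_diff_near (halfopen U) (CARD('s) + 1) L x0"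
    and beta_hat_meas: "\<And>n. beta_hat n \<in> borel_measurable M"
    and beta_hat: "\<And>n \<omega>. \<omega> \<in> space M \<Longrightarrow>
      (\<exists>!c :: (real, 's) vec. solves_system z n (h n) (x n) (\<lambda>i. X i \<omega>) c) \<Longrightarrow>
      solves_system z n (h n) (x n) (\<lambda>i. X i \<omega>) (beta_hat n \<omega>)"
begin

sublocale prob_space M by (rule M)

abbreviation "A \<equiv> halfopen U"
abbreviation "N \<equiv> \<lambda>k. nth_deriv_within A k L"

section \<open>The shrinking window and the density near the evaluation point\<close>

lemma z: "0 \<le> z" "z \<le> 1" using point by auto

lemma x0_in: "x0 \<in> A" using point U by (auto simp: halfopen_def zero_ereal_def)

lemma f_nonneg: "0 \<le> f y" using f_pos[of y] f_zero[of y] by (cases "y \<in> A") auto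

lemma f_x0: "0 < f x0" using f_pos x0_in .

lemma f_measurable [measurable]: "f \<in> borel_measurable borel"
  using distributed_real_measurable[OF _ density[of 0]] f_nonneg by simp

lemma X_measurable [measurable]: "X i \<in> borel_measurable M"
  using distributed_measurable[OF density[of i]] by simp

text \<open>In the interior case the window stays in the support once \<open>h n\<close> is small
  against \<open>x0\<close>. In the boundary case \<open>x n + h n * t = h n * (z + t)\<close>,
  which is nonnegative for every \<open>n\<close>: truncating the kernels at \<open>-z\<close> fits
  the window to the support.\<close>

lemma eventually_window:
  assumes "0 < e"
  shows "\<forall>\<^sub>F n in sequentially. \<forall>t\<in>{-z..1}. x n + h n * t \<in> A \<and> \<bar>x n + h n * t - x0\<bar> < e"
proof -
  have "open {y. ereal y < U}"
    using open_ereal_vimage[OF open_lessThan[of U]] by (simp add: vimage_def)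
  moreover have "x0 \<in> {y. ereal y < U}" using x0_in by (simp add: halfopen_def)
  ultimately obtain d where d: "0 < d" "\<And>y. \<bar>y - x0\<bar> < d \<Longrightarrow> ereal y < U"
    unfolding open_contains_ball by (auto simp: subset_iff dist_real_def abs_minus_commute)
  \<comment> \<open>The distance to the left end of the support in the interior case, and a dummy 1
    at the boundary. Halving in \<open>r\<close> leaves room for the window to extend
    \<open>2 * h n\<close> from 0 when \<open>z = 1\<close>.\<close>
  define c where "c = (if x0 = 0 then 1 else x0)"
  have c: "0 < c" using point by (auto simp: c_def)
  define r where "r = min (min e d) c / 2"
  have r: "0 < r" "2 * r \<le> e" "2 * r \<le> d" "2 * r \<le> c"
    using assms d(1) c by (simp_all add: r_def)
  show ?thesis
    using order_tendstoD(2)[OF h_lim r(1)]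
  proof eventually_elim
    case (elim n)
    show ?case
    proof
      fix t assume t: "t \<in> {-z..1}"
      have hz: "- (h n * z) \<le> h n * t" "h n * t \<le> h n" "h n * z \<le> h n"
        using t z h_pos[of n] mult_left_mono[of "- z" t "h n"] mult_left_mono[of t 1 "h n"]
          mult_left_mono[of z 1 "h n"] by auto
      have bd: "\<bar>x n + h n * t - x0\<bar> < 2 * r" and nn: "0 \<le> x n + h n * t"
        using point
      proof (atomize (full), elim disjE)
        assume "0 < x0 \<and> ereal x0 < U \<and> (\<forall>n. x n = x0) \<and> z = 1"
        then have eq: "x n = x0" "z = 1" "x0 = c" by (auto simp: c_def)
        have "- h n \<le> h n * t" using hz(1) eq(2) by simp
        then show "\<bar>x n + h n * t - x0\<bar> < 2 * r \<and> 0 \<le> x n + h n * t"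
          using hz(2) elim h_pos[of n] r(4) eq(3) unfolding abs_less_iff eq(1)
          by (intro conjI; linarith)
      next
        assume "x0 = 0 \<and> 0 \<le> z \<and> z \<le> 1 \<and> (\<forall>n. x n = z * h n)"
        then have eq: "x0 = 0" "x n = h n * z" by simp_all
        show "\<bar>x n + h n * t - x0\<bar> < 2 * r \<and> 0 \<le> x n + h n * t"
          using hz elim h_pos[of n] unfolding abs_less_iff eq by (intro conjI; linarith)
      qed
      show "x n + h n * t \<in> A \<and> \<bar>x n + h n * t - x0\<bar> < e"
        using bd nn r d by (auto simp: halfopen_def)
    qed
  qed
qed

lemma uniform_limit_window:
  assumes "0 < e" "continuous_on (A \<inter> ball x0 e) G"
  shows "uniform_limit {-z..1} (\<lambda>n t. G (x n + h n * t)) (\<lambda>_. G x0 :: real) sequentially"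
proof (rule uniform_limitI)
  fix r :: real assume r: "0 < r"
  obtain d where d: "0 < d" "\<And>y. y \<in> A \<inter> ball x0 e \<Longrightarrow> dist y x0 < d \<Longrightarrow> dist (G y) (G x0) < r"
    using assms x0_in r unfolding continuous_on_iff by (metis IntI centre_in_ball)
  show "\<forall>\<^sub>F n in sequentially. \<forall>t\<in>{-z..1}. dist (G (x n + h n * t)) (G x0) < r"
    using eventually_window[of "min d e", simplified, OF conjI[OF d(1) assms(1)]]
  proof eventually_elim
    case (elim n)
    show ?case
    proof
      fix t assume "t \<in> {-z..1}"
      then have "x n + h n * t \<in> A" "\<bar>x n + h n * t - x0\<bar> < d" "\<bar>x n + h n * t - x0\<bar> < e"
        using elim by auto
      then show "dist (G (x n + h n * t)) (G x0) < r"
        by (intro d(2)) (auto simp: dist_real_def abs_minus_commute)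
    qed
  qed
qed

lemma tendsto_at_x:
  assumes "0 < e" "continuous_on (A \<inter> ball x0 e) G"
  shows "(\<lambda>n. G (x n)) \<longlonglongrightarrow> (G x0 :: real)"
  using tendsto_uniform_limitI[OF uniform_limit_window[OF assms], of 0] z by simp

lemma continuous_on_window:
  assumes "0 < e" "continuous_on (A \<inter> ball x0 e) G"
  shows "\<forall>\<^sub>F n in sequentially. continuous_on {-z..1} (\<lambda>t. G (x n + h n * t) :: real)"
  using eventually_window[OF assms(1)]
proof eventually_elim
  case (elim n)
  then have "(\<lambda>t. x n + h n * t) ` {-z..1} \<subseteq> A \<inter> ball x0 e"
    by (auto simp: dist_real_def abs_minus_commute)
  then show ?case
    by (intro continuous_on_compose2[OF assms(2)] continuous_intros)
qed

lemma smooth_radius: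
  obtains e where "0 < e"
    "\<And>k y. k \<le> CARD('s) \<Longrightarrow> y \<in> A \<inter> ball x0 e \<Longrightarrow> (N k has_real_derivative N (Suc k) y) (at y within A)"
    "\<And>k. k \<le> Suc CARD('s) \<Longrightarrow> continuous_on (A \<inter> ball x0 e) (N k)"
proof -
  obtain e where e: "0 < e"
    "\<And>k y. k \<le> CARD('s) \<Longrightarrow> y \<in> A \<inter> ball x0 e \<Longrightarrow> N k differentiable (at y within A)"
    "continuous_on (A \<inter> ball x0 e) (N (CARD('s) + 1))"
    using smooth unfolding cont_diff_near_def by (metis less_Suc_eq_le Suc_eq_plus1)
  have der: "(N k has_real_derivative N (Suc k) y) (at y within A)" if "k \<le> CARD('s)" "y \<in> A \<inter> ball x0 e" for k y
    using e(2)[OF that] by (simp add: nth_deriv_within_def vector_derivative_works has_real_derivative_iff_has_vector_derivative)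
  moreover have "continuous_on (A \<inter> ball x0 e) (N k)" if "k \<le> Suc CARD('s)" for k
  proof (cases "k \<le> CARD('s)")
    case True
    have "continuous (at y within A \<inter> ball x0 e) (N k)" if "y \<in> A \<inter> ball x0 e" for y
      using DERIV_continuous[OF der[OF True that]] by (rule continuous_within_subset) auto
    then show ?thesis by (simp add: continuous_on_eq_continuous_within)
  next
    case False
    with that e(3) show ?thesis by (metis Suc_eq_plus1 le_SucE)
  qed
  ultimately show ?thesis using e(1) that by blast
qed

lemma f_eq_exp: "y \<in> A \<Longrightarrow> f y = exp (N 0 y)"
  using f_pos[of y] by (simp add: nth_deriv_within_def L)

text \<open>One radius fixed once and for all, so that \<open>regular\<close> can be a predicate of
  \<open>n\<close> alone and identities can be proved for each such \<open>n\<close>.\<close>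

definition "smooth_rad = (SOME e. 0 < e \<and>
    (\<forall>k y. k \<le> CARD('s) \<longrightarrow> y \<in> A \<inter> ball x0 e \<longrightarrow> (N k has_real_derivative N (Suc k) y) (at y within A)) \<and>
    (\<forall>k. k \<le> Suc CARD('s) \<longrightarrow> continuous_on (A \<inter> ball x0 e) (N k)))"

lemma smooth_rad: "0 < smooth_rad"
    "k \<le> CARD('s) \<Longrightarrow> y \<in> A \<Longrightarrow> \<bar>y - x0\<bar> < smooth_rad \<Longrightarrow> (N k has_real_derivative N (Suc k) y) (at y within A)"
    "k \<le> Suc CARD('s) \<Longrightarrow> continuous_on (A \<inter> ball x0 smooth_rad) (N k)"
proof -
  have "\<exists>e. 0 < e \<and>
    (\<forall>k y. k \<le> CARD('s) \<longrightarrow> y \<in> A \<inter> ball x0 e \<longrightarrow> (N k has_real_derivative N (Suc k) y) (at y within A)) \<and>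
    (\<forall>k. k \<le> Suc CARD('s) \<longrightarrow> continuous_on (A \<inter> ball x0 e) (N k))"
    by (rule smooth_radius) blast
  from someI_ex[OF this, folded smooth_rad_def] show "0 < smooth_rad"
    "k \<le> CARD('s) \<Longrightarrow> y \<in> A \<Longrightarrow> \<bar>y - x0\<bar> < smooth_rad \<Longrightarrow> (N k has_real_derivative N (Suc k) y) (at y within A)"
    "k \<le> Suc CARD('s) \<Longrightarrow> continuous_on (A \<inter> ball x0 smooth_rad) (N k)"
    by (auto simp: dist_real_def abs_minus_commute)
qed

lemma f_continuous: "continuous_on (A \<inter> ball x0 smooth_rad) f"
proof -
  have "continuous_on (A \<inter> ball x0 smooth_rad) (\<lambda>y. exp (N 0 y))"
    by (intro continuous_intros smooth_rad) simp
  then show ?thesis by (rule continuous_on_eq) (simp add: f_eq_exp)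
qed

text \<open>From \<open>f = exp L\<close> on the support. Through this identity an integral against
  the derivative of the density becomes one against \<open>f\<close> times the derivative of
  \<open>L\<close>.\<close>

lemma f_deriv:
  assumes "y \<in> A" "\<bar>y - x0\<bar> < smooth_rad"
  shows "(f has_real_derivative f y * N 1 y) (at y within A)"
proof -
  have "((\<lambda>y. exp (N 0 y)) has_real_derivative exp (N 0 y) * N 1 y) (at y within A)"
    using DERIV_chain'[OF smooth_rad(2)[OF _ assms, of 0] DERIV_exp] by simp
  then have "((\<lambda>y. exp (N 0 y)) has_real_derivative f y * N 1 y) (at y within A)"
    using assms by (simp add: f_eq_exp)
  then show ?thesis
    by (rule has_field_derivative_transform_within[OF _ zero_less_one assms(1)]) (simp add: f_eq_exp)
qed

section \<open>Kernel moments as integrals over the fixed window\<close>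

definition local_integral :: "nat \<Rightarrow> (real \<Rightarrow> real) \<Rightarrow> real" where
  "local_integral n K = (LBINT t:{-z..1}. K t * f (x n + h n * t))"

text \<open>The kernel may vary with \<open>n\<close>, as required for the Taylor remainder and for
  the scores, which contain \<open>scaled_btilde n\<close>.\<close>

lemma local_integral_tendsto:
  assumes u: "uniform_limit {-z..1} K K0 sequentially"
    and "\<forall>\<^sub>F n in sequentially. continuous_on {-z..1} (K n)" "continuous_on {-z..1} K0"
  shows "(\<lambda>n. local_integral n (K n)) \<longlonglongrightarrow> f x0 * (LBINT t:{-z..1}. K0 t)"
proof -
  have "bounded (K0 ` {-z..1})"
    by (intro compact_imp_bounded compact_continuous_image assms compact_Icc)
  then have "uniform_limit {-z..1} (\<lambda>n t. K n t * f (x n + h n * t)) (\<lambda>t. K0 t * f x0) sequentially"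
    by (intro uniform_lim_mult u uniform_limit_window[OF smooth_rad(1) f_continuous]) (auto simp: image_constant_conv)
  moreover have "\<forall>\<^sub>F n in sequentially. continuous_on {-z..1} (\<lambda>t. K n t * f (x n + h n * t))"
    using assms(2) continuous_on_window[OF smooth_rad(1) f_continuous]
    by eventually_elim (rule continuous_on_mult)
  ultimately have "(\<lambda>n. LBINT t:{-z..1}. K n t * f (x n + h n * t)) \<longlonglongrightarrow> (LBINT t:{-z..1}. K0 t * f x0)"
    using z assms(3) by (intro LBINT_uniform_tendsto) (auto intro!: continuous_intros)
  then show ?thesis by (simp add: local_integral_def mult.commute)
qed

lemma local_integral_tendsto_const:
  assumes "continuous_on {-z..1} K"
  shows "(\<lambda>n. local_integral n K) \<longlonglongrightarrow> f x0 * (LBINT t:{-z..1}. K t)"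
  using assms by (intro local_integral_tendsto uniform_limit_const) auto

lemma local_integral_cong: "(\<And>t. - z < t \<Longrightarrow> t < 1 \<Longrightarrow> K t = K' t) \<Longrightarrow> local_integral n K = local_integral n K'"
  unfolding local_integral_def by (rule LBINT_Icc_cong_Ioo) simp

definition "obs_law = distr M borel (X 0)"

lemma distr_X: "distr M borel (X i) = obs_law"
proof -
  have "distr M borel (X i) = density lborel (\<lambda>y. ennreal (f y))" for i
    using distributed_distr_eq_density[OF density[of i]] by (simp cong: distr_cong)
  then show ?thesis by (simp add: obs_law_def)
qed

text \<open>Substituting \<open>y = x n + h n * t\<close> produces the factor \<open>h n\<close>. It
  is kept out of \<open>local_integral\<close>, which therefore has a limit of order one.\<close>

lemma expectation_kernel:
  assumes [measurable]: "K \<in> borel_measurable borel"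
    and supp: "\<And>t. \<not> (- z \<le> t \<and> t \<le> 1) \<Longrightarrow> K t = 0"
  shows "expectation (\<lambda>\<omega>. K ((X i \<omega> - x n) / h n)) = h n * local_integral n K"
proof -
  have "expectation (\<lambda>\<omega>. K ((X i \<omega> - x n) / h n)) = (LBINT y. f y * K ((y - x n) / h n))"
    using f_nonneg by (intro distributed_integral[OF density, symmetric]) auto
  also have "\<dots> = \<bar>h n\<bar> *\<^sub>R (LBINT t. f (x n + h n * t) * K ((x n + h n * t - x n) / h n))"
    using h_pos[of n] by (intro lborel_integral_real_affine) simp
  also have "(LBINT t. f (x n + h n * t) * K ((x n + h n * t - x n) / h n)) = local_integral n K"
    unfolding local_integral_def set_lebesgue_integral_def using h_pos[of n] supp
    by (intro Bochner_Integration.integral_cong refl) (auto simp: indicator_def)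
  finally show ?thesis using h_pos[of n] by simp
qed

lemma integral_obs_law_kernel:
  assumes [measurable]: "K \<in> borel_measurable borel"
    and supp: "\<And>t. \<not> (- z \<le> t \<and> t \<le> 1) \<Longrightarrow> K t = 0"
  shows "(LINT y|obs_law. K ((y - x n) / h n)) = h n * local_integral n K"
  unfolding obs_law_def by (subst integral_distr) (auto simp: expectation_kernel[OF assms])

definition "regular n \<longleftrightarrow> (\<forall>t\<in>{-z..1}. x n + h n * t \<in> A \<and> \<bar>x n + h n * t - x0\<bar> < smooth_rad)"

lemma eventually_regular: "\<forall>\<^sub>F n in sequentially. regular n"
  unfolding regular_def by (rule eventually_window[OF smooth_rad(1)])

lemma regular_continuous:
  assumes "regular n" "continuous_on (A \<inter> ball x0 smooth_rad) G"
  shows "continuous_on {-z..1} (\<lambda>t. G (x n + h n * t) :: real)"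
proof -
  have "(\<lambda>t. x n + h n * t) ` {-z..1} \<subseteq> A \<inter> ball x0 smooth_rad"
    using assms(1) by (auto simp: regular_def dist_real_def abs_minus_commute)
  then show ?thesis
    by (intro continuous_on_compose2[OF assms(2)] continuous_intros)
qed

lemma local_integral_sum:
  assumes "regular n" "finite I" "\<And>i. i \<in> I \<Longrightarrow> continuous_on {-z..1} (K i)"
  shows "local_integral n (\<lambda>t. \<Sum>i\<in>I. c i * K i t) = (\<Sum>i\<in>I. c i * local_integral n (K i))"
proof -
  have "local_integral n (\<lambda>t. \<Sum>i\<in>I. c i * K i t) = (LBINT t:{-z..1}. \<Sum>i\<in>I. c i * (K i t * f (x n + h n * t)))"
    by (simp add: local_integral_def sum_distrib_right mult.assoc)
  also have "\<dots> = (\<Sum>i\<in>I. LBINT t:{-z..1}. c i * (K i t * f (x n + h n * t)))"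
    by (intro LBINT_sum_continuous assms continuous_intros regular_continuous[OF assms(1) f_continuous])
  finally show ?thesis by (simp add: local_integral_def)
qed

lemma local_integral_add:
  assumes "regular n" "continuous_on {-z..1} K" "continuous_on {-z..1} K'"
  shows "local_integral n (\<lambda>t. K t + K' t) = local_integral n K + local_integral n K'"
  using local_integral_sum[OF assms(1), of "UNIV :: bool set" "\<lambda>b. if b then K else K'" "\<lambda>_. 1"] assms(2,3)
  by (simp add: UNIV_bool add.commute)

lemma local_integral_cmult: "local_integral n (\<lambda>t. c * K t) = c * local_integral n K"
  by (simp add: local_integral_def mult.assoc)

lemma local_integral_gder_poly:
  assumes g: "regular n" and j: "1 \<le> j"
  shows "local_integral n (gder_poly z j) = - h n * local_integral n (\<lambda>t. gfun_poly z j t * N 1 (x n + h n * t))"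
proof -
  let ?y = "\<lambda>t. x n + h n * t"
  let ?F' = "\<lambda>t. gder_poly z j t * f (?y t) + h n * (gfun_poly z j t * N 1 (?y t)) * f (?y t)"
  have cf: "continuous_on {-z..1} (\<lambda>t. f (?y t))"
    by (rule regular_continuous[OF g f_continuous])
  have cN: "continuous_on {-z..1} (\<lambda>t. N 1 (?y t))"
    by (rule regular_continuous[OF g smooth_rad(3)]) (simp add: Suc_le_eq)
  have der: "((\<lambda>t. gfun_poly z j t * f (?y t)) has_vector_derivative ?F' t) (at t within {-z..1})"
    if "- z \<le> t" "t \<le> 1" for t
  proof -
    have "(f has_real_derivative f (?y t) * N 1 (?y t)) (at (?y t) within A)"
      using g that by (intro f_deriv) (auto simp: regular_def)
    \<comment> \<open>At the point 0 only a one-sided derivative is available, so the chain rule is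
      applied within the image of the window, which lies in the support.\<close>
    then have "(f has_real_derivative f (?y t) * N 1 (?y t)) (at (?y t) within ?y ` {-z..1})"
      by (rule has_field_derivative_subset) (use g in \<open>auto simp: regular_def\<close>)
    moreover have "(?y has_real_derivative h n) (at t within {-z..1})"
      by (auto intro!: derivative_eq_intros)
    ultimately have "((\<lambda>t. f (?y t)) has_real_derivative f (?y t) * N 1 (?y t) * h n) (at t within {-z..1})"
      using DERIV_image_chain[of f _ ?y t "{-z..1}"] by (simp add: o_def)
    from DERIV_mult[OF has_real_derivative_gfun_poly this, of z j]
    show ?thesis
      unfolding has_real_derivative_iff_has_vector_derivative[symmetric] by (simp add: algebra_simps)
  qed
  have "(LBINT t:{-z..1}. ?F' t) = gfun_poly z j 1 * f (?y 1) - gfun_poly z j (- z) * f (?y (- z))"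
    unfolding set_lebesgue_integral_def
    by (rule integral_FTC_atLeastAtMost) (use z der cf cN in \<open>auto intro!: continuous_intros\<close>)
  also have "\<dots> = 0" using j by (simp add: gfun_poly_def)
  finally have "local_integral n (\<lambda>t. gder_poly z j t + h n * (gfun_poly z j t * N 1 (?y t))) = 0"
    by (simp add: local_integral_def distrib_right)
  then have "local_integral n (gder_poly z j) + h n * local_integral n (\<lambda>t. gfun_poly z j t * N 1 (?y t)) = 0"
    using cN by (simp add: local_integral_add[OF g] local_integral_cmult continuous_intros)
  then show ?thesis by simp
qed

text \<open>The remainder of the degree-S Taylor expansion of \<open>N 1\<close> at
  \<open>x n\<close>, divided by \<open>h n ^ S\<close>. The term of degree S is split off from the
  sum because it produces the bias, while the lower terms reproduce the target vector.\<close>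

definition taylor_rem :: "nat \<Rightarrow> real \<Rightarrow> real" where
  "taylor_rem n t = (N 1 (x n + h n * t) - (\<Sum>k<CARD('s). N (Suc k) (x n) * (h n * t) ^ k / fact k)) / h n ^ CARD('s)
     - N (Suc CARD('s)) (x n) * t ^ CARD('s) / fact CARD('s)"

lemma taylor_rem_continuous:
  assumes "regular n" shows "continuous_on {-z..1} (taylor_rem n)"
  unfolding taylor_rem_def using h_pos[of n] regular_continuous[OF assms smooth_rad(3)[of 1]]
  by (auto intro!: continuous_intros simp: Suc_le_eq)

text \<open>Taylor's theorem is applied to \<open>N 1\<close> minus its degree-S term. The
  derivative of order S of that difference is the increment of \<open>N (Suc S)\<close> over the
  window, so continuity of the highest derivative suffices. Since \<open>z \<le> 1\<close>, the
  powers of \<open>t\<close> are bounded by 1.\<close>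

lemma taylor_rem_bound:
  assumes g: "regular n" and B: "\<And>t. t \<in> {-z..1} \<Longrightarrow> \<bar>N (Suc CARD('s)) (x n + h n * t) - N (Suc CARD('s)) (x n)\<bar> \<le> B"
    and t: "t \<in> {-z..1}"
  shows "\<bar>taylor_rem n t\<bar> \<le> B"
proof -
  let ?y = "\<lambda>t. x n + h n * t"
  let ?W = "?y ` {-z..1}"
  define b where "b = N (Suc CARD('s)) (x n)"
  define F where "F i y = N (Suc i) y - b * (y - x n) ^ (CARD('s) - i) / fact (CARD('s) - i)" for i y
  obtain p where p: "CARD('s) = Suc p"
    by (metis not0_implies_Suc zero_less_card_finite less_irrefl)
  have W: "convex ?W"
    using convex_affinity[OF convex_real_interval(5)[of "- z" 1], of "x n" "h n"] by simp
  have B0: "0 \<le> B" using B[OF t] by linarith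
  have Fder: "(F i has_field_derivative F (Suc i) y) (at y within ?W)" if "y \<in> ?W" "i \<le> p" for i y
  proof -
    have i: "i < CARD('s)" using that(2) p by simp
    have "(N (Suc i) has_real_derivative N (Suc (Suc i)) y) (at y within A)"
      using g that(1) i by (intro smooth_rad(2)) (auto simp: regular_def)
    then have 1: "(N (Suc i) has_real_derivative N (Suc (Suc i)) y) (at y within ?W)"
      by (rule has_field_derivative_subset) (use g in \<open>auto simp: regular_def\<close>)
    obtain m where m: "CARD('s) - i = Suc m" using i by (metis Suc_diff_Suc)
    then have m': "CARD('s) - Suc i = m" by simp
    have "((\<lambda>y. (y - x n) ^ Suc m) has_real_derivative real (Suc m) * (y - x n) ^ m) (at y within ?W)"
    proof -
      have "((\<lambda>y. y - x n) has_real_derivative 1) (at y within ?W)"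
        by (auto intro!: derivative_eq_intros)
      from DERIV_power_Suc[OF this, of m] show ?thesis by simp
    qed
    from DERIV_cmult[OF this, of "b / fact (Suc m)"]
    have "((\<lambda>y. b * (y - x n) ^ Suc m / fact (Suc m)) has_real_derivative b * (y - x n) ^ m / fact m) (at y within ?W)"
      by (simp add: fact_Suc del: of_nat_Suc power_Suc)
    from DERIV_diff[OF 1 this] show ?thesis
      unfolding F_def m m' .
  qed
  have FB: "norm (F (Suc p) y) \<le> B" if "y \<in> ?W" for y
    using B that p by (auto simp: F_def b_def)
  have x: "x n \<in> ?W" using z by (intro image_eqI[of _ _ 0]) auto
  have y: "?y t \<in> ?W" using t by blast
  have "norm (F 0 (?y t) - (\<Sum>i\<le>p. F i (x n) * (?y t - x n) ^ i / fact i))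
      \<le> B * norm (?y t - x n) ^ Suc p / fact p"
    by (rule field_Taylor[OF W Fder FB x y])
  \<comment> \<open>At \<open>x n\<close> the subtracted monomial has the positive exponent
    \<open>S - i\<close> and vanishes, so the Taylor coefficients are those of
    \<open>N 1\<close>.\<close>
  moreover have "(\<Sum>i\<le>p. F i (x n) * (?y t - x n) ^ i / fact i) = (\<Sum>k<CARD('s). N (Suc k) (x n) * (h n * t) ^ k / fact k)"
    unfolding p lessThan_Suc_atMost using p by (intro sum.cong refl) (simp add: F_def)
  moreover have "F 0 (?y t) = N 1 (?y t) - b * (h n * t) ^ CARD('s) / fact CARD('s)" by (simp add: F_def)
  ultimately have "\<bar>N 1 (?y t) - b * (h n * t) ^ CARD('s) / fact CARD('s) - (\<Sum>k<CARD('s). N (Suc k) (x n) * (h n * t) ^ k / fact k)\<bar>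
      \<le> B * \<bar>h n * t\<bar> ^ CARD('s) / fact p"
    using p by simp
  also have "N 1 (?y t) - b * (h n * t) ^ CARD('s) / fact CARD('s) - (\<Sum>k<CARD('s). N (Suc k) (x n) * (h n * t) ^ k / fact k) = h n ^ CARD('s) * taylor_rem n t"
    using h_pos[of n] by (simp add: taylor_rem_def b_def power_mult_distrib field_simps)
  also have "B * \<bar>h n * t\<bar> ^ CARD('s) / fact p \<le> h n ^ CARD('s) * B"
  proof -
    have "\<bar>t\<bar> ^ CARD('s) \<le> 1" using t z by (intro power_le_one) auto
    then have "\<bar>t\<bar> ^ CARD('s) / fact p \<le> 1 / 1"
      by (intro frac_le) (auto simp: fact_ge_1)
    then have "(h n ^ CARD('s) * B) * (\<bar>t\<bar> ^ CARD('s) / fact p) \<le> (h n ^ CARD('s) * B) * 1"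
      using B0 h_pos[of n] by (intro mult_left_mono) auto
    then show ?thesis using h_pos[of n] by (simp add: abs_mult power_mult_distrib mult_ac)
  qed
  finally show ?thesis using h_pos[of n] by (simp add: abs_mult)
qed

lemma taylor_rem_uniform_limit: "uniform_limit {-z..1} taylor_rem (\<lambda>_. 0) sequentially"
proof (rule uniform_limitI)
  fix e :: real assume e: "0 < e"
  have "0 < e / 4" using e by simp
  from uniform_limitD[OF uniform_limit_window[OF smooth_rad(1) smooth_rad(3)[OF order_refl]] this] eventually_regular
  show "\<forall>\<^sub>F n in sequentially. \<forall>t\<in>{-z..1}. dist (taylor_rem n t) 0 < e"
  proof eventually_elim
    case (elim n)
    have x: "\<bar>N (Suc CARD('s)) (x n) - N (Suc CARD('s)) x0\<bar> < e / 4"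
      using bspec[OF elim(1), of 0] z by (simp add: dist_real_def)
    have "\<bar>N (Suc CARD('s)) (x n + h n * t) - N (Suc CARD('s)) (x n)\<bar> \<le> e / 2" if "t \<in> {-z..1}" for t
      using bspec[OF elim(1) that] x unfolding dist_real_def by linarith
    from taylor_rem_bound[OF elim(2) this] e show ?case by (fastforce simp: dist_real_def)
  qed
qed

text \<open>The columns are natural numbers rather than elements of \<open>'s\<close>, since column
  \<open>S + 1\<close>, outside the matrix, is what the bias is made of.\<close>

definition mean_design_entry :: "nat \<Rightarrow> nat \<Rightarrow> nat \<Rightarrow> real" where
  "mean_design_entry n j k = - local_integral n (\<lambda>t. gfun_poly z j t * t ^ (k - 1)) / fact (k - 1)"

lemma mean_design_entry_tendsto: "(\<lambda>n. mean_design_entry n j k) \<longlonglongrightarrow> f x0 * omega z j k"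
proof -
  have "(\<lambda>n. - local_integral n (\<lambda>t. gfun_poly z j t * t ^ (k - 1)) / fact (k - 1))
      \<longlonglongrightarrow> - (f x0 * (LBINT t:{-z..1}. gfun_poly z j t * t ^ (k - 1))) / fact (k - 1)"
    by (intro tendsto_intros local_integral_tendsto_const continuous_intros) simp
  then show ?thesis by (simp add: mean_design_entry_def omega_eq_gfun_poly)
qed

text \<open>Integration by parts makes the left side minus the local integral of
  \<open>gfun_poly\<close> times \<open>N 1\<close>, and the minus sign is built into
  \<open>mean_design_entry\<close>. Inserting the Taylor expansion gives the design columns times
  the scaled derivatives, plus a term of order \<open>h n ^ S\<close>.\<close>

lemma mean_expansion:
  assumes g: "regular n" and j: "1 \<le> j"
  shows "local_integral n (gder_poly z j) / h n = (\<Sum>k<CARD('s). mean_design_entry n j (Suc k) * (h n ^ k * N (Suc k) (x n)))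
    + h n ^ CARD('s) * (N (Suc CARD('s)) (x n) * mean_design_entry n j (Suc CARD('s)) - local_integral n (\<lambda>t. gfun_poly z j t * taylor_rem n t))"
proof -
  let ?y = "\<lambda>t. x n + h n * t"
  have eq: "gfun_poly z j t * N 1 (?y t) =
      (\<Sum>k<CARD('s). (h n ^ k * N (Suc k) (x n) / fact k) * (gfun_poly z j t * t ^ k))
      + ((h n ^ CARD('s) * N (Suc CARD('s)) (x n) / fact CARD('s)) * (gfun_poly z j t * t ^ CARD('s)) + h n ^ CARD('s) * (gfun_poly z j t * taylor_rem n t))" for t
  proof -
    have "N 1 (?y t) = (\<Sum>k<CARD('s). N (Suc k) (x n) * (h n * t) ^ k / fact k)
        + h n ^ CARD('s) * (N (Suc CARD('s)) (x n) * t ^ CARD('s) / fact CARD('s) + taylor_rem n t)"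
      using h_pos[of n] by (simp add: taylor_rem_def)
    then show ?thesis
      by (simp only: distrib_left sum_distrib_left) (simp add: power_mult_distrib mult_ac)
  qed
  have crem: "continuous_on {-z..1} (taylor_rem n)" by (rule taylor_rem_continuous[OF g])
  have "local_integral n (\<lambda>t. gfun_poly z j t * N 1 (?y t)) =
      (\<Sum>k<CARD('s). (h n ^ k * N (Suc k) (x n) / fact k) * local_integral n (\<lambda>t. gfun_poly z j t * t ^ k))
      + ((h n ^ CARD('s) * N (Suc CARD('s)) (x n) / fact CARD('s)) * local_integral n (\<lambda>t. gfun_poly z j t * t ^ CARD('s))
      + h n ^ CARD('s) * local_integral n (\<lambda>t. gfun_poly z j t * taylor_rem n t))"
    unfolding eq
  proof -
    let ?c = "\<lambda>k. h n ^ k * N (Suc k) (x n) / fact k"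
    have "local_integral n (\<lambda>t. (\<Sum>k<CARD('s). ?c k * (gfun_poly z j t * t ^ k)) + (?c CARD('s) * (gfun_poly z j t * t ^ CARD('s)) + h n ^ CARD('s) * (gfun_poly z j t * taylor_rem n t))) =
        local_integral n (\<lambda>t. \<Sum>k<CARD('s). ?c k * (gfun_poly z j t * t ^ k)) + local_integral n (\<lambda>t. ?c CARD('s) * (gfun_poly z j t * t ^ CARD('s)) + h n ^ CARD('s) * (gfun_poly z j t * taylor_rem n t))"
      by (rule local_integral_add[OF g]) (intro continuous_intros crem)+
    also have "local_integral n (\<lambda>t. \<Sum>k<CARD('s). ?c k * (gfun_poly z j t * t ^ k)) = (\<Sum>k<CARD('s). ?c k * local_integral n (\<lambda>t. gfun_poly z j t * t ^ k))"
      by (rule local_integral_sum[OF g]) (intro continuous_intros finite_lessThan)+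
    also have "local_integral n (\<lambda>t. ?c CARD('s) * (gfun_poly z j t * t ^ CARD('s)) + h n ^ CARD('s) * (gfun_poly z j t * taylor_rem n t)) =
        local_integral n (\<lambda>t. ?c CARD('s) * (gfun_poly z j t * t ^ CARD('s))) + local_integral n (\<lambda>t. h n ^ CARD('s) * (gfun_poly z j t * taylor_rem n t))"
      by (rule local_integral_add[OF g]) (intro continuous_intros crem)+
    finally show "local_integral n (\<lambda>t. (\<Sum>k<CARD('s). ?c k * (gfun_poly z j t * t ^ k)) + (?c CARD('s) * (gfun_poly z j t * t ^ CARD('s)) + h n ^ CARD('s) * (gfun_poly z j t * taylor_rem n t))) =
        (\<Sum>k<CARD('s). ?c k * local_integral n (\<lambda>t. gfun_poly z j t * t ^ k)) + (?c CARD('s) * local_integral n (\<lambda>t. gfun_poly z j t * t ^ CARD('s)) + h n ^ CARD('s) * local_integral n (\<lambda>t. gfun_poly z j t * taylor_rem n t))"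
      unfolding local_integral_cmult .
  qed
  then have "- local_integral n (\<lambda>t. gfun_poly z j t * N 1 (?y t)) =
      (\<Sum>k<CARD('s). mean_design_entry n j (Suc k) * (h n ^ k * N (Suc k) (x n)))
    + h n ^ CARD('s) * (N (Suc CARD('s)) (x n) * mean_design_entry n j (Suc CARD('s)) - local_integral n (\<lambda>t. gfun_poly z j t * taylor_rem n t))"
    by (simp add: mean_design_entry_def sum_negf algebra_simps)
  then show ?thesis using h_pos[of n] local_integral_gder_poly[OF g j] by simp
qed

section \<open>The population system and the bias\<close>

definition mean_design :: "nat \<Rightarrow> ((real, 's) vec, 's) vec" where
  "mean_design n = (\<chi> j s. mean_design_entry n (pos j) (pos s))"

lemma mean_design_tendsto: "mean_design \<longlonglongrightarrow> f x0 *\<^sub>R (Omega_mat z :: ((real, 's) vec, 's) vec)"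
  unfolding mean_design_def Omega_mat_def by (intro vec_tendstoI) (simp add: mean_design_entry_tendsto)

lemma invertible_limit: "invertible (f x0 *\<^sub>R (Omega_mat z :: ((real, 's) vec, 's) vec))"
  using invertible_scaleR[OF invertible_Omega_mat[OF z(1)], of "f x0"] f_x0 by simp

definition mean_score :: "nat \<Rightarrow> (real, 's) vec" where
  "mean_score n = (\<chi> j. local_integral n (gder_poly z (pos j)) / h n)"

abbreviation "btilde n \<equiv> beta_tilde M (X 0) z (h n) (x n) :: (real, 's) vec"
abbreviation "beta n \<equiv> deriv_vec A L (x n) :: (real, 's) vec"

definition scaled_btilde :: "nat \<Rightarrow> (real, 's) vec" where
  "scaled_btilde n = Lambda_mat (h n) *v btilde n"

lemma mean_score_expansion:
  assumes "regular n"
  shows "mean_score n = mean_design n *v (Lambda_mat (h n) *v beta n) +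
    h n ^ CARD('s) *\<^sub>R (\<chi> j. N (Suc CARD('s)) (x n) * mean_design_entry n (pos j) (Suc CARD('s)) - local_integral n (\<lambda>t. gfun_poly z (pos j) t * taylor_rem n t))"
proof -
  have "(mean_design n *v (Lambda_mat (h n) *v beta n)) $ j = (\<Sum>k<CARD('s). mean_design_entry n (pos j) (Suc k) * (h n ^ k * N (Suc k) (x n)))" for j
  proof -
    have "(mean_design n *v (Lambda_mat (h n) *v beta n)) $ j =
        (\<Sum>s\<in>(UNIV::'s set). mean_design_entry n (pos j) (pos s) * (h n ^ (pos s - 1) * N (pos s) (x n)))"
      unfolding Lambda_mat_mult by (simp add: matrix_vector_mult_def mean_design_def deriv_vec_def)
    also have "\<dots> = (\<Sum>k<CARD('s). mean_design_entry n (pos j) (Suc k) * (h n ^ k * N (Suc k) (x n)))"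
      by (subst sum_pos[of "\<lambda>k. mean_design_entry n (pos j) k * (h n ^ (k - 1) * N k (x n))"]) simp
    finally show ?thesis .
  qed
  then show ?thesis
    by (simp add: vec_eq_iff mean_score_def mean_expansion[OF assms pos_ge_1])
qed

lemma local_integral_one_tendsto: "(\<lambda>n. local_integral n (\<lambda>_. 1)) \<longlonglongrightarrow> f x0 * (1 + z)"
  using local_integral_tendsto_const[of "\<lambda>_. 1"] z by (simp add: set_lebesgue_integral_def)

lemma eventually_local_integral_one_pos: "\<forall>\<^sub>F n in sequentially. 0 < local_integral n (\<lambda>_. 1)"
  using order_tendstoD(1)[OF local_integral_one_tendsto, of 0] f_x0 z by simp

text \<open>The window has probability \<open>h n\<close> times the local integral of 1, so
  \<open>h n\<close> cancels and conditioning merely divides by that integral. The same divisor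
  occurs in \<open>ell_vec\<close> and \<open>R_mat\<close> and disappears from
  \<open>beta_tilde\<close>.\<close>

lemma window_integral:
  assumes [measurable]: "K \<in> borel_measurable borel"
    and supp: "\<And>t. \<not> (- z \<le> t \<and> t \<le> 1) \<Longrightarrow> K t = 0"
    and pos: "0 < local_integral n (\<lambda>_. 1)"
  shows "(LINT \<omega>|window_measure M (X 0) z (h n) (x n). K ((X 0 \<omega> - x n) / h n)) = local_integral n K / local_integral n (\<lambda>_. 1)"
proof -
  define W where "W = {\<omega>\<in>space M. x n - z * h n \<le> X 0 \<omega> \<and> X 0 \<omega> \<le> x n + h n}"
  have [measurable]: "W \<in> sets M" unfolding W_def by measurable
  have W: "\<omega> \<in> W \<longleftrightarrow> - z \<le> (X 0 \<omega> - x n) / h n \<and> (X 0 \<omega> - x n) / h n \<le> 1" if "\<omega> \<in> space M" for \<omega>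
    using that h_pos[of n] by (auto simp: W_def pos_divide_le_eq pos_le_divide_eq)
  have "prob W = expectation (indicator W)" by simp
  also have "\<dots> = expectation (\<lambda>\<omega>. indicator {-z..1} ((X 0 \<omega> - x n) / h n))"
    by (intro Bochner_Integration.integral_cong refl) (simp add: indicator_def W)
  also have "\<dots> = h n * local_integral n (indicator {-z..1})"
    by (rule expectation_kernel) (auto simp: indicator_def)
  also have "local_integral n (indicator {-z..1}) = local_integral n (\<lambda>_. 1)"
    by (rule local_integral_cong) (auto simp: indicator_def)
  finally have prob: "prob W = h n * local_integral n (\<lambda>_. 1)" .
  have "expectation (\<lambda>\<omega>. indicator W \<omega> * K ((X 0 \<omega> - x n) / h n)) = expectation (\<lambda>\<omega>. K ((X 0 \<omega> - x n) / h n))"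
    using supp by (intro Bochner_Integration.integral_cong refl) (auto simp: indicator_def W)
  also have "\<dots> = h n * local_integral n K" by (rule expectation_kernel[OF assms(1,2)])
  finally show ?thesis
    unfolding window_measure_def W_def[symmetric] using prob pos h_pos[of n]
    by (subst integral_uniform_measure) auto
qed

lemma ell_vec_eq:
  assumes "0 < local_integral n (\<lambda>_. 1)"
  shows "ell_vec M (X 0) z (h n) (x n) = (1 / local_integral n (\<lambda>_. 1)) *\<^sub>R mean_score n"
proof -
  have "(LINT \<omega>|window_measure M (X 0) z (h n) (x n). 1 / h n * gder z j ((X 0 \<omega> - x n) / h n)) =
      local_integral n (\<lambda>t. 1 / h n * gder z j t) / local_integral n (\<lambda>_. 1)" for j
    by (rule window_integral[OF _ _ assms]) (auto simp: gder_outside)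
  moreover have "local_integral n (\<lambda>t. 1 / h n * gder z j t) = local_integral n (gder_poly z j) / h n" for j
    unfolding local_integral_cmult by (subst local_integral_cong[of "gder z j" "gder_poly z j"]) (simp_all add: gder_eq_gder_poly)
  ultimately show ?thesis
    unfolding ell_vec_def mean_score_def by (simp add: vec_eq_iff)
qed

lemma R_mat_mult:
  assumes "0 < local_integral n (\<lambda>_. 1)"
  shows "R_mat M (X 0) z (h n) (x n) *v c = (1 / local_integral n (\<lambda>_. 1)) *\<^sub>R (mean_design n *v (Lambda_mat (h n) *v c))"
proof -
  let ?R = "R_mat M (X 0) z (h n) (x n) :: ((real, 's) vec, 's) vec"
  have "?R $ j $ s = 1 / local_integral n (\<lambda>_. 1) * (mean_design_entry n (pos j) (pos s) * h n ^ (pos s - 1))" for j s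
  proof -
    let ?K = "\<lambda>t. gfun z (pos j) t * ((h n * t) ^ (pos s - 1) / fact (pos s - 1))"
    have "?R $ j $ s = - (LINT \<omega>|window_measure M (X 0) z (h n) (x n). ?K ((X 0 \<omega> - x n) / h n))"
      using h_pos[of n] by (simp add: R_mat_def)
    also have "(LINT \<omega>|window_measure M (X 0) z (h n) (x n). ?K ((X 0 \<omega> - x n) / h n)) = local_integral n ?K / local_integral n (\<lambda>_. 1)"
      by (rule window_integral[OF _ _ assms]) (auto simp: gfun_outside)
    also have "local_integral n ?K = local_integral n (\<lambda>t. h n ^ (pos s - 1) / fact (pos s - 1) * (gfun_poly z (pos j) t * t ^ (pos s - 1)))"
      by (rule local_integral_cong) (simp add: gfun_eq_gfun_poly power_mult_distrib)
    finally show ?thesis unfolding local_integral_cmult by (simp add: mean_design_entry_def mult_ac)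
  qed
  then show ?thesis
    unfolding Lambda_mat_mult
    by (simp add: vec_eq_iff matrix_vector_mult_def mean_design_def sum_distrib_left mult_ac)
qed

lemma Lambda_mat_ker: "Lambda_mat (h n) *v (c :: (real, 's) vec) = 0 \<Longrightarrow> c = 0"
  using h_pos[of n] by (simp add: Lambda_mat_mult vec_eq_iff)

text \<open>\<open>R_mat\<close> inherits invertibility from \<open>mean_design\<close> and
  \<open>Lambda_mat\<close>. The resulting system serves twice: compared with the Taylor expansion
  it gives the bias, and it centres the scores exactly.\<close>

lemma eventually_scaled_btilde: "\<forall>\<^sub>F n in sequentially. mean_design n *v scaled_btilde n = mean_score n"
  using eventually_invertible[OF invertible_limit mean_design_tendsto] eventually_local_integral_one_pos
proof eventually_elim
  case (elim n)
  let ?R = "R_mat M (X 0) z (h n) (x n) :: ((real, 's) vec, 's) vec"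
  have "c = 0" if "?R *v c = 0" for c
  proof -
    have "mean_design n *v (Lambda_mat (h n) *v c) = 0"
      using that elim(2) by (simp add: R_mat_mult)
    then have "Lambda_mat (h n) *v c = 0"
      using elim(1) unfolding invertible_left_inverse matrix_left_invertible_ker by blast
    then show ?thesis by (rule Lambda_mat_ker)
  qed
  then have "invertible ?R"
    by (simp add: invertible_left_inverse matrix_left_invertible_ker)
  then have "?R *v btilde n = ell_vec M (X 0) z (h n) (x n)"
    by (simp add: beta_tilde_def matrix_vector_mul_assoc matrix_inv_mult)
  then show ?case
    using elim(2) by (simp add: R_mat_mult ell_vec_eq scaled_btilde_def)
qed

text \<open>Subtracting the Taylor expansion from the population system leaves
  \<open>mean_design n\<close> applied to the rescaled bias on one side. The other side tends to
  \<open>f x0\<close> times the highest derivative times column \<open>S + 1\<close>, and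
  \<open>f x0\<close> cancels against the one in the limit matrix.\<close>

lemma scaled_bias_tendsto:
  "(\<lambda>n. (1 / h n ^ CARD('s)) *\<^sub>R (scaled_btilde n - Lambda_mat (h n) *v beta n))
    \<longlonglongrightarrow> N (Suc CARD('s)) x0 *\<^sub>R b_vec z"
proof -
  let ?w = "\<lambda>n. ((\<chi> j. N (Suc CARD('s)) (x n) * mean_design_entry n (pos j) (Suc CARD('s)) - local_integral n (\<lambda>t. gfun_poly z (pos j) t * taylor_rem n t)) :: (real, 's) vec)"
  let ?lim = "(\<chi> j. N (Suc CARD('s)) x0 * (f x0 * omega z (pos j) (Suc CARD('s))) - f x0 * (LBINT t:{-z..1}. gfun_poly z (pos j) t * 0)) :: (real, 's) vec"
  have "\<forall>\<^sub>F n in sequentially. mean_design n *v ((1 / h n ^ CARD('s)) *\<^sub>R (scaled_btilde n - Lambda_mat (h n) *v beta n)) = ?w n"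
    using eventually_scaled_btilde eventually_regular
  proof eventually_elim
    case (elim n)
    have "mean_design n *v (scaled_btilde n - Lambda_mat (h n) *v beta n) = h n ^ CARD('s) *\<^sub>R ?w n"
      using elim mean_score_expansion[OF elim(2)] by (simp add: matrix_vector_mult_diff_distrib)
    then show ?case
      using h_pos[of n] by (simp add: matrix_vector_mult_scaleR)
  qed
  moreover have "?w \<longlonglongrightarrow> ?lim"
  proof (intro vec_tendstoI, unfold vec_lambda_beta)
    fix j :: 's
    have "uniform_limit {-z..1} (\<lambda>n t. gfun_poly z (pos j) t * taylor_rem n t) (\<lambda>t. gfun_poly z (pos j) t * 0) sequentially"
      by (intro uniform_lim_mult taylor_rem_uniform_limit uniform_limit_const compact_imp_bounded
          compact_continuous_image continuous_intros compact_Icc)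
    moreover have "\<forall>\<^sub>F n in sequentially. continuous_on {-z..1} (\<lambda>t. gfun_poly z (pos j) t * taylor_rem n t)"
      using eventually_regular by eventually_elim (intro continuous_intros taylor_rem_continuous)
    ultimately have "(\<lambda>n. local_integral n (\<lambda>t. gfun_poly z (pos j) t * taylor_rem n t)) \<longlonglongrightarrow> f x0 * (LBINT t:{-z..1}. gfun_poly z (pos j) t * 0)"
      by (rule local_integral_tendsto) (intro continuous_intros)
    then show "(\<lambda>n. N (Suc CARD('s)) (x n) * mean_design_entry n (pos j) (Suc CARD('s)) - local_integral n (\<lambda>t. gfun_poly z (pos j) t * taylor_rem n t))
        \<longlonglongrightarrow> N (Suc CARD('s)) x0 * (f x0 * omega z (pos j) (Suc CARD('s))) - f x0 * (LBINT t:{-z..1}. gfun_poly z (pos j) t * 0)"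
      by (intro tendsto_diff tendsto_mult mean_design_entry_tendsto tendsto_at_x[OF smooth_rad(1) smooth_rad(3)]) auto
  qed
  ultimately have "(\<lambda>n. mean_design n *v ((1 / h n ^ CARD('s)) *\<^sub>R (scaled_btilde n - Lambda_mat (h n) *v beta n))) \<longlonglongrightarrow> ?lim"
    by (subst tendsto_cong)
  from tendsto_matrix_vector_solve[OF invertible_limit mean_design_tendsto this]
  have "(\<lambda>n. (1 / h n ^ CARD('s)) *\<^sub>R (scaled_btilde n - Lambda_mat (h n) *v beta n))
      \<longlonglongrightarrow> matrix_inv (f x0 *\<^sub>R Omega_mat z) *v ?lim" .
  also have "?lim = (f x0 * N (Suc CARD('s)) x0) *\<^sub>R (\<chi> j. omega z (pos j) (Suc CARD('s)))"
    by (simp add: vec_eq_iff)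
  also have "matrix_inv (f x0 *\<^sub>R Omega_mat z) *v \<dots> = N (Suc CARD('s)) x0 *\<^sub>R b_vec z"
  proof -
    have "matrix_inv (f x0 *\<^sub>R (Omega_mat z :: ((real, 's) vec, 's) vec)) = (1 / f x0) *\<^sub>R matrix_inv (Omega_mat z)"
      using f_x0 by (intro matrix_inv_scaleR invertible_Omega_mat z) simp
    then show ?thesis
      using f_x0 by (simp add: b_vec_def matrix_vector_mult_scaleR scaleR_matrix_vector_assoc[symmetric])
  qed
  finally show ?thesis .
qed

text \<open>Nothing here is random, so the event in \<open>little_op\<close> is empty for large
  \<open>n\<close>. The derivative is taken at \<open>x n\<close>, while the limit just proved has
  it at \<open>x0\<close>; continuity bridges the two.\<close>

lemma bias:
  "little_op M
     (\<lambda>n \<omega>. Lambda_mat (h n) *v (btilde n - beta n)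
        - (h n ^ CARD('s) * N (CARD('s) + 1) (x n)) *\<^sub>R (b_vec z :: (real, 's) vec))
     (\<lambda>n. h n ^ CARD('s))"
  unfolding little_op_def
proof (intro allI impI)
  fix e :: real assume e: "0 < e"
  let ?r = "\<lambda>n. (1 / h n ^ CARD('s)) *\<^sub>R (scaled_btilde n - Lambda_mat (h n) *v beta n) - N (CARD('s) + 1) (x n) *\<^sub>R b_vec z"
  let ?d = "\<lambda>n. Lambda_mat (h n) *v (btilde n - beta n)
        - (h n ^ CARD('s) * N (CARD('s) + 1) (x n)) *\<^sub>R (b_vec z :: (real, 's) vec)"
  have "?r \<longlonglongrightarrow> N (Suc CARD('s)) x0 *\<^sub>R b_vec z - N (Suc CARD('s)) x0 *\<^sub>R b_vec z"
    using tendsto_at_x[OF smooth_rad(1) smooth_rad(3)[OF order_refl]]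
    by (intro tendsto_diff scaled_bias_tendsto tendsto_scaleR tendsto_const) simp
  then have "?r \<longlonglongrightarrow> 0" by simp
  from tendstoD[OF this e]
  have "\<forall>\<^sub>F n in sequentially. measure M {\<omega>\<in>space M. norm (?d n) > e * h n ^ CARD('s)} = 0"
  proof eventually_elim
    case (elim n)
    have "?d n = h n ^ CARD('s) *\<^sub>R ?r n"
      using h_pos[of n] by (simp add: scaled_btilde_def scaleR_diff_right matrix_vector_mult_diff_distrib)
    then have "norm (?d n) = h n ^ CARD('s) * norm (?r n)" using h_pos[of n] by simp
    also have "\<dots> \<le> e * h n ^ CARD('s)"
      using elim h_pos[of n] by (simp add: mult.commute)
    finally have "{\<omega>\<in>space M. norm (?d n) > e * h n ^ CARD('s)} = {}" by (simp add: not_less)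
    then show ?case by (metis measure_empty)
  qed
  then show "(\<lambda>n. measure M {\<omega>\<in>space M. norm (?d n) > e * h n ^ CARD('s)}) \<longlonglongrightarrow> 0"
    by (rule tendsto_eventually)
qed

text \<open>As \<open>0 ^ 0 = 1\<close>, the limit has \<open>N 1 x0\<close> as its first coordinate
  and 0 in all others. Convergence guarantees that the correction in \<open>score_kernel\<close>,
  which carries a factor \<open>h n\<close>, disappears.\<close>

lemma scaled_btilde_convergent: "scaled_btilde \<longlonglongrightarrow> (\<chi> j. 0 ^ (pos j - 1) * N (pos j) x0)"
proof -
  have "(\<lambda>n. Lambda_mat (h n) *v beta n) \<longlonglongrightarrow> (\<chi> j. 0 ^ (pos j - 1) * N (pos j) x0)"
    unfolding Lambda_mat_mult deriv_vec_def
  proof (intro vec_tendstoI, unfold vec_lambda_beta)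
    fix j :: 's
    show "(\<lambda>n. h n ^ (pos j - 1) * N (pos j) (x n)) \<longlonglongrightarrow> 0 ^ (pos j - 1) * N (pos j) x0"
      using pos_le[of j] by (intro tendsto_mult tendsto_power h_lim tendsto_at_x[OF smooth_rad(1) smooth_rad(3)]) simp
  qed
  with tendsto_scaleR[OF tendsto_power[OF h_lim] scaled_bias_tendsto]
  have "(\<lambda>n. h n ^ CARD('s) *\<^sub>R ((1 / h n ^ CARD('s)) *\<^sub>R (scaled_btilde n - Lambda_mat (h n) *v beta n)) + Lambda_mat (h n) *v beta n)
      \<longlonglongrightarrow> 0 ^ CARD('s) *\<^sub>R (N (Suc CARD('s)) x0 *\<^sub>R b_vec z) + (\<chi> j. 0 ^ (pos j - 1) * N (pos j) x0)"
    by (rule tendsto_add)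
  moreover have "h n ^ CARD('s) *\<^sub>R ((1 / h n ^ CARD('s)) *\<^sub>R (scaled_btilde n - Lambda_mat (h n) *v beta n)) + Lambda_mat (h n) *v beta n = scaled_btilde n" for n
    using h_pos[of n] by simp
  ultimately show ?thesis by (simp add: power_0_left)
qed

section \<open>The random system and its centred scores\<close>

lemma nh_at_top: "filterlim (\<lambda>n. real n * h n) at_top sequentially"
proof (rule filterlim_at_top_mono[OF nh3])
  have "\<forall>\<^sub>F n in sequentially. h n < 1" using order_tendstoD(2)[OF h_lim, of 1] by simp
  then show "\<forall>\<^sub>F n in sequentially. real n * h n ^ 3 \<le> real n * h n"
  proof eventually_elim
    case (elim n)
    have "h n ^ 3 \<le> h n ^ 1" using elim h_pos[of n] by (intro power_decreasing) auto
    then show ?case by (simp add: mult_left_mono)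
  qed
qed

lemma prob_space_obs_law: "prob_space obs_law"
  unfolding obs_law_def by (rule prob_space_distr) measurable

definition scaled_obs :: "nat \<Rightarrow> nat \<Rightarrow> 'a \<Rightarrow> real" where
  "scaled_obs n i \<omega> = (X i \<omega> - x n) / h n"

lemma scaled_obs_measurable [measurable]: "scaled_obs n i \<in> borel_measurable M"
  unfolding scaled_obs_def by measurable

text \<open>The residual of the system at \<open>beta_tilde\<close>, left side minus right side, is
  \<open>1 / (n h^2)\<close> times the sum of these kernels over the scaled observations.\<close>

definition score_kernel :: "nat \<Rightarrow> 's \<Rightarrow> real \<Rightarrow> real" where
  "score_kernel n j t = gder z (pos j) t + h n * (\<Sum>s\<in>UNIV. gfun z (pos j) t * t ^ (pos s - 1) / fact (pos s - 1) * scaled_btilde n $ s)"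

definition score_poly :: "nat \<Rightarrow> 's \<Rightarrow> real \<Rightarrow> real" where
  "score_poly n j t = gder_poly z (pos j) t + h n * (\<Sum>s\<in>UNIV. gfun_poly z (pos j) t * t ^ (pos s - 1) / fact (pos s - 1) * scaled_btilde n $ s)"

lemma score_kernel_measurable [measurable]: "score_kernel n j \<in> borel_measurable borel"
  unfolding score_kernel_def by measurable

lemma score_kernel_eq_score_poly: "- z < t \<Longrightarrow> t < 1 \<Longrightarrow> score_kernel n j t = score_poly n j t"
  by (simp add: score_kernel_def score_poly_def gder_eq_gder_poly gfun_eq_gfun_poly)

lemma score_kernel_outside: "\<not> (- z < t \<and> t < 1) \<Longrightarrow> score_kernel n j t = 0"
proof -
  assume t: "\<not> (- z < t \<and> t < 1)"
  then have "gfun z (pos j) t = 0"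
    by (cases "t = - z \<or> t = 1") (auto simp: gfun_def)
  then show ?thesis using t by (simp add: score_kernel_def gder_outside)
qed

definition score_vec :: "nat \<Rightarrow> 'a \<Rightarrow> (real, 's) vec" where
  "score_vec n \<omega> = (\<chi> j. 1 / sqrt (real n * h n) * (\<Sum>i<n. score_kernel n j (scaled_obs n i \<omega>)))"

definition design_mat :: "nat \<Rightarrow> 'a \<Rightarrow> ((real, 's) vec, 's) vec" where
  "design_mat n \<omega> = (\<chi> j s. - (1 / (real n * h n)) * (\<Sum>i<n. gfun z (pos j) (scaled_obs n i \<omega>) *
      scaled_obs n i \<omega> ^ (pos s - 1) / fact (pos s - 1)))"

lemma score_vec_measurable [measurable]: "score_vec n \<in> borel_measurable M"
  unfolding score_vec_def by measurable

lemma design_mat_measurable [measurable]: "design_mat n \<in> borel_measurable M"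
  unfolding design_mat_def by measurable

text \<open>An invertible design matrix makes the solution unique, so \<open>beta_hat\<close> solves
  the system. Subtracting the design matrix applied to \<open>scaled_btilde n\<close> leaves the
  residual at \<open>beta_tilde\<close>, and \<open>sqrt (n h^3)\<close> turns its factor
  \<open>1 / (n h^2)\<close> into \<open>1 / sqrt (n h)\<close>.\<close>

lemma solution:
  assumes n: "0 < n" and \<omega>: "\<omega> \<in> space M" and inv: "invertible (design_mat n \<omega>)"
  shows "design_mat n \<omega> *v (sqrt (real n * h n ^ 3) *\<^sub>R (Lambda_mat (h n) *v (beta_hat n \<omega> - btilde n))) = score_vec n \<omega>"
proof -
  let ?a = "(\<chi> j. 1 / (real n * (h n)\<^sup>2) * (\<Sum>i<n. gder z (pos j) (scaled_obs n i \<omega>))) :: (real, 's) vec"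
  let ?L = "Lambda_mat (h n) :: ((real, 's) vec, 's) vec"
  have iff: "solves_system z n (h n) (x n) (\<lambda>i. X i \<omega>) c \<longleftrightarrow> design_mat n \<omega> *v (?L *v c) = ?a" for c
    unfolding solves_system_iff[OF h_pos] design_mat_def scaled_obs_def ..
  have L: "invertible ?L"
    using Lambda_mat_ker by (auto simp: invertible_left_inverse matrix_left_invertible_ker)
  have "\<exists>!c :: (real, 's) vec. solves_system z n (h n) (x n) (\<lambda>i. X i \<omega>) c"
    unfolding iff
  proof (intro ex1I)
    have L': "?L *v (matrix_inv ?L *v w) = w" for w
      by (simp add: matrix_vector_mul_assoc matrix_inv_mult[OF L])
    show "design_mat n \<omega> *v (?L *v (matrix_inv ?L *v (matrix_inv (design_mat n \<omega>) *v ?a))) = ?a"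
      unfolding L' by (simp add: matrix_vector_mul_assoc matrix_inv_mult[OF inv])
    fix c assume c: "design_mat n \<omega> *v (?L *v c) = ?a"
    have "matrix_inv (design_mat n \<omega>) *v ?a = ?L *v c"
      unfolding c[symmetric] matrix_vector_mul_assoc[of "matrix_inv (design_mat n \<omega>)"] by (simp add: matrix_inv_mult[OF inv])
    then show "c = matrix_inv ?L *v (matrix_inv (design_mat n \<omega>) *v ?a)"
      by (simp add: matrix_vector_mul_assoc matrix_inv_mult[OF L])
  qed
  from beta_hat[OF \<omega> this] have bh: "design_mat n \<omega> *v (?L *v beta_hat n \<omega>) = ?a" by (simp add: iff)
  have nh: "0 < real n * h n" using n h_pos[of n] by simp
  have s1: "sqrt (real n * h n ^ 3) / (real n * (h n)\<^sup>2) = 1 / sqrt (real n * h n)"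
  proof -
    define r where "r = sqrt (real n * h n)"
    have r: "0 < r" "r * r = real n * h n" using nh by (simp_all add: r_def)
    have "sqrt (real n * h n ^ 3) = h n * r"
      using h_pos[of n] by (simp add: r_def real_sqrt_mult eval_nat_numeral)
    moreover have "real n * (h n)\<^sup>2 = h n * (r * r)"
      unfolding r(2) by (simp add: power2_eq_square)
    ultimately show ?thesis using r(1) h_pos[of n] by (simp add: r_def[symmetric])
  qed
  have "design_mat n \<omega> *v (?L *v (beta_hat n \<omega> - btilde n)) = ?a - design_mat n \<omega> *v scaled_btilde n"
    by (simp add: matrix_vector_mult_diff_distrib bh scaled_btilde_def)
  moreover have "sqrt (real n * h n ^ 3) * (?a - design_mat n \<omega> *v scaled_btilde n) $ j = score_vec n \<omega> $ j" for j
  proof -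
    let ?G = "\<lambda>i s. gfun z (pos j) (scaled_obs n i \<omega>) * scaled_obs n i \<omega> ^ (pos s - 1) / fact (pos s - 1)"
    have "(design_mat n \<omega> *v scaled_btilde n) $ j = - (1 / (real n * h n)) * (\<Sum>s\<in>UNIV. \<Sum>i<n. ?G i s * scaled_btilde n $ s)"
      by (simp add: matrix_vector_mult_def design_mat_def sum_distrib_left sum_distrib_right sum_negf mult.assoc)
    also have "(\<Sum>s\<in>UNIV. \<Sum>i<n. ?G i s * scaled_btilde n $ s) = (\<Sum>i<n. \<Sum>s\<in>UNIV. ?G i s * scaled_btilde n $ s)"
      by (rule sum.swap)
    also have "- (1 / (real n * h n)) * \<dots> = - (1 / (real n * (h n)\<^sup>2)) * (\<Sum>i<n. h n * (\<Sum>s\<in>UNIV. ?G i s * scaled_btilde n $ s))"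
      using h_pos[of n] n by (simp add: sum_distrib_left[symmetric] power2_eq_square)
    finally have "(?a - design_mat n \<omega> *v scaled_btilde n) $ j = 1 / (real n * (h n)\<^sup>2) * (\<Sum>i<n. score_kernel n j (scaled_obs n i \<omega>))"
      by (simp add: score_kernel_def sum.distrib distrib_left add_divide_distrib)
    then have "sqrt (real n * h n ^ 3) * (?a - design_mat n \<omega> *v scaled_btilde n) $ j =
        sqrt (real n * h n ^ 3) / (real n * (h n)\<^sup>2) * (\<Sum>i<n. score_kernel n j (scaled_obs n i \<omega>))" by simp
    then show ?thesis unfolding s1 by (simp add: score_vec_def)
  qed
  ultimately show ?thesis
    by (simp add: matrix_vector_mult_scaleR vec_eq_iff)
qed

lemma kernel_bounded:
  assumes "continuous_on {-z..1} K"
  obtains C where "0 \<le> C" "\<And>t. - z \<le> t \<Longrightarrow> t \<le> 1 \<Longrightarrow> \<bar>K t :: real\<bar> \<le> C"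
proof -
  have "bounded (K ` {-z..1})"
    by (intro compact_imp_bounded compact_continuous_image assms compact_Icc)
  then obtain C where C: "0 < C" "\<And>v. v \<in> K ` {-z..1} \<Longrightarrow> norm v \<le> C"
    unfolding bounded_pos by blast
  show ?thesis by (rule that[of C]) (use C in \<open>auto intro: less_imp_le\<close>)
qed

text \<open>Each entry is an average with mean \<open>mean_design_entry\<close> and variance of
  order \<open>1 / (n h)\<close>. Half of \<open>e\<close> is spent on the deterministic convergence
  of the mean, the other half on Chebyshev's inequality.\<close>

lemma design_mat_tendsto:
  assumes e: "0 < e"
  shows "(\<lambda>n. prob {\<omega>\<in>space M. e \<le> norm (design_mat n \<omega> - f x0 *\<^sub>R Omega_mat z)}) \<longlonglongrightarrow> 0"
proof (rule matrix_conv_in_probability[OF design_mat_measurable _ e])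
  fix j s :: 's and e :: real assume e: "0 < e"
  define Kg where "Kg t = gfun z (pos j) t * t ^ (pos s - 1) / fact (pos s - 1)" for t
  define Kq where "Kq t = gfun_poly z (pos j) t * t ^ (pos s - 1) / fact (pos s - 1)" for t
  have [measurable]: "Kg \<in> borel_measurable borel" unfolding Kg_def by measurable
  have Kg0: "Kg t = 0" if "\<not> (- z \<le> t \<and> t \<le> 1)" for t using gfun_outside[OF that] by (simp add: Kg_def)
  have Kgq: "Kg t = Kq t" if "- z \<le> t" "t \<le> 1" for t using gfun_eq_gfun_poly[OF that] by (simp add: Kg_def Kq_def)
  have contKq: "continuous_on {-z..1} Kq" unfolding Kq_def by (intro continuous_intros) auto
  obtain c where c: "0 \<le> c" "\<And>t. - z \<le> t \<Longrightarrow> t \<le> 1 \<Longrightarrow> \<bar>Kq t\<bar> \<le> c"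
    by (rule kernel_bounded[OF contKq]) blast
  have Kgc: "\<bar>Kg t\<bar> \<le> c" for t
    using c Kg0[of t] Kgq[of t] by (cases "- z \<le> t \<and> t \<le> 1") auto
  define m where "m n = h n * local_integral n Kg" for n
  \<comment> \<open>Centred and normalized so that the sum over the sample is the deviation of a
    design entry from its mean.\<close>
  define G where "G n y = - (1 / (real n * h n)) * (Kg ((y - x n) / h n) - m n)" for n y
  have Gm[measurable]: "G n \<in> borel_measurable borel" for n unfolding G_def by measurable
  interpret PD: prob_space obs_law by (rule prob_space_obs_law)
  have [measurable_cong]: "sets obs_law = sets borel" by (simp add: obs_law_def)
  have int: "integrable obs_law (\<lambda>y. Kg ((y - x n) / h n))" "integrable obs_law (\<lambda>y. (Kg ((y - x n) / h n))\<^sup>2)" for n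
  proof -
    show "integrable obs_law (\<lambda>y. Kg ((y - x n) / h n))"
      by (rule PD.integrable_const_bound[of _ c]) (use Kgc in auto)
    have "(Kg t)\<^sup>2 \<le> c\<^sup>2" for t using Kgc[of t] c(1) by (metis abs_le_square_iff abs_of_nonneg)
    then show "integrable obs_law (\<lambda>y. (Kg ((y - x n) / h n))\<^sup>2)"
      by (intro PD.integrable_const_bound[of _ "c\<^sup>2"]) auto
  qed
  have EK: "(LINT y|obs_law. Kg ((y - x n) / h n)) = m n" for n
    unfolding m_def by (rule integral_obs_law_kernel) (use Kg0 in auto)
  have EK2: "(LINT y|obs_law. (Kg ((y - x n) / h n))\<^sup>2) = h n * local_integral n (\<lambda>t. (Kq t)\<^sup>2)" for n
  proof -
    have "(LINT y|obs_law. (Kg ((y - x n) / h n))\<^sup>2) = h n * local_integral n (\<lambda>t. (Kg t)\<^sup>2)"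
      by (rule integral_obs_law_kernel) (use Kg0 in auto)
    also have "local_integral n (\<lambda>t. (Kg t)\<^sup>2) = local_integral n (\<lambda>t. (Kq t)\<^sup>2)" by (rule local_integral_cong) (simp add: Kgq)
    finally show ?thesis .
  qed
  have mean: "(LINT y|obs_law. G n y) = 0" for n
    using int EK[of n] by (simp add: G_def PD.prob_space)
  have Gbd: "\<bar>G n y\<bar> \<le> 1 / (real n * h n) * (c + \<bar>m n\<bar>)" for n y
  proof -
    have "\<bar>Kg ((y - x n) / h n) - m n\<bar> \<le> c + \<bar>m n\<bar>"
      using Kgc[of "(y - x n) / h n"] by linarith
    then show ?thesis
      using h_pos[of n] by (simp add: G_def abs_mult divide_right_mono)
  qed
  have second: "(LINT y|obs_law. (G n y)\<^sup>2) \<le> (1 / (real n * h n))\<^sup>2 * (h n * local_integral n (\<lambda>t. (Kq t)\<^sup>2))" for n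
  proof -
    have eq: "(LINT y|obs_law. (Kg ((y - x n) / h n) - m n)\<^sup>2) = (LINT y|obs_law. (Kg ((y - x n) / h n))\<^sup>2) - (m n)\<^sup>2"
      using PD.variance_eq[OF int(1)[of n] int(2)[of n]] by (simp add: EK)
    have "(LINT y|obs_law. (G n y)\<^sup>2) = (1 / (real n * h n))\<^sup>2 * (LINT y|obs_law. (Kg ((y - x n) / h n) - m n)\<^sup>2)"
      by (simp add: G_def power_mult_distrib power_divide)
    also have "\<dots> \<le> (1 / (real n * h n))\<^sup>2 * (LINT y|obs_law. (Kg ((y - x n) / h n))\<^sup>2)"
      unfolding eq by (intro mult_left_mono) auto
    finally show ?thesis unfolding EK2 .
  qed
  have sumG: "(\<Sum>i<n. G n (X i \<omega>)) = design_mat n \<omega> $ j $ s - mean_design_entry n (pos j) (pos s)" if "0 < n" for n \<omega>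
  proof -
    have "local_integral n Kg = local_integral n (\<lambda>t. 1 / fact (pos s - 1) * (gfun_poly z (pos j) t * t ^ (pos s - 1)))"
      by (rule local_integral_cong) (simp add: Kgq Kq_def)
    then have m: "m n = - (h n * mean_design_entry n (pos j) (pos s))" unfolding m_def local_integral_cmult by (simp add: mean_design_entry_def)
    have "(\<Sum>i<n. G n (X i \<omega>)) = - (1 / (real n * h n)) * ((\<Sum>i<n. Kg (scaled_obs n i \<omega>)) - real n * m n)"
      by (simp only: G_def scaled_obs_def sum_distrib_left[symmetric] sum_subtractf sum_constant card_lessThan)
    also have "\<dots> = - (1 / (real n * h n)) * (\<Sum>i<n. Kg (scaled_obs n i \<omega>)) - mean_design_entry n (pos j) (pos s)"
      using that h_pos[of n] by (simp add: m field_simps)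
    finally show ?thesis by (simp only: design_mat_def Kg_def vec_lambda_beta)
  qed
  have bnd: "\<forall>\<^sub>F n in sequentially. prob {\<omega>\<in>space M. e < \<bar>design_mat n \<omega> $ j $ s - (f x0 *\<^sub>R Omega_mat z :: ((real, 's) vec, 's) vec) $ j $ s\<bar>}
      \<le> local_integral n (\<lambda>t. (Kq t)\<^sup>2) / (real n * h n) / (e / 2)\<^sup>2"
  proof -
    have "\<forall>\<^sub>F n in sequentially. \<bar>mean_design_entry n (pos j) (pos s) - f x0 * omega z (pos j) (pos s)\<bar> < e / 2"
      using tendstoD[OF mean_design_entry_tendsto, of "e / 2"] e by (simp add: dist_real_def)
    then show ?thesis
      using eventually_gt_at_top[of 0]
    proof eventually_elim
      case (elim n)
      have "{\<omega>\<in>space M. e < \<bar>design_mat n \<omega> $ j $ s - (f x0 *\<^sub>R Omega_mat z :: ((real, 's) vec, 's) vec) $ j $ s\<bar>}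
          \<subseteq> {\<omega>\<in>space M. e / 2 < \<bar>\<Sum>i<n. G n (X i \<omega>)\<bar>}"
      proof
        fix \<omega> assume "\<omega> \<in> {\<omega>\<in>space M. e < \<bar>design_mat n \<omega> $ j $ s - (f x0 *\<^sub>R Omega_mat z :: ((real, 's) vec, 's) vec) $ j $ s\<bar>}"
        then have "\<omega> \<in> space M" "e < \<bar>design_mat n \<omega> $ j $ s - f x0 * omega z (pos j) (pos s)\<bar>"
          by (auto simp: Omega_mat_def)
        with elim(1) have "e / 2 < \<bar>design_mat n \<omega> $ j $ s - mean_design_entry n (pos j) (pos s)\<bar>" by linarith
        with \<open>\<omega> \<in> space M\<close> show "\<omega> \<in> {\<omega>\<in>space M. e / 2 < \<bar>\<Sum>i<n. G n (X i \<omega>)\<bar>}"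
          by (simp add: sumG[OF elim(2)])
      qed
      then have "prob {\<omega>\<in>space M. e < \<bar>design_mat n \<omega> $ j $ s - (f x0 *\<^sub>R Omega_mat z :: ((real, 's) vec, 's) vec) $ j $ s\<bar>}
          \<le> prob {\<omega>\<in>space M. e / 2 < \<bar>\<Sum>i<n. G n (X i \<omega>)\<bar>}"
        by (rule finite_measure_mono) measurable
      also have "\<dots> \<le> real n * (LINT y|obs_law. (G n y)\<^sup>2) / (e / 2)\<^sup>2"
        by (rule sum_chebyshev[OF indep distr_X Gm Gbd mean]) (use e in simp)
      also have "\<dots> \<le> real n * ((1 / (real n * h n))\<^sup>2 * (h n * local_integral n (\<lambda>t. (Kq t)\<^sup>2))) / (e / 2)\<^sup>2"
        using second[of n] by (intro divide_right_mono mult_left_mono) auto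
      also have "real n * ((1 / (real n * h n))\<^sup>2 * (h n * local_integral n (\<lambda>t. (Kq t)\<^sup>2))) = local_integral n (\<lambda>t. (Kq t)\<^sup>2) / (real n * h n)"
        using elim(2) h_pos[of n] by (simp add: power2_eq_square)
      finally show ?case .
    qed
  qed
  have "(\<lambda>n. local_integral n (\<lambda>t. (Kq t)\<^sup>2)) \<longlonglongrightarrow> f x0 * (LBINT t:{-z..1}. (Kq t)\<^sup>2)"
    by (intro local_integral_tendsto_const continuous_intros contKq)
  then have "(\<lambda>n. local_integral n (\<lambda>t. (Kq t)\<^sup>2) / (real n * h n)) \<longlonglongrightarrow> 0"
    by (rule real_tendsto_divide_at_top[OF _ nh_at_top])
  then have "(\<lambda>n. local_integral n (\<lambda>t. (Kq t)\<^sup>2) / (real n * h n) / (e / 2)\<^sup>2) \<longlonglongrightarrow> 0 / (e / 2)\<^sup>2"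
    using e by (intro tendsto_divide tendsto_const) auto
  then show "(\<lambda>n. prob {\<omega>\<in>space M. e < \<bar>design_mat n \<omega> $ j $ s - (f x0 *\<^sub>R Omega_mat z :: ((real, 's) vec, 's) vec) $ j $ s\<bar>}) \<longlonglongrightarrow> 0"
    by (intro tendsto_sandwich[OF _ bnd tendsto_const]) auto
qed

text \<open>The Cramer--Wold reduction: a linear functional of \<open>score_vec\<close> is a sum of
  this function over the observations, so a limit theorem for scalar triangular arrays is
  enough.\<close>

definition score_fn :: "(real, 's) vec \<Rightarrow> nat \<Rightarrow> real \<Rightarrow> real" where
  "score_fn a n y = 1 / sqrt (real n * h n) * (\<Sum>j\<in>UNIV. a $ j * score_kernel n j ((y - x n) / h n))"

lemma score_fn_measurable [measurable]: "score_fn a n \<in> borel_measurable borel"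
  unfolding score_fn_def by measurable

lemma inner_score_vec: "a \<bullet> score_vec n \<omega> = (\<Sum>i<n. score_fn a n (X i \<omega>))"
proof -
  have "a \<bullet> score_vec n \<omega> = 1 / sqrt (real n * h n) * (\<Sum>j\<in>UNIV. \<Sum>i<n. a $ j * score_kernel n j (scaled_obs n i \<omega>))"
    by (simp add: inner_vec_def score_vec_def sum_distrib_left mult_ac)
  also have "(\<Sum>j\<in>UNIV. \<Sum>i<n. a $ j * score_kernel n j (scaled_obs n i \<omega>)) = (\<Sum>i<n. \<Sum>j\<in>UNIV. a $ j * score_kernel n j (scaled_obs n i \<omega>))"
    by (rule sum.swap)
  finally show ?thesis by (simp add: score_fn_def scaled_obs_def sum_distrib_left)
qed

lemma continuous_score_poly: "continuous_on A' (score_poly n j)"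
  unfolding score_poly_def by (intro continuous_intros) auto

text \<open>The correction carries \<open>h n\<close> times a convergent vector and dies out
  uniformly; this is why the limit covariance contains the kernel derivatives alone.\<close>

lemma score_poly_uniform_limit:
  "uniform_limit {-z..1} (\<lambda>n t. \<Sum>j\<in>UNIV. a $ j * score_poly n j t) (\<lambda>t. \<Sum>j\<in>UNIV. a $ j * gder_poly z (pos j) t) sequentially"
proof -
  let ?F = "\<lambda>j s t. gfun_poly z (pos j) t * t ^ (pos s - 1) / fact (pos s - 1)"
  obtain l where l: "scaled_btilde \<longlonglongrightarrow> l" using scaled_btilde_convergent by blast
  have bdd: "bounded (G ` {-z..1})" if "continuous_on {-z..1} G" for G :: "real \<Rightarrow> real"
    by (intro compact_imp_bounded compact_continuous_image that compact_Icc)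
  have bc: "bounded ((\<lambda>_. c) ` {-z..1})" for c :: real by (intro bdd continuous_intros)
  have "uniform_limit {-z..1} (\<lambda>n t. \<Sum>j\<in>UNIV. a $ j * (gder_poly z (pos j) t + h n * (\<Sum>s\<in>UNIV. ?F j s t * scaled_btilde n $ s)))
      (\<lambda>t. \<Sum>j\<in>UNIV. a $ j * (gder_poly z (pos j) t + 0 * (\<Sum>s\<in>UNIV. ?F j s t * l $ s))) sequentially"
    by (intro uniform_limit_sum uniform_lim_mult uniform_limit_add uniform_limit_const
        uniform_limit_of_tendsto h_lim tendsto_vec_nth l bdd continuous_intros bc) auto
  then show ?thesis by (simp add: score_poly_def)
qed

text \<open>The three inputs of \<open>triangular_clt_char\<close>. The bound is of order
  \<open>1 / sqrt (n h)\<close>, the mean vanishes by the choice of \<open>beta_tilde\<close>, and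
  in the variance \<open>n\<close>, the norming \<open>1 / (n h)\<close> and the \<open>h\<close>
  from the substitution cancel.\<close>

lemma
  fixes a :: "(real, 's) vec"
  shows score_fn_bounded: "\<exists>C. \<forall>\<^sub>F n in sequentially. \<forall>y. \<bar>score_fn a n y\<bar> \<le> C / sqrt (real n * h n)"
    and score_fn_mean: "\<forall>\<^sub>F n in sequentially. (LINT y|obs_law. score_fn a n y) = 0"
    and score_fn_variance: "(\<lambda>n. real n * (LINT y|obs_law. (score_fn a n y)\<^sup>2)) \<longlonglongrightarrow> a \<bullet> ((f x0 *\<^sub>R V_mat z) *v a)"
proof -
  let ?score_kernel = "\<lambda>n t. \<Sum>j\<in>UNIV. a $ j * score_kernel n j t"
  let ?score_poly = "\<lambda>n t. \<Sum>j\<in>UNIV. a $ j * score_poly n j t"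
  let ?k0 = "\<lambda>t. \<Sum>j\<in>UNIV. a $ j * gder_poly z (pos j) t"
  have cont0: "continuous_on {-z..1} ?k0" by (intro continuous_intros)
  have contq: "continuous_on {-z..1} (?score_poly n)" for n by (intro continuous_intros continuous_score_poly)
  have supp: "?score_kernel n t = 0" if "\<not> (- z < t \<and> t < 1)" for n t using score_kernel_outside[OF that] by simp
  have gq: "?score_kernel n t = ?score_poly n t" if "- z < t" "t < 1" for n t using score_kernel_eq_score_poly[OF that] by simp
  show "\<exists>C. \<forall>\<^sub>F n in sequentially. \<forall>y. \<bar>score_fn a n y\<bar> \<le> C / sqrt (real n * h n)"
  proof -
    obtain C where C: "0 \<le> C" "\<And>t. - z \<le> t \<Longrightarrow> t \<le> 1 \<Longrightarrow> \<bar>?k0 t\<bar> \<le> C"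
      by (rule kernel_bounded[OF cont0]) blast
    have "\<forall>\<^sub>F n in sequentially. \<forall>t\<in>{-z..1}. dist (?score_poly n t) (?k0 t) < 1"
      by (rule uniform_limitD[OF score_poly_uniform_limit]) simp
    then have "\<forall>\<^sub>F n in sequentially. \<forall>y. \<bar>score_fn a n y\<bar> \<le> (C + 1) / sqrt (real n * h n)"
    proof eventually_elim
      case (elim n)
      have "\<bar>?score_kernel n t\<bar> \<le> C + 1" for t
      proof (cases "- z < t \<and> t < 1")
        case True
        then have "\<bar>?score_poly n t - ?k0 t\<bar> < 1" using bspec[OF elim, of t] by (simp add: dist_real_def)
        with C(2)[of t] True show ?thesis unfolding gq[OF conjunct1[OF True] conjunct2[OF True]] by linarith
      next
        case False
        then show ?thesis using C(1) supp[OF False] by simp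
      qed
      then show ?case
        using h_pos[of n] by (simp add: score_fn_def abs_mult divide_right_mono)
    qed
    then show ?thesis by blast
  qed
  show "\<forall>\<^sub>F n in sequentially. (LINT y|obs_law. score_fn a n y) = 0"
    using eventually_scaled_btilde eventually_regular
  proof eventually_elim
    case (elim n)
    \<comment> \<open>The local integral is \<open>h n\<close> times a component of
      \<open>mean_score n - mean_design n *v scaled_btilde n\<close>, which is 0 by the population
      system.\<close>
    have comp: "local_integral n (score_poly n j) = 0" for j
    proof -
      let ?F = "\<lambda>s t. gfun_poly z (pos j) t * t ^ (pos s - 1)"
      have eq: "score_poly n j = (\<lambda>t. gder_poly z (pos j) t + h n * (\<Sum>s\<in>UNIV. (scaled_btilde n $ s / fact (pos s - 1)) * ?F s t))"
        by (simp add: score_poly_def fun_eq_iff mult_ac)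
      have "local_integral n (score_poly n j) = local_integral n (gder_poly z (pos j)) + h n * (\<Sum>s\<in>UNIV. (scaled_btilde n $ s / fact (pos s - 1)) * local_integral n (?F s))"
        unfolding eq
        by (subst local_integral_add[OF elim(2)], intro continuous_intros, intro continuous_intros)
          (subst local_integral_cmult, subst local_integral_sum[OF elim(2) finite], intro continuous_intros, rule refl)
      also have "(\<Sum>s\<in>UNIV. (scaled_btilde n $ s / fact (pos s - 1)) * local_integral n (?F s)) = - (mean_design n *v scaled_btilde n) $ j"
        by (simp add: matrix_vector_mult_def mean_design_def mean_design_entry_def sum_negf mult_ac)
      also have "local_integral n (gder_poly z (pos j)) = h n * (mean_score n $ j)"
        using h_pos[of n] by (simp add: mean_score_def)
      finally show ?thesis by (simp add: elim(1))
    qed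
    have "(LINT y|obs_law. score_fn a n y) = 1 / sqrt (real n * h n) * (LINT y|obs_law. ?score_kernel n ((y - x n) / h n))"
      by (simp add: score_fn_def)
    also have "(LINT y|obs_law. ?score_kernel n ((y - x n) / h n)) = h n * local_integral n (?score_kernel n)"
      by (rule integral_obs_law_kernel) (measurable, rule supp, auto)
    also have "local_integral n (?score_kernel n) = local_integral n (?score_poly n)" by (rule local_integral_cong) (rule gq)
    also have "\<dots> = 0" by (subst local_integral_sum[OF elim(2)]) (auto intro: continuous_score_poly simp: comp)
    finally show ?case by simp
  qed
  show "(\<lambda>n. real n * (LINT y|obs_law. (score_fn a n y)\<^sup>2)) \<longlonglongrightarrow> a \<bullet> ((f x0 *\<^sub>R V_mat z) *v a)"
  proof -
    have "bounded (?k0 ` {-z..1})"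
      by (intro compact_imp_bounded compact_continuous_image cont0 compact_Icc)
    then have "uniform_limit {-z..1} (\<lambda>n t. ?score_poly n t * ?score_poly n t) (\<lambda>t. ?k0 t * ?k0 t) sequentially"
      by (intro uniform_lim_mult score_poly_uniform_limit)
    then have "(\<lambda>n. local_integral n (\<lambda>t. ?score_poly n t * ?score_poly n t)) \<longlonglongrightarrow> f x0 * (LBINT t:{-z..1}. ?k0 t * ?k0 t)"
      by (rule local_integral_tendsto) (intro always_eventually allI continuous_intros contq cont0)+
    also have "f x0 * (LBINT t:{-z..1}. ?k0 t * ?k0 t) = a \<bullet> ((f x0 *\<^sub>R V_mat z) *v a)"
      by (simp add: scaleR_matrix_vector_assoc[symmetric] V_mat_quadratic power2_eq_square)
    finally have lim: "(\<lambda>n. local_integral n (\<lambda>t. ?score_poly n t * ?score_poly n t)) \<longlonglongrightarrow> a \<bullet> ((f x0 *\<^sub>R V_mat z) *v a)" .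
    have "\<forall>\<^sub>F n in sequentially. local_integral n (\<lambda>t. ?score_poly n t * ?score_poly n t) = real n * (LINT y|obs_law. (score_fn a n y)\<^sup>2)"
      using eventually_gt_at_top[of 0]
    proof eventually_elim
      case (elim n)
      have "(LINT y|obs_law. (score_fn a n y)\<^sup>2) = 1 / (real n * h n) * (LINT y|obs_law. ?score_kernel n ((y - x n) / h n) * ?score_kernel n ((y - x n) / h n))"
        using h_pos[of n] by (simp add: score_fn_def power_mult_distrib power_divide) (simp add: power2_eq_square)
      also have "(LINT y|obs_law. ?score_kernel n ((y - x n) / h n) * ?score_kernel n ((y - x n) / h n)) = h n * local_integral n (\<lambda>t. ?score_kernel n t * ?score_kernel n t)"
        by (rule integral_obs_law_kernel) (measurable, subst supp, auto)
      also have "local_integral n (\<lambda>t. ?score_kernel n t * ?score_kernel n t) = local_integral n (\<lambda>t. ?score_poly n t * ?score_poly n t)" by (rule local_integral_cong) (simp only: gq)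
      finally show ?case using elim h_pos[of n] by simp
    qed
    with lim show ?thesis by (rule Lim_transform_eventually)
  qed
qed

lemma score_vec_char:
  "(\<lambda>n. CLINT \<omega>|M. iexp (a \<bullet> score_vec n \<omega>)) \<longlonglongrightarrow> complex_of_real (exp (- (a \<bullet> ((f x0 *\<^sub>R V_mat z) *v a)) / 2))"
proof -
  obtain C where C: "\<forall>\<^sub>F n in sequentially. \<forall>y. \<bar>score_fn a n y\<bar> \<le> C / sqrt (real n * h n)"
    using score_fn_bounded by blast
  have "(\<lambda>n. C / sqrt (real n * h n)) \<longlonglongrightarrow> 0"
    by (intro real_tendsto_divide_at_top[OF tendsto_const] filterlim_compose[OF sqrt_at_top nh_at_top])
  from triangular_clt_char[OF indep distr_X score_fn_measurable C this score_fn_mean score_fn_variance]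
  show ?thesis unfolding inner_score_vec .
qed

lemma score_vec_tight:
  assumes "0 < e"
  shows "\<exists>R. \<forall>\<^sub>F n in sequentially. prob {\<omega>\<in>space M. R < norm (score_vec n \<omega>)} < e"
proof (rule tight_cart[OF score_vec_measurable _ assms])
  fix j :: 's and e :: real assume e: "0 < e"
  let ?a = "axis j 1 :: (real, 's) vec"
  let ?v = "?a \<bullet> ((f x0 *\<^sub>R V_mat z) *v ?a)"
  obtain C where C: "\<forall>\<^sub>F n in sequentially. \<forall>y. \<bar>score_fn ?a n y\<bar> \<le> C / sqrt (real n * h n)"
    using score_fn_bounded by blast
  \<comment> \<open>\<open>\<bar>?v\<bar> + 1\<close> eventually exceeds the second moment, and the
    final \<open>+ 1\<close> makes \<open>R\<close> positive and the Chebyshev bound strictly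
    smaller than \<open>e\<close>.\<close>
  define R where "R = sqrt ((\<bar>?v\<bar> + 1) / e) + 1"
  have R: "0 < R" using e by (simp add: R_def add_nonneg_pos)
  have "(sqrt ((\<bar>?v\<bar> + 1) / e))\<^sup>2 < R\<^sup>2"
    unfolding R_def using e by (intro power_strict_mono) auto
  then have R2: "(\<bar>?v\<bar> + 1) / R\<^sup>2 < e"
    using e R by (simp add: field_simps)
  have "\<forall>\<^sub>F n in sequentially. real n * (LINT y|obs_law. (score_fn ?a n y)\<^sup>2) < \<bar>?v\<bar> + 1"
    by (rule order_tendstoD(2)[OF score_fn_variance]) simp
  with C score_fn_mean[of ?a] have "\<forall>\<^sub>F n in sequentially. prob {\<omega>\<in>space M. R < \<bar>score_vec n \<omega> $ j\<bar>} < e"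
  proof eventually_elim
    case (elim n)
    have "score_vec n \<omega> $ j = (\<Sum>i<n. score_fn ?a n (X i \<omega>))" for \<omega>
      by (simp add: inner_score_vec[symmetric] inner_axis')
    then have "prob {\<omega>\<in>space M. R < \<bar>score_vec n \<omega> $ j\<bar>} \<le> real n * (LINT y|obs_law. (score_fn ?a n y)\<^sup>2) / R\<^sup>2"
      using sum_chebyshev[OF indep distr_X score_fn_measurable _ elim(2) R, of "C / sqrt (real n * h n)" n] elim(1) by simp
    also have "\<dots> \<le> (\<bar>?v\<bar> + 1) / R\<^sup>2" using elim(3) by (intro divide_right_mono) auto
    finally show ?case using R2 by linarith
  qed
  then show "\<exists>R. \<forall>\<^sub>F n in sequentially. prob {\<omega>\<in>space M. R < \<bar>score_vec n \<omega> $ j\<bar>} < e" by blast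
qed

text \<open>The scaled error is close in probability to \<open>?C\<close> applied to
  \<open>score_vec\<close>, whose limit law has covariance \<open>f x0 *\<^sub>R V_mat z\<close>.
  \<open>sandwich_covariance\<close> recognizes the covariance of the image and supplies the
  definiteness that the density of the limit law requires.\<close>

lemma normality:
  "conv_in_distribution M
     (\<lambda>n \<omega>. sqrt (real n * h n ^ 3) *\<^sub>R (Lambda_mat (h n) *v (beta_hat n \<omega> - btilde n)))
     (mvnormal 0 ((1 / f x0) *\<^sub>R
        matrix_inv (transpose (Omega_mat z) ** matrix_inv (V_mat z) ** (Omega_mat z :: ((real, 's) vec, 's) vec))))"
proof -
  let ?\<Sigma> = "(1 / f x0) *\<^sub>R
        matrix_inv (transpose (Omega_mat z) ** matrix_inv (V_mat z) ** (Omega_mat z :: ((real, 's) vec, 's) vec))"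
  let ?Z = "\<lambda>n \<omega>. sqrt (real n * h n ^ 3) *\<^sub>R (Lambda_mat (h n) *v (beta_hat n \<omega> - btilde n))"
  note cov = sandwich_covariance[OF invertible_Omega_mat[OF z(1)] transpose_V_mat _ f_x0]
  have c1: "transpose ?\<Sigma> = ?\<Sigma>"
    by (rule cov(1)) (rule V_mat_posdef[OF z(1)])
  have c2: "0 < c \<bullet> (?\<Sigma> *v c)" if "c \<noteq> 0" for c
    using that by (rule cov(2)[rotated]) (rule V_mat_posdef[OF z(1)])
  let ?C = "matrix_inv (f x0 *\<^sub>R (Omega_mat z :: ((real, 's) vec, 's) vec))"
  have c3: "c \<bullet> (?\<Sigma> *v c) = (transpose ?C *v c) \<bullet> ((f x0 *\<^sub>R V_mat z) *v (transpose ?C *v c))" for c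
    by (rule cov(3)) (rule V_mat_posdef[OF z(1)])
  have pm: "prob_space (mvnormal 0 ?\<Sigma>)"
    using c1 c2 by (rule prob_space_mvnormal)
  have ch: "(CLINT y|mvnormal 0 ?\<Sigma>. iexp (a \<bullet> y)) = complex_of_real (exp (- (a \<bullet> (?\<Sigma> *v a)) / 2))" for a
    using c1 c2 by (rule mvnormal_char)
  have Zm: "?Z n \<in> borel_measurable M" for n
  proof -
    have "continuous_on UNIV (\<lambda>c :: (real, 's) vec. sqrt (real n * h n ^ 3) *\<^sub>R (Lambda_mat (h n) *v (c - btilde n)))"
      by (intro continuous_intros bounded_linear.continuous_on[OF matrix_vector_mul_bounded_linear])
    from borel_measurable_continuous_on[OF this beta_hat_meas] show ?thesis .
  qed
  have close: "(\<lambda>n. prob {\<omega>\<in>space M. e < norm (?Z n \<omega> - matrix_inv (f x0 *\<^sub>R Omega_mat z) *v score_vec n \<omega>)}) \<longlonglongrightarrow> 0"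
    if "0 < e" for e
  proof (rule solve_close_in_probability[OF score_vec_measurable design_mat_measurable invertible_limit design_mat_tendsto score_vec_tight _ that])
    show "\<forall>\<^sub>F n in sequentially. \<forall>\<omega>\<in>space M. invertible (design_mat n \<omega>) \<longrightarrow> design_mat n \<omega> *v ?Z n \<omega> = score_vec n \<omega>"
      using eventually_gt_at_top[of 0] by eventually_elim (use solution in blast)
  qed
  show ?thesis
  proof (rule slutsky_levy[OF score_vec_measurable Zm score_vec_char score_vec_tight close pm])
    show "sets (mvnormal 0 ?\<Sigma>) = sets borel" by (simp add: mvnormal_def)
    show "(CLINT y|mvnormal 0 ?\<Sigma>. iexp (a \<bullet> y)) =
        complex_of_real (exp (- ((transpose (matrix_inv (f x0 *\<^sub>R Omega_mat z)) *v a) \<bullet>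
          ((f x0 *\<^sub>R V_mat z) *v (transpose (matrix_inv (f x0 *\<^sub>R Omega_mat z)) *v a))) / 2))" for a
      unfolding ch c3 ..
  qed
qed

end

theorem theorem1:
  fixes M :: "'a measure" and X :: "nat \<Rightarrow> 'a \<Rightarrow> real"
    and f L :: "real \<Rightarrow> real" and U :: ereal
    and h x :: "nat \<Rightarrow> real" and x0 z :: real
    and beta_hat :: "nat \<Rightarrow> 'a \<Rightarrow> real^'s::{finite,linorder}"
  assumes M: "prob_space M"
    and U: "0 < U"
    and f_pos: "\<And>y. y \<in> halfopen U \<Longrightarrow> 0 < f y"
    and f_zero: "\<And>y. y \<notin> halfopen U \<Longrightarrow> f y = 0"
    and indep: "prob_space.indep_vars M (\<lambda>_. borel) X UNIV"
    and density: "\<And>i. distributed M lborel (X i) (\<lambda>y. ennreal (f y))"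
    and L: "L = (\<lambda>y. ln (f y))"
    and h_pos: "\<And>n. 0 < h n"
    and h_lim: "h \<longlonglongrightarrow> 0"
    and nh3: "filterlim (\<lambda>n. real n * h n ^ 3) at_top sequentially"
    and point:
      "(0 < x0 \<and> ereal x0 < U \<and> (\<forall>n. x n = x0) \<and> z = 1) \<or>
       (x0 = 0 \<and> 0 \<le> z \<and> z \<le> 1 \<and> (\<forall>n. x n = z * h n))"
    and smooth: "cont_diff_near (halfopen U) (CARD('s) + 1) L x0"
    and beta_hat_meas: "\<And>n. beta_hat n \<in> borel_measurable M"
    and beta_hat: "\<And>n \<omega>. \<omega> \<in> space M \<Longrightarrow>
      (\<exists>!c :: (real, 's) vec. solves_system z n (h n) (x n) (\<lambda>i. X i \<omega>) c) \<Longrightarrow>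
      solves_system z n (h n) (x n) (\<lambda>i. X i \<omega>) (beta_hat n \<omega>)"
  shows
    "little_op M
       (\<lambda>n \<omega>. Lambda_mat (h n) *v
                (beta_tilde M (X 0) z (h n) (x n) - deriv_vec (halfopen U) L (x n))
              - (h n ^ CARD('s) * nth_deriv_within (halfopen U) (CARD('s) + 1) L (x n)) *\<^sub>R
                (b_vec z :: (real, 's) vec))
       (\<lambda>n. h n ^ CARD('s))
     \<and>
     conv_in_distribution M
       (\<lambda>n \<omega>. sqrt (real n * h n ^ 3) *\<^sub>R
                (Lambda_mat (h n) *v (beta_hat n \<omega> - beta_tilde M (X 0) z (h n) (x n))))
       (mvnormal 0
         ((1 / f x0) *\<^sub>R
          matrix_inv (transpose (Omega_mat z) ** matrix_inv (V_mat z) ** (Omega_mat z :: ((real, 's) vec, 's) vec))))"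
proof -
  interpret score_estimation M X f L U h x x0 z beta_hat
    by (rule score_estimation.intro) (fact assms)+
  show ?thesis
    using bias normality by blast
qed

end
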